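(* The comparison 2-functor $$\Gamma_{\mathrm f}\colon\mathbf{SFib}\longrightarrow\mathbf{Alg}_{\mathrm s}(\mathbb F)$$ is an isomorphism of 2-categories over $\mathbf{CAT}^{\mathbf 2}$. Hence split Grothendieck fibrations are strictly 2-monadic when the base is allowed to vary (i.e. the forgetful 2-functor $\mathbf{SFib}\to\mathbf{CAT}^{\mathbf 2}$ is strictly 2-monadic).
   Context: $\mathbf{CAT}$ is the strict 2-category of locally small categories, functors and natural transformations. $\mathbf{CAT}^{\mathbf 2}$ is the strict arrow 2-category: objects are functors $P\colon E\to B$; a 1-cell (square) $(T,S)\colon P\to Q$ is a pair of functors with $QT=SP$; a 2-cell $(\beta,\alpha)\colon(T,S)\Rightarrow(T',S')$ is a pair of natural transformations with $Q\beta=\alpha P$. **Split fibrations.** For $P\colon E\to B$, an arrow $e\colon z\to x$ is $P$-cartesian if every $g\colon y\to x$ and $v\colon Py\to Pz$ with $Pg=(Pe)v$ admit a unique $h\colon y\to z$ with $eh=g$, $Ph=v$. A cleavage chooses for every $x\in E$, $u\colon b\to Px$ a $P$-cartesian $\delta^x_u\colon u^*x\to x$ over $u$; it induces functors $u^*$ between fibres (for $f\colon x\to y$ in a fibre, $u^*f$ is the arrow over an identity with $\delta^y_u(u^*f)=f\delta^x_u$). It is split if $(1_a)^*=1_{E_a}$, $(uv)^*=v^*u^*$, $\delta^x_{1_{Px}}=1_x$, $\delta^x_{uv}=\delta^x_u\,\delta^{u^*x}_v$ for $u\colon b\to Px$, $v\colon c\to b$. $\mathbf{SFib}$: functors with a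 split cleavage as objects, squares $(T,S)$ with $T\delta^x_u=\delta^{Tx}_{Su}$ as 1-cells, all 2-cells of $\mathbf{CAT}^{\mathbf 2}$ between them. **Dual comma 2-monad $\mathbb F$ on $\mathbf{CAT}^{\mathbf 2}$.** $B\downarrow P$ has objects $(b,u,x)$ with $u\colon b\to Px$; an arrow $(s,f)\colon(b,u,x)\to(c,v,y)$ consists of $s\colon b\to c$, $f\colon x\to y$ with $Pf\,u=vs$. $\mathbb FP=\mathrm{Dom}_P\colon B\downarrow P\to B$, $(b,u,x)\mapsto b$, $(s,f)\mapsto s$. A square $(T,S)$ is sent to the square with base functor $S$ and total functor $(b,u,x)\mapsto(Sb,Su,Tx)$, $(s,f)\mapsto(Ss,Tf)$; a 2-cell $(\beta,\alpha)$ to the 2-cell with base component $\alpha$ and total component $(\alpha_b,\beta_x)$ at $(b,u,x)$. The unit has base component $1_B$ and total component $J^Px=(Px,1_{Px},x)$, $J^Pf=(Pf,f)$. The multiplication has base component $1_B$ and total component $(a,t,(b,u,x))\mapsto(a,ut,x)$, $(s,(r,f))\mapsto(s,f)$. **Strict algebras and comparison.** For a strict 2-monad $\mathbb T=(\mathbb T,\eta,\mu)$ on $\mathcal K$, $\mathbf{Alg}_{\mathrm s}(\mathbb T)$ has objects $a\colon\mathbb TX\to X$ with $a\eta_X=1_X$, $a\mu_X=a\,\mathbb Ta$; 1-cells $f$ with $fa=b\,\mathbb Tf$; 2-cells $\alpha\colon f\Rightarrow g$ with $\alpha a=b\,\mathbb T\alpha$. $\Gamma_{\mathrm f}$ sends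 a split fibration $P$ to the action $(A,1_B)\colon\mathbb FP\to P$ with $A(b,u,x)=u^*x$ and $A(s,f)\colon u^*x\to v^*y$, for $(s,f)\colon(b,u,x)\to(c,v,y)$, the unique arrow over $s$ with $\delta^y_v\,A(s,f)=f\,\delta^x_u$ (so that $A(u,1_x)=\delta^x_u$ for the canonical arrow $(u,1_x)\colon(b,u,x)\to J^Px$); it leaves underlying squares and 2-cells unchanged. "Over $\mathbf{CAT}^{\mathbf 2}$" means commuting strictly with the forgetful 2-functors. A right 2-adjoint $U\colon\mathcal A\to\mathcal K$ with counit $\varepsilon$ and induced 2-monad $\mathbb T$ is strictly 2-monadic if the comparison $\mathcal A\to\mathbf{Alg}_{\mathrm s}(\mathbb T)$, $A\mapsto U\varepsilon_A$, is an isomorphism of 2-categories over $\mathcal K$. *)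

theory Defs
  imports "HOL-Library.FuncSet"
begin

section \<open>Generalities\<close>

text \<open>
  Strict equations between functors and between natural transformations are meant literally, so
  all maps occurring in the cells of the 2-category of categories below are extensional: they are
  \<open>undefined\<close> outside their domain.  For abstract 2-categories this is not needed; equations between
  2-functors are stated on cells only.
\<close>

record ('o, 'a) cat =
  Ob :: "'o set"
  Ar :: "'a set"
  Dom :: "'a \<Rightarrow> 'o"
  Cod :: "'a \<Rightarrow> 'o"
  Idn :: "'o \<Rightarrow> 'a"
  Cmp :: "'a \<Rightarrow> 'a \<Rightarrow> 'a"  \<comment> \<open>\<open>Cmp C g f\<close> is the composite of \<open>f\<close> followed by \<open>g\<close>\<close>

definition category :: "('o, 'a) cat \<Rightarrow> bool" where
  "category C \<longleftrightarrow>
     (\<forall>f\<in>Ar C. Dom C f \<in> Ob C \<and> Cod C f \<in> Ob C) \<and>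
     (\<forall>x\<in>Ob C. Idn C x \<in> Ar C \<and> Dom C (Idn C x) = x \<and> Cod C (Idn C x) = x) \<and>
     (\<forall>f\<in>Ar C. \<forall>g\<in>Ar C. Cod C f = Dom C g \<longrightarrow>
        Cmp C g f \<in> Ar C \<and> Dom C (Cmp C g f) = Dom C f \<and> Cod C (Cmp C g f) = Cod C g) \<and>
     (\<forall>f\<in>Ar C. Cmp C f (Idn C (Dom C f)) = f \<and> Cmp C (Idn C (Cod C f)) f = f) \<and>
     (\<forall>f\<in>Ar C. \<forall>g\<in>Ar C. \<forall>h\<in>Ar C. Cod C f = Dom C g \<and> Cod C g = Dom C h \<longrightarrow>
        Cmp C h (Cmp C g f) = Cmp C (Cmp C h g) f)"

definition hom :: "('o, 'a) cat \<Rightarrow> 'o \<Rightarrow> 'o \<Rightarrow> 'a set" where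
  "hom C x y = {f \<in> Ar C. Dom C f = x \<and> Cod C f = y}"

section \<open>Strict 2-categories, 2-functors and 2-natural transformations\<close>

record ('o, 'f, 'c) twocat =
  cell0 :: "'o set"
  cell1 :: "'f set"
  cell2 :: "'c set"
  dom1 :: "'f \<Rightarrow> 'o"
  cod1 :: "'f \<Rightarrow> 'o"
  dom2 :: "'c \<Rightarrow> 'f"
  cod2 :: "'c \<Rightarrow> 'f"
  id1 :: "'o \<Rightarrow> 'f"
  id2 :: "'f \<Rightarrow> 'c"
  comp1 :: "'f \<Rightarrow> 'f \<Rightarrow> 'f"
  vcomp :: "'c \<Rightarrow> 'c \<Rightarrow> 'c"
  hcomp :: "'c \<Rightarrow> 'c \<Rightarrow> 'c"

definition underlying_cat :: "('o, 'f, 'c) twocat \<Rightarrow> ('o, 'f) cat" where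
  "underlying_cat K =
     \<lparr>Ob = cell0 K, Ar = cell1 K, Dom = dom1 K, Cod = cod1 K, Idn = id1 K, Cmp = comp1 K\<rparr>"

definition vertical_cat :: "('o, 'f, 'c) twocat \<Rightarrow> ('f, 'c) cat" where
  "vertical_cat K =
     \<lparr>Ob = cell1 K, Ar = cell2 K, Dom = dom2 K, Cod = cod2 K, Idn = id2 K, Cmp = vcomp K\<rparr>"

definition horizontal_cat :: "('o, 'f, 'c) twocat \<Rightarrow> ('o, 'c) cat" where
  "horizontal_cat K =
     \<lparr>Ob = cell0 K, Ar = cell2 K, Dom = (\<lambda>\<alpha>. dom1 K (dom2 K \<alpha>)), Cod = (\<lambda>\<alpha>. cod1 K (dom2 K \<alpha>)),
      Idn = (\<lambda>x. id2 K (id1 K x)), Cmp = hcomp K\<rparr>"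

definition two_category :: "('o, 'f, 'c) twocat \<Rightarrow> bool" where
  "two_category K \<longleftrightarrow>
     category (underlying_cat K) \<and> category (vertical_cat K) \<and> category (horizontal_cat K) \<and>
     (\<forall>\<alpha>\<in>cell2 K. dom1 K (dom2 K \<alpha>) = dom1 K (cod2 K \<alpha>) \<and> cod1 K (dom2 K \<alpha>) = cod1 K (cod2 K \<alpha>)) \<and>
     (\<forall>f\<in>cell1 K. \<forall>g\<in>cell1 K. cod1 K f = dom1 K g \<longrightarrow>
        id2 K (comp1 K g f) = hcomp K (id2 K g) (id2 K f)) \<and>
     (\<forall>\<alpha>\<in>cell2 K. \<forall>\<beta>\<in>cell2 K. cod1 K (dom2 K \<alpha>) = dom1 K (dom2 K \<beta>) \<longrightarrow>
        dom2 K (hcomp K \<beta> \<alpha>) = comp1 K (dom2 K \<beta>) (dom2 K \<alpha>) \<and>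
        cod2 K (hcomp K \<beta> \<alpha>) = comp1 K (cod2 K \<beta>) (cod2 K \<alpha>)) \<and>
     (\<forall>\<alpha>\<in>cell2 K. \<forall>\<alpha>'\<in>cell2 K. \<forall>\<beta>\<in>cell2 K. \<forall>\<beta>'\<in>cell2 K.
        cod2 K \<alpha> = dom2 K \<alpha>' \<and> cod2 K \<beta> = dom2 K \<beta>' \<and> cod1 K (dom2 K \<alpha>) = dom1 K (dom2 K \<beta>) \<longrightarrow>
        hcomp K (vcomp K \<beta>' \<beta>) (vcomp K \<alpha>' \<alpha>) = vcomp K (hcomp K \<beta>' \<alpha>') (hcomp K \<beta> \<alpha>))"

record ('o, 'f, 'c, 'o2, 'f2, 'c2) twofun =
  map0 :: "'o \<Rightarrow> 'o2"
  map1 :: "'f \<Rightarrow> 'f2"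
  map2 :: "'c \<Rightarrow> 'c2"

definition two_functor ::
  "('o, 'f, 'c) twocat \<Rightarrow> ('o2, 'f2, 'c2) twocat \<Rightarrow> ('o, 'f, 'c, 'o2, 'f2, 'c2) twofun \<Rightarrow> bool" where
  "two_functor A K F \<longleftrightarrow>
     two_category A \<and> two_category K \<and>
     (\<forall>x\<in>cell0 A. map0 F x \<in> cell0 K) \<and>
     (\<forall>f\<in>cell1 A. map1 F f \<in> cell1 K \<and>
        dom1 K (map1 F f) = map0 F (dom1 A f) \<and> cod1 K (map1 F f) = map0 F (cod1 A f)) \<and>
     (\<forall>\<alpha>\<in>cell2 A. map2 F \<alpha> \<in> cell2 K \<and>
        dom2 K (map2 F \<alpha>) = map1 F (dom2 A \<alpha>) \<and> cod2 K (map2 F \<alpha>) = map1 F (cod2 A \<alpha>)) \<and>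
     (\<forall>x\<in>cell0 A. map1 F (id1 A x) = id1 K (map0 F x)) \<and>
     (\<forall>f\<in>cell1 A. map2 F (id2 A f) = id2 K (map1 F f)) \<and>
     (\<forall>f\<in>cell1 A. \<forall>g\<in>cell1 A. cod1 A f = dom1 A g \<longrightarrow>
        map1 F (comp1 A g f) = comp1 K (map1 F g) (map1 F f)) \<and>
     (\<forall>\<alpha>\<in>cell2 A. \<forall>\<beta>\<in>cell2 A. cod2 A \<alpha> = dom2 A \<beta> \<longrightarrow>
        map2 F (vcomp A \<beta> \<alpha>) = vcomp K (map2 F \<beta>) (map2 F \<alpha>)) \<and>
     (\<forall>\<alpha>\<in>cell2 A. \<forall>\<beta>\<in>cell2 A. cod1 A (dom2 A \<alpha>) = dom1 A (dom2 A \<beta>) \<longrightarrow>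
        map2 F (hcomp A \<beta> \<alpha>) = hcomp K (map2 F \<beta>) (map2 F \<alpha>))"

definition twofun_id :: "('o, 'f, 'c, 'o, 'f, 'c) twofun" where
  "twofun_id = \<lparr>map0 = (\<lambda>x. x), map1 = (\<lambda>f. f), map2 = (\<lambda>\<alpha>. \<alpha>)\<rparr>"

definition twofun_comp ::
  "('o2, 'f2, 'c2, 'o3, 'f3, 'c3) twofun \<Rightarrow> ('o, 'f, 'c, 'o2, 'f2, 'c2) twofun
     \<Rightarrow> ('o, 'f, 'c, 'o3, 'f3, 'c3) twofun" where
  "twofun_comp G F = \<lparr>map0 = map0 G \<circ> map0 F, map1 = map1 G \<circ> map1 F, map2 = map2 G \<circ> map2 F\<rparr>"

definition twofun_eq ::
  "('o, 'f, 'c) twocat \<Rightarrow> ('o, 'f, 'c, 'o2, 'f2, 'c2) twofun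
     \<Rightarrow> ('o, 'f, 'c, 'o2, 'f2, 'c2) twofun \<Rightarrow> bool" where
  "twofun_eq A F G \<longleftrightarrow>
     (\<forall>x\<in>cell0 A. map0 F x = map0 G x) \<and>
     (\<forall>f\<in>cell1 A. map1 F f = map1 G f) \<and>
     (\<forall>\<alpha>\<in>cell2 A. map2 F \<alpha> = map2 G \<alpha>)"

definition two_iso ::
  "('o, 'f, 'c) twocat \<Rightarrow> ('o2, 'f2, 'c2) twocat \<Rightarrow> ('o, 'f, 'c, 'o2, 'f2, 'c2) twofun \<Rightarrow> bool" where
  "two_iso A K F \<longleftrightarrow> two_functor A K F \<and>
     (\<exists>G. two_functor K A G \<and>
        twofun_eq A (twofun_comp G F) twofun_id \<and> twofun_eq K (twofun_comp F G) twofun_id)"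

definition two_iso_over ::
  "('o3, 'f3, 'c3) twocat \<Rightarrow>
   ('o, 'f, 'c) twocat \<Rightarrow> ('o, 'f, 'c, 'o3, 'f3, 'c3) twofun \<Rightarrow>
   ('o2, 'f2, 'c2) twocat \<Rightarrow> ('o2, 'f2, 'c2, 'o3, 'f3, 'c3) twofun \<Rightarrow>
   ('o, 'f, 'c, 'o2, 'f2, 'c2) twofun \<Rightarrow> bool" where
  "two_iso_over K A U A' U' F \<longleftrightarrow>
     two_functor A K U \<and> two_functor A' K U' \<and> two_iso A A' F \<and> twofun_eq A (twofun_comp U' F) U"

definition two_natural ::
  "('o, 'f, 'c) twocat \<Rightarrow> ('o2, 'f2, 'c2) twocat \<Rightarrow> ('o, 'f, 'c, 'o2, 'f2, 'c2) twofun
     \<Rightarrow> ('o, 'f, 'c, 'o2, 'f2, 'c2) twofun \<Rightarrow> ('o \<Rightarrow> 'f2) \<Rightarrow> bool" where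
  "two_natural A K F G \<tau> \<longleftrightarrow>
     two_functor A K F \<and> two_functor A K G \<and>
     (\<forall>x\<in>cell0 A. \<tau> x \<in> cell1 K \<and> dom1 K (\<tau> x) = map0 F x \<and> cod1 K (\<tau> x) = map0 G x) \<and>
     (\<forall>f\<in>cell1 A. comp1 K (\<tau> (cod1 A f)) (map1 F f) = comp1 K (map1 G f) (\<tau> (dom1 A f))) \<and>
     (\<forall>\<alpha>\<in>cell2 A. hcomp K (id2 K (\<tau> (cod1 A (dom2 A \<alpha>)))) (map2 F \<alpha>)
                   = hcomp K (map2 G \<alpha>) (id2 K (\<tau> (dom1 A (dom2 A \<alpha>)))))"

definition prod_twocat ::
  "('o, 'f, 'c) twocat \<Rightarrow> ('o2, 'f2, 'c2) twocat \<Rightarrow> ('o \<times> 'o2, 'f \<times> 'f2, 'c \<times> 'c2) twocat" where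
  "prod_twocat K L =
     \<lparr>cell0 = cell0 K \<times> cell0 L, cell1 = cell1 K \<times> cell1 L, cell2 = cell2 K \<times> cell2 L,
      dom1 = (\<lambda>(f, g). (dom1 K f, dom1 L g)), cod1 = (\<lambda>(f, g). (cod1 K f, cod1 L g)),
      dom2 = (\<lambda>(\<alpha>, \<beta>). (dom2 K \<alpha>, dom2 L \<beta>)), cod2 = (\<lambda>(\<alpha>, \<beta>). (cod2 K \<alpha>, cod2 L \<beta>)),
      id1 = (\<lambda>(x, y). (id1 K x, id1 L y)), id2 = (\<lambda>(f, g). (id2 K f, id2 L g)),
      comp1 = (\<lambda>(f', g') (f, g). (comp1 K f' f, comp1 L g' g)),
      vcomp = (\<lambda>(\<alpha>', \<beta>') (\<alpha>, \<beta>). (vcomp K \<alpha>' \<alpha>, vcomp L \<beta>' \<beta>)),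
      hcomp = (\<lambda>(\<alpha>', \<beta>') (\<alpha>, \<beta>). (hcomp K \<alpha>' \<alpha>, hcomp L \<beta>' \<beta>))\<rparr>"

subsection \<open>2-categories of structured objects\<close>

text \<open>
  The arrow 2-category, the 2-category of strict algebras and the 2-category of split fibrations
  all have the following shape: objects are structured objects \<open>x \<in> X\<close> lying over an object \<open>p x\<close> of
  a 2-category \<open>K\<close>; 1-cells (2-cells) are 1-cells (2-cells) of \<open>K\<close> between the underlying data that
  satisfy a condition \<open>ok1\<close> (\<open>ok2\<close>), tagged with their source and target object; all operations are
  those of \<open>K\<close>.
\<close>

record ('x, 'k) tagged =
  osrc :: 'x
  otgt :: 'x
  und :: 'k

definition structured ::
  "('o, 'f, 'c) twocat \<Rightarrow> 'x set \<Rightarrow> ('x \<Rightarrow> 'o) \<Rightarrow> ('x \<Rightarrow> 'x \<Rightarrow> 'f \<Rightarrow> bool) \<Rightarrow> ('x \<Rightarrow> 'x \<Rightarrow> 'c \<Rightarrow> bool)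
     \<Rightarrow> ('x, ('x, 'f) tagged, ('x, 'c) tagged) twocat" where
  "structured K X p ok1 ok2 =
     (let C1 = {\<lparr>osrc = x, otgt = y, und = f\<rparr> | x y f.
                  x \<in> X \<and> y \<in> X \<and> f \<in> cell1 K \<and> dom1 K f = p x \<and> cod1 K f = p y \<and> ok1 x y f};
          s = (\<lambda>\<theta>. \<lparr>osrc = osrc \<theta>, otgt = otgt \<theta>, und = dom2 K (und \<theta>)\<rparr>);
          t = (\<lambda>\<theta>. \<lparr>osrc = osrc \<theta>, otgt = otgt \<theta>, und = cod2 K (und \<theta>)\<rparr>)
      in \<lparr>cell0 = X,
          cell1 = C1,
          cell2 = {\<theta>. und \<theta> \<in> cell2 K \<and> s \<theta> \<in> C1 \<and> t \<theta> \<in> C1 \<and> ok2 (osrc \<theta>) (otgt \<theta>) (und \<theta>)},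
          dom1 = osrc,
          cod1 = otgt,
          dom2 = s,
          cod2 = t,
          id1 = (\<lambda>x. \<lparr>osrc = x, otgt = x, und = id1 K (p x)\<rparr>),
          id2 = (\<lambda>h. \<lparr>osrc = osrc h, otgt = otgt h, und = id2 K (und h)\<rparr>),
          comp1 = (\<lambda>k h. \<lparr>osrc = osrc h, otgt = otgt k, und = comp1 K (und k) (und h)\<rparr>),
          vcomp = (\<lambda>\<theta>' \<theta>. \<lparr>osrc = osrc \<theta>, otgt = otgt \<theta>, und = vcomp K (und \<theta>') (und \<theta>)\<rparr>),
          hcomp = (\<lambda>\<theta>' \<theta>. \<lparr>osrc = osrc \<theta>, otgt = otgt \<theta>', und = hcomp K (und \<theta>') (und \<theta>)\<rparr>)\<rparr>)"

definition forget ::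
  "('x \<Rightarrow> 'o) \<Rightarrow> ('x, ('x, 'f) tagged, ('x, 'c) tagged, 'o, 'f, 'c) twofun" where
  "forget p = \<lparr>map0 = p, map1 = und, map2 = und\<rparr>"

text \<open>
  A 1-cell \<open>P \<rightarrow> Q\<close> of the arrow 2-category is a pair \<open>(T, S)\<close> with \<open>Q T = S P\<close>, a 2-cell is a pair
  \<open>(\<beta>, \<alpha>)\<close> with \<open>Q \<beta> = \<alpha> P\<close>; the first component belongs to the domains, the second to the codomains.
\<close>

definition arrow_twocat ::
  "('o, 'f, 'c) twocat \<Rightarrow> ('f, ('f, 'f \<times> 'f) tagged, ('f, 'c \<times> 'c) tagged) twocat" where
  "arrow_twocat K = structured (prod_twocat K K) (cell1 K) (\<lambda>P. (dom1 K P, cod1 K P))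
     (\<lambda>P Q (T, S). comp1 K Q T = comp1 K S P)
     (\<lambda>P Q (\<beta>, \<alpha>). hcomp K (id2 K Q) \<beta> = hcomp K \<alpha> (id2 K P))"

section \<open>Strict 2-monads, algebras and 2-monadicity\<close>

record ('o, 'f, 'c) twomonad =
  mfun :: "('o, 'f, 'c, 'o, 'f, 'c) twofun"
  munit :: "'o \<Rightarrow> 'f"
  mmult :: "'o \<Rightarrow> 'f"

definition two_monad :: "('o, 'f, 'c) twocat \<Rightarrow> ('o, 'f, 'c) twomonad \<Rightarrow> bool" where
  "two_monad K T \<longleftrightarrow>
     two_natural K K twofun_id (mfun T) (munit T) \<and>
     two_natural K K (twofun_comp (mfun T) (mfun T)) (mfun T) (mmult T) \<and>
     (\<forall>x\<in>cell0 K.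
        comp1 K (mmult T x) (munit T (map0 (mfun T) x)) = id1 K (map0 (mfun T) x) \<and>
        comp1 K (mmult T x) (map1 (mfun T) (munit T x)) = id1 K (map0 (mfun T) x) \<and>
        comp1 K (mmult T x) (mmult T (map0 (mfun T) x))
          = comp1 K (mmult T x) (map1 (mfun T) (mmult T x)))"

text \<open>An algebra is represented by its action; its carrier is the codomain of the action.\<close>

definition algebras :: "('o, 'f, 'c) twocat \<Rightarrow> ('o, 'f, 'c) twomonad \<Rightarrow> 'f set" where
  "algebras K T = {a \<in> cell1 K.
     dom1 K a = map0 (mfun T) (cod1 K a) \<and>
     comp1 K a (munit T (cod1 K a)) = id1 K (cod1 K a) \<and>
     comp1 K a (mmult T (cod1 K a)) = comp1 K a (map1 (mfun T) a)}"

definition Alg ::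
  "('o, 'f, 'c) twocat \<Rightarrow> ('o, 'f, 'c) twomonad \<Rightarrow> ('f, ('f, 'f) tagged, ('f, 'c) tagged) twocat" where
  "Alg K T = structured K (algebras K T) (cod1 K)
     (\<lambda>a b f. comp1 K f a = comp1 K b (map1 (mfun T) f))
     (\<lambda>a b \<alpha>. hcomp K \<alpha> (id2 K a) = hcomp K (id2 K b) (map2 (mfun T) \<alpha>))"

definition two_adjunction ::
  "('o, 'f, 'c) twocat \<Rightarrow> ('o2, 'f2, 'c2) twocat \<Rightarrow>
   ('o2, 'f2, 'c2, 'o, 'f, 'c) twofun \<Rightarrow> ('o, 'f, 'c, 'o2, 'f2, 'c2) twofun \<Rightarrow>
   ('o2 \<Rightarrow> 'f2) \<Rightarrow> ('o \<Rightarrow> 'f) \<Rightarrow> bool" where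
  "two_adjunction A K L U \<eta> \<epsilon> \<longleftrightarrow>
     two_functor K A L \<and> two_functor A K U \<and>
     two_natural K K twofun_id (twofun_comp U L) \<eta> \<and>
     two_natural A A (twofun_comp L U) twofun_id \<epsilon> \<and>
     (\<forall>x\<in>cell0 K. comp1 A (\<epsilon> (map0 L x)) (map1 L (\<eta> x)) = id1 A (map0 L x)) \<and>
     (\<forall>y\<in>cell0 A. comp1 K (map1 U (\<epsilon> y)) (\<eta> (map0 U y)) = id1 K (map0 U y))"

definition induced_monad ::
  "('o2, 'f2, 'c2, 'o, 'f, 'c) twofun \<Rightarrow> ('o, 'f, 'c, 'o2, 'f2, 'c2) twofun \<Rightarrow>
   ('o2 \<Rightarrow> 'f2) \<Rightarrow> ('o \<Rightarrow> 'f) \<Rightarrow> ('o2, 'f2, 'c2) twomonad" where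
  "induced_monad L U \<eta> \<epsilon> =
     \<lparr>mfun = twofun_comp U L, munit = \<eta>, mmult = (\<lambda>x. map1 U (\<epsilon> (map0 L x)))\<rparr>"

definition comparison ::
  "('o, 'f, 'c) twocat \<Rightarrow> ('o, 'f, 'c, 'o2, 'f2, 'c2) twofun \<Rightarrow> ('o \<Rightarrow> 'f) \<Rightarrow>
   ('o, 'f, 'c, 'f2, ('f2, 'f2) tagged, ('f2, 'c2) tagged) twofun" where
  "comparison A U \<epsilon> =
     \<lparr>map0 = (\<lambda>x. map1 U (\<epsilon> x)),
      map1 = (\<lambda>f. \<lparr>osrc = map1 U (\<epsilon> (dom1 A f)), otgt = map1 U (\<epsilon> (cod1 A f)), und = map1 U f\<rparr>),
      map2 = (\<lambda>\<alpha>. \<lparr>osrc = map1 U (\<epsilon> (dom1 A (dom2 A \<alpha>))), otgt = map1 U (\<epsilon> (cod1 A (dom2 A \<alpha>))),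
                    und = map2 U \<alpha>\<rparr>)\<rparr>"

definition strictly_two_monadic ::
  "('o, 'f, 'c) twocat \<Rightarrow> ('o2, 'f2, 'c2) twocat \<Rightarrow> ('o, 'f, 'c, 'o2, 'f2, 'c2) twofun \<Rightarrow> bool" where
  "strictly_two_monadic A K U \<longleftrightarrow>
     (\<exists>L \<eta> \<epsilon>. two_adjunction A K L U \<eta> \<epsilon> \<and>
        two_iso_over K A U (Alg K (induced_monad L U \<eta> \<epsilon>)) (forget (cod1 K)) (comparison A U \<epsilon>))"

section \<open>The 2-category of locally small categories\<close>

text \<open>
  Sets of elements of a type of class \<open>universe\<close> play the role of classes, the \<open>small\<close> ones that of
  sets.  Objects and arrows of the categories considered are elements of such a type; the pairing
  makes it possible to form comma categories inside it.
\<close>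

class universe =
  fixes pair :: "'a \<Rightarrow> 'a \<Rightarrow> 'a"
    and small :: "'a set \<Rightarrow> bool"
  assumes pair_inject: "pair a b = pair c d \<Longrightarrow> a = c \<and> b = d"
    and small_finite: "finite A \<Longrightarrow> small A"
    and small_subset: "small B \<Longrightarrow> A \<subseteq> B \<Longrightarrow> small A"
    and small_image: "small A \<Longrightarrow> small (f ` A)"
    and small_pairs: "small A \<Longrightarrow> small B \<Longrightarrow> small {pair a b | a b. a \<in> A \<and> b \<in> B}"

definition pfst :: "'u::universe \<Rightarrow> 'u" where
  "pfst z = (THE a. \<exists>b. z = pair a b)"

definition psnd :: "'u::universe \<Rightarrow> 'u" where
  "psnd z = (THE b. \<exists>a. z = pair a b)"

type_synonym 'u ucat = "('u, 'u) cat"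

definition ls_category :: "'u::universe ucat \<Rightarrow> bool" where
  "ls_category C \<longleftrightarrow> category C \<and>
     (\<forall>x\<in>Ob C. \<forall>y\<in>Ob C. small (hom C x y)) \<and>
     Dom C \<in> extensional (Ar C) \<and> Cod C \<in> extensional (Ar C) \<and> Idn C \<in> extensional (Ob C) \<and>
     (\<forall>f g. \<not> (f \<in> Ar C \<and> g \<in> Ar C \<and> Cod C f = Dom C g) \<longrightarrow> Cmp C g f = undefined)"

record 'u func =
  fdom :: "'u ucat"
  fcod :: "'u ucat"
  fob :: "'u \<Rightarrow> 'u"
  far :: "'u \<Rightarrow> 'u"

definition is_func :: "'u::universe func \<Rightarrow> bool" where
  "is_func F \<longleftrightarrow> (let C = fdom F; D = fcod F in
     ls_category C \<and> ls_category D \<and>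
     fob F \<in> extensional (Ob C) \<and> far F \<in> extensional (Ar C) \<and>
     (\<forall>x\<in>Ob C. fob F x \<in> Ob D) \<and>
     (\<forall>f\<in>Ar C. far F f \<in> Ar D \<and> Dom D (far F f) = fob F (Dom C f) \<and> Cod D (far F f) = fob F (Cod C f)) \<and>
     (\<forall>x\<in>Ob C. far F (Idn C x) = Idn D (fob F x)) \<and>
     (\<forall>f\<in>Ar C. \<forall>g\<in>Ar C. Cod C f = Dom C g \<longrightarrow> far F (Cmp C g f) = Cmp D (far F g) (far F f)))"

definition func_id :: "'u ucat \<Rightarrow> 'u func" where
  "func_id C = \<lparr>fdom = C, fcod = C, fob = (\<lambda>x\<in>Ob C. x), far = (\<lambda>f\<in>Ar C. f)\<rparr>"

definition func_comp :: "'u func \<Rightarrow> 'u func \<Rightarrow> 'u func" where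
  "func_comp G F = \<lparr>fdom = fdom F, fcod = fcod G,
     fob = (\<lambda>x\<in>Ob (fdom F). fob G (fob F x)), far = (\<lambda>f\<in>Ar (fdom F). far G (far F f))\<rparr>"

record 'u nt =
  ndom :: "'u func"
  ncod :: "'u func"
  ncmp :: "'u \<Rightarrow> 'u"

definition is_nt :: "'u::universe nt \<Rightarrow> bool" where
  "is_nt \<alpha> \<longleftrightarrow> (let F = ndom \<alpha>; G = ncod \<alpha>; C = fdom F; D = fcod F in
     is_func F \<and> is_func G \<and> fdom G = C \<and> fcod G = D \<and>
     ncmp \<alpha> \<in> extensional (Ob C) \<and>
     (\<forall>x\<in>Ob C. ncmp \<alpha> x \<in> hom D (fob F x) (fob G x)) \<and>
     (\<forall>f\<in>Ar C. Cmp D (ncmp \<alpha> (Cod C f)) (far F f) = Cmp D (far G f) (ncmp \<alpha> (Dom C f))))"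

definition nt_id :: "'u func \<Rightarrow> 'u nt" where
  "nt_id F = \<lparr>ndom = F, ncod = F, ncmp = (\<lambda>x\<in>Ob (fdom F). Idn (fcod F) (fob F x))\<rparr>"

definition nt_vcomp :: "'u nt \<Rightarrow> 'u nt \<Rightarrow> 'u nt" where
  "nt_vcomp \<beta> \<alpha> = \<lparr>ndom = ndom \<alpha>, ncod = ncod \<beta>,
     ncmp = (\<lambda>x\<in>Ob (fdom (ndom \<alpha>)). Cmp (fcod (ndom \<alpha>)) (ncmp \<beta> x) (ncmp \<alpha> x))\<rparr>"

definition nt_hcomp :: "'u nt \<Rightarrow> 'u nt \<Rightarrow> 'u nt" where
  "nt_hcomp \<beta> \<alpha> = \<lparr>ndom = func_comp (ndom \<beta>) (ndom \<alpha>), ncod = func_comp (ncod \<beta>) (ncod \<alpha>),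
     ncmp = (\<lambda>x\<in>Ob (fdom (ndom \<alpha>)).
       Cmp (fcod (ndom \<beta>)) (ncmp \<beta> (fob (ncod \<alpha>) x)) (far (ndom \<beta>) (ncmp \<alpha> x)))\<rparr>"

definition CAT :: "('u::universe ucat, 'u func, 'u nt) twocat" where
  "CAT = \<lparr>cell0 = {C. ls_category C}, cell1 = {F. is_func F}, cell2 = {\<alpha>. is_nt \<alpha>},
     dom1 = fdom, cod1 = fcod, dom2 = ndom, cod2 = ncod, id1 = func_id, id2 = nt_id,
     comp1 = func_comp, vcomp = nt_vcomp, hcomp = nt_hcomp\<rparr>"

type_synonym 'u sq = "('u func, 'u func \<times> 'u func) tagged"
type_synonym 'u sq2 = "('u func, 'u nt \<times> 'u nt) tagged"

definition CAT2 :: "('u::universe func, 'u sq, 'u sq2) twocat" where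
  "CAT2 = arrow_twocat CAT"

section \<open>Split fibrations\<close>

definition cartesian :: "'u func \<Rightarrow> 'u \<Rightarrow> bool" where
  "cartesian P e \<longleftrightarrow> (let E = fdom P; B = fcod P in
     e \<in> Ar E \<and>
     (\<forall>g\<in>Ar E. \<forall>v\<in>Ar B.
        Cod E g = Cod E e \<and> Dom B v = fob P (Dom E g) \<and> Cod B v = fob P (Dom E e) \<and>
        far P g = Cmp B (far P e) v \<longrightarrow>
        (\<exists>!h. h \<in> hom E (Dom E g) (Dom E e) \<and> Cmp E e h = g \<and> far P h = v)))"

definition liftable :: "'u func \<Rightarrow> ('u \<times> 'u) set" where
  "liftable P = {(x, u). x \<in> Ob (fdom P) \<and> u \<in> Ar (fcod P) \<and> Cod (fcod P) u = fob P x}"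

definition cleavage :: "'u func \<Rightarrow> ('u \<times> 'u \<Rightarrow> 'u) \<Rightarrow> bool" where
  "cleavage P \<delta> \<longleftrightarrow> \<delta> \<in> extensional (liftable P) \<and>
     (\<forall>(x, u)\<in>liftable P.
        cartesian P (\<delta> (x, u)) \<and> Cod (fdom P) (\<delta> (x, u)) = x \<and> far P (\<delta> (x, u)) = u)"

definition fibre :: "'u func \<Rightarrow> 'u \<Rightarrow> 'u ucat" where
  "fibre P b = (let E = fdom P; O' = {x \<in> Ob E. fob P x = b}; A' = {f \<in> Ar E. far P f = Idn (fcod P) b} in
     \<lparr>Ob = O', Ar = A', Dom = restrict (Dom E) A', Cod = restrict (Cod E) A', Idn = restrict (Idn E) O',
      Cmp = (\<lambda>g f. if f \<in> A' \<and> g \<in> A' \<and> Cod E f = Dom E g then Cmp E g f else undefined)\<rparr>)"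

definition reindex :: "'u func \<Rightarrow> ('u \<times> 'u \<Rightarrow> 'u) \<Rightarrow> 'u \<Rightarrow> 'u func" where
  "reindex P \<delta> u = (let E = fdom P; B = fcod P; F = fibre P (Cod B u); F' = fibre P (Dom B u) in
     \<lparr>fdom = F, fcod = F',
      fob = (\<lambda>x\<in>Ob F. Dom E (\<delta> (x, u))),
      far = (\<lambda>f\<in>Ar F. THE h. h \<in> hom F' (Dom E (\<delta> (Dom E f, u))) (Dom E (\<delta> (Cod E f, u))) \<and>
               Cmp E (\<delta> (Cod E f, u)) h = Cmp E f (\<delta> (Dom E f, u)))\<rparr>)"

definition split_cleavage :: "'u func \<Rightarrow> ('u \<times> 'u \<Rightarrow> 'u) \<Rightarrow> bool" where
  "split_cleavage P \<delta> \<longleftrightarrow> (let E = fdom P; B = fcod P in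
     cleavage P \<delta> \<and>
     (\<forall>a\<in>Ob B. reindex P \<delta> (Idn B a) = func_id (fibre P a)) \<and>
     (\<forall>u\<in>Ar B. \<forall>v\<in>Ar B. Cod B v = Dom B u \<longrightarrow>
        reindex P \<delta> (Cmp B u v) = func_comp (reindex P \<delta> v) (reindex P \<delta> u)) \<and>
     (\<forall>x\<in>Ob E. \<delta> (x, Idn B (fob P x)) = Idn E x) \<and>
     (\<forall>(x, u)\<in>liftable P. \<forall>v\<in>Ar B. Cod B v = Dom B u \<longrightarrow>
        \<delta> (x, Cmp B u v) = Cmp E (\<delta> (x, u)) (\<delta> (Dom E (\<delta> (x, u)), v))))"

type_synonym 'u splitfib = "'u func \<times> ('u \<times> 'u \<Rightarrow> 'u)"

definition SFib ::
  "('u::universe splitfib, ('u splitfib, 'u sq) tagged, ('u splitfib, 'u sq2) tagged) twocat" where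
  "SFib = structured CAT2 {(P, \<delta>). is_func P \<and> split_cleavage P \<delta>} fst
     (\<lambda>(P, \<delta>) (Q, \<gamma>) h. case und h of (T, S) \<Rightarrow>
        \<forall>(x, u)\<in>liftable P. far T (\<delta> (x, u)) = \<gamma> (fob T x, far S u))
     (\<lambda>_ _ _. True)"

section \<open>The dual comma 2-monad\<close>

text \<open>
  The object \<open>(b, u, x)\<close> of \<open>B \<down> P\<close> is coded by nested pairs.  The code of an arrow \<open>(s, f)\<close> also
  contains its domain \<open>X\<close> and codomain \<open>Y\<close>, which are not determined by \<open>s\<close> and \<open>f\<close>.
\<close>

definition cobj :: "'u::universe \<Rightarrow> 'u \<Rightarrow> 'u \<Rightarrow> 'u" where
  "cobj b u x = pair b (pair u x)"

definition cbase :: "'u::universe \<Rightarrow> 'u" where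
  "cbase X = pfst X"

definition cmor :: "'u::universe \<Rightarrow> 'u" where
  "cmor X = pfst (psnd X)"

definition ctop :: "'u::universe \<Rightarrow> 'u" where
  "ctop X = psnd (psnd X)"

definition carr :: "'u::universe \<Rightarrow> 'u \<Rightarrow> 'u \<Rightarrow> 'u \<Rightarrow> 'u" where
  "carr X Y s f = pair (pair X Y) (pair s f)"

definition adom :: "'u::universe \<Rightarrow> 'u" where
  "adom h = pfst (pfst h)"

definition acod :: "'u::universe \<Rightarrow> 'u" where
  "acod h = psnd (pfst h)"

definition abase :: "'u::universe \<Rightarrow> 'u" where
  "abase h = pfst (psnd h)"

definition atop :: "'u::universe \<Rightarrow> 'u" where
  "atop h = psnd (psnd h)"

definition comma :: "'u::universe func \<Rightarrow> 'u ucat" where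
  "comma P = (let E = fdom P; B = fcod P;
       O' = {cobj b u x | b u x. x \<in> Ob E \<and> u \<in> hom B b (fob P x)};
       A' = {carr X Y s f | X Y s f. X \<in> O' \<and> Y \<in> O' \<and>
               s \<in> hom B (cbase X) (cbase Y) \<and> f \<in> hom E (ctop X) (ctop Y) \<and>
               Cmp B (far P f) (cmor X) = Cmp B (cmor Y) s}
     in \<lparr>Ob = O', Ar = A', Dom = restrict adom A', Cod = restrict acod A',
         Idn = (\<lambda>X\<in>O'. carr X X (Idn B (cbase X)) (Idn E (ctop X))),
         Cmp = (\<lambda>k h. if h \<in> A' \<and> k \<in> A' \<and> acod h = adom k
                  then carr (adom h) (acod k) (Cmp B (abase k) (abase h)) (Cmp E (atop k) (atop h))
                  else undefined)\<rparr>)"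

definition DomF :: "'u::universe func \<Rightarrow> 'u func" where
  "DomF P = \<lparr>fdom = comma P, fcod = fcod P, fob = restrict cbase (Ob (comma P)),
     far = restrict abase (Ar (comma P))\<rparr>"

definition comma_ob :: "'u::universe func \<Rightarrow> 'u func \<Rightarrow> 'u \<Rightarrow> 'u" where
  "comma_ob T S X = cobj (fob S (cbase X)) (far S (cmor X)) (fob T (ctop X))"

definition comma_map :: "'u::universe func \<Rightarrow> 'u func \<Rightarrow> 'u func \<Rightarrow> 'u func \<Rightarrow> 'u func" where
  "comma_map P Q T S = \<lparr>fdom = comma P, fcod = comma Q,
     fob = restrict (comma_ob T S) (Ob (comma P)),
     far = (\<lambda>h\<in>Ar (comma P).
       carr (comma_ob T S (adom h)) (comma_ob T S (acod h)) (far S (abase h)) (far T (atop h)))\<rparr>"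

definition comma_nt :: "'u::universe func \<Rightarrow> 'u func \<Rightarrow> 'u nt \<Rightarrow> 'u nt \<Rightarrow> 'u nt" where
  "comma_nt P Q \<beta> \<alpha> =
     \<lparr>ndom = comma_map P Q (ndom \<beta>) (ndom \<alpha>), ncod = comma_map P Q (ncod \<beta>) (ncod \<alpha>),
      ncmp = (\<lambda>X\<in>Ob (comma P).
        carr (comma_ob (ndom \<beta>) (ndom \<alpha>) X) (comma_ob (ncod \<beta>) (ncod \<alpha>) X)
             (ncmp \<alpha> (cbase X)) (ncmp \<beta> (ctop X)))\<rparr>"

definition comma_fun ::
  "('u::universe func, 'u sq, 'u sq2, 'u func, 'u sq, 'u sq2) twofun" where
  "comma_fun =
     \<lparr>map0 = DomF,
      map1 = (\<lambda>h. case und h of (T, S) \<Rightarrow>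
        \<lparr>osrc = DomF (osrc h), otgt = DomF (otgt h), und = (comma_map (osrc h) (otgt h) T S, S)\<rparr>),
      map2 = (\<lambda>\<theta>. case und \<theta> of (\<beta>, \<alpha>) \<Rightarrow>
        \<lparr>osrc = DomF (osrc \<theta>), otgt = DomF (otgt \<theta>), und = (comma_nt (osrc \<theta>) (otgt \<theta>) \<beta> \<alpha>, \<alpha>)\<rparr>)\<rparr>"

definition comma_J_ob :: "'u::universe func \<Rightarrow> 'u \<Rightarrow> 'u" where
  "comma_J_ob P x = cobj (fob P x) (Idn (fcod P) (fob P x)) x"

definition comma_J :: "'u::universe func \<Rightarrow> 'u func" where
  "comma_J P = \<lparr>fdom = fdom P, fcod = comma P,
     fob = restrict (comma_J_ob P) (Ob (fdom P)),
     far = (\<lambda>f\<in>Ar (fdom P).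
       carr (comma_J_ob P (Dom (fdom P) f)) (comma_J_ob P (Cod (fdom P) f)) (far P f) f)\<rparr>"

definition comma_unit :: "'u::universe func \<Rightarrow> 'u sq" where
  "comma_unit P = \<lparr>osrc = P, otgt = DomF P, und = (comma_J P, func_id (fcod P))\<rparr>"

definition comma_M_ob :: "'u::universe func \<Rightarrow> 'u \<Rightarrow> 'u" where
  "comma_M_ob P Z =
     cobj (cbase Z) (Cmp (fcod P) (cmor (ctop Z)) (cmor Z)) (ctop (ctop Z))"

definition comma_M :: "'u::universe func \<Rightarrow> 'u func" where
  "comma_M P = \<lparr>fdom = comma (DomF P), fcod = comma P,
     fob = restrict (comma_M_ob P) (Ob (comma (DomF P))),
     far = (\<lambda>k\<in>Ar (comma (DomF P)).
       carr (comma_M_ob P (adom k)) (comma_M_ob P (acod k)) (abase k) (atop (atop k)))\<rparr>"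

definition comma_mult :: "'u::universe func \<Rightarrow> 'u sq" where
  "comma_mult P = \<lparr>osrc = DomF (DomF P), otgt = DomF P, und = (comma_M P, func_id (fcod P))\<rparr>"

definition comma_monad :: "('u::universe func, 'u sq, 'u sq2) twomonad" where
  "comma_monad = \<lparr>mfun = comma_fun, munit = comma_unit, mmult = comma_mult\<rparr>"

section \<open>The comparison for split fibrations\<close>

definition action_top :: "'u::universe splitfib \<Rightarrow> 'u func" where
  "action_top = (\<lambda>(P, \<delta>). let E = fdom P; d = (\<lambda>X. \<delta> (ctop X, cmor X)) in
     \<lparr>fdom = comma P, fcod = E,
      fob = (\<lambda>X\<in>Ob (comma P). Dom E (d X)),
      far = (\<lambda>h\<in>Ar (comma P).
        THE k. k \<in> hom E (Dom E (d (adom h))) (Dom E (d (acod h))) \<and> far P k = abase h \<and>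
               Cmp E (d (acod h)) k = Cmp E (atop h) (d (adom h)))\<rparr>)"

definition action :: "'u::universe splitfib \<Rightarrow> 'u sq" where
  "action Z = \<lparr>osrc = DomF (fst Z), otgt = fst Z, und = (action_top Z, func_id (fcod (fst Z)))\<rparr>"

definition Gamma_f ::
  "('u::universe splitfib, ('u splitfib, 'u sq) tagged, ('u splitfib, 'u sq2) tagged,
    'u sq, ('u sq, 'u sq) tagged, ('u sq, 'u sq2) tagged) twofun" where
  "Gamma_f =
     \<lparr>map0 = action,
      map1 = (\<lambda>h. \<lparr>osrc = action (osrc h), otgt = action (otgt h), und = und h\<rparr>),
      map2 = (\<lambda>\<theta>. \<lparr>osrc = action (osrc \<theta>), otgt = action (otgt \<theta>), und = und \<theta>\<rparr>)\<rparr>"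

definition U_SFib ::
  "('u::universe splitfib, ('u splitfib, 'u sq) tagged, ('u splitfib, 'u sq2) tagged,
    'u func, 'u sq, 'u sq2) twofun" where
  "U_SFib = forget fst"

end

theory Submission
  imports Defs
begin

text \<open>
  For an action \<open>A\<close> of the monad on \<open>P\<close> whose base component is the identity, put
  \<open>\<delta>\<^sup>x\<^sub>u = A(u, 1)\<close>, where \<open>(u, 1)\<close> is the canonical arrow \<open>(b, u, x) \<rightarrow> J x\<close>.
  The unit law gives \<open>\<delta>\<^sup>x\<^sub>u A(v, g) = A(J g) = g\<close> whenever \<open>P g = u v\<close>, so \<open>A(v, g)\<close> is a lift;
  conversely a lift \<open>h\<close> equals \<open>A(J h)\<close>, and the multiplication law shows that \<open>A\<close> sends
  \<open>(1, \<delta>\<^sup>x\<^sub>u) : J (u\<^sup>*x) \<rightarrow> (b, u, x)\<close> to an identity, so \<open>h = A(1, \<delta>\<^sup>x\<^sub>u) A(J h) = A(v, g)\<close>.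
  Hence the lifts are cartesian; the monad laws are exactly the splitting equations, and cartesianness
  makes \<open>A\<close>, the compatibility of morphisms and that of 2-cells determined by the lifts.
  Strict monadicity then follows by transporting the free-forgetful adjunction of the strict
  algebras along the isomorphism.
\<close>

section \<open>Strict 2-categories\<close>

text \<open>An isomorphism is claimed, not an equivalence, so every comparison is a literal
  equation. What makes this tractable is that 1-cells and 2-cells of \<open>SFib\<close> and of
  \<open>Alg\<close> are both cells of \<open>CAT2\<close> subject to a condition. The isomorphism
  thus reduces to a bijection on objects over \<open>CAT2\<close> under which the conditions on
  1-cells agree, and those on 2-cells agree whenever the boundary 1-cells are admissible.
  \<open>SFib\<close> imposes nothing on 2-cells, so the algebra equation has to be automatic: the
  component of \<beta> at \<open>u^*x\<close> lies over \<alpha> at b, and naturality of \<beta> at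
  the lift is exactly the equation that characterizes the action on (\<alpha> at b, \<beta> at x).
  That the base component of an action is an identity is itself a consequence of the unit law,
  because the unit has an identity in the base. An action is recovered from its values on canonical
  arrows because (s, f) followed by a canonical arrow equals a canonical arrow followed by J
  f.\<close>

lemma two_categoryD:
  assumes "two_category K"
  shows two_category_dom1: "f \<in> cell1 K \<Longrightarrow> dom1 K f \<in> cell0 K"
    and two_category_cod1: "f \<in> cell1 K \<Longrightarrow> cod1 K f \<in> cell0 K"
    and two_category_id1: "x \<in> cell0 K \<Longrightarrow> id1 K x \<in> cell1 K"
    and two_category_dom1_id1: "x \<in> cell0 K \<Longrightarrow> dom1 K (id1 K x) = x"
    and two_category_cod1_id1: "x \<in> cell0 K \<Longrightarrow> cod1 K (id1 K x) = x"
    and two_category_comp1: "\<lbrakk>f \<in> cell1 K; g \<in> cell1 K; cod1 K f = dom1 K g\<rbrakk> \<Longrightarrow> comp1 K g f \<in> cell1 K"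
    and two_category_dom1_comp1:
      "\<lbrakk>f \<in> cell1 K; g \<in> cell1 K; cod1 K f = dom1 K g\<rbrakk> \<Longrightarrow> dom1 K (comp1 K g f) = dom1 K f"
    and two_category_cod1_comp1:
      "\<lbrakk>f \<in> cell1 K; g \<in> cell1 K; cod1 K f = dom1 K g\<rbrakk> \<Longrightarrow> cod1 K (comp1 K g f) = cod1 K g"
    and two_category_comp1_id1: "f \<in> cell1 K \<Longrightarrow> comp1 K f (id1 K (dom1 K f)) = f"
    and two_category_id1_comp1: "f \<in> cell1 K \<Longrightarrow> comp1 K (id1 K (cod1 K f)) f = f"
    and two_category_comp1_assoc:
      "\<lbrakk>f \<in> cell1 K; g \<in> cell1 K; h \<in> cell1 K; cod1 K f = dom1 K g; cod1 K g = dom1 K h\<rbrakk>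
        \<Longrightarrow> comp1 K h (comp1 K g f) = comp1 K (comp1 K h g) f"
    and two_category_dom2: "\<alpha> \<in> cell2 K \<Longrightarrow> dom2 K \<alpha> \<in> cell1 K"
    and two_category_cod2: "\<alpha> \<in> cell2 K \<Longrightarrow> cod2 K \<alpha> \<in> cell1 K"
    and two_category_id2: "f \<in> cell1 K \<Longrightarrow> id2 K f \<in> cell2 K"
    and two_category_dom2_id2: "f \<in> cell1 K \<Longrightarrow> dom2 K (id2 K f) = f"
    and two_category_cod2_id2: "f \<in> cell1 K \<Longrightarrow> cod2 K (id2 K f) = f"
    and two_category_vcomp: "\<lbrakk>\<alpha> \<in> cell2 K; \<beta> \<in> cell2 K; cod2 K \<alpha> = dom2 K \<beta>\<rbrakk> \<Longrightarrow> vcomp K \<beta> \<alpha> \<in> cell2 K"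
    and two_category_dom2_vcomp:
      "\<lbrakk>\<alpha> \<in> cell2 K; \<beta> \<in> cell2 K; cod2 K \<alpha> = dom2 K \<beta>\<rbrakk> \<Longrightarrow> dom2 K (vcomp K \<beta> \<alpha>) = dom2 K \<alpha>"
    and two_category_cod2_vcomp:
      "\<lbrakk>\<alpha> \<in> cell2 K; \<beta> \<in> cell2 K; cod2 K \<alpha> = dom2 K \<beta>\<rbrakk> \<Longrightarrow> cod2 K (vcomp K \<beta> \<alpha>) = cod2 K \<beta>"
    and two_category_vcomp_id2: "\<alpha> \<in> cell2 K \<Longrightarrow> vcomp K \<alpha> (id2 K (dom2 K \<alpha>)) = \<alpha>"
    and two_category_id2_vcomp: "\<alpha> \<in> cell2 K \<Longrightarrow> vcomp K (id2 K (cod2 K \<alpha>)) \<alpha> = \<alpha>"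
    and two_category_vcomp_assoc:
      "\<lbrakk>\<alpha> \<in> cell2 K; \<beta> \<in> cell2 K; \<gamma> \<in> cell2 K; cod2 K \<alpha> = dom2 K \<beta>; cod2 K \<beta> = dom2 K \<gamma>\<rbrakk>
        \<Longrightarrow> vcomp K \<gamma> (vcomp K \<beta> \<alpha>) = vcomp K (vcomp K \<gamma> \<beta>) \<alpha>"
    and two_category_dom1_cod2: "\<alpha> \<in> cell2 K \<Longrightarrow> dom1 K (cod2 K \<alpha>) = dom1 K (dom2 K \<alpha>)"
    and two_category_cod1_cod2: "\<alpha> \<in> cell2 K \<Longrightarrow> cod1 K (cod2 K \<alpha>) = cod1 K (dom2 K \<alpha>)"
    and two_category_hcomp:
      "\<lbrakk>\<alpha> \<in> cell2 K; \<beta> \<in> cell2 K; cod1 K (dom2 K \<alpha>) = dom1 K (dom2 K \<beta>)\<rbrakk> \<Longrightarrow> hcomp K \<beta> \<alpha> \<in> cell2 K"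
    and two_category_dom2_hcomp:
      "\<lbrakk>\<alpha> \<in> cell2 K; \<beta> \<in> cell2 K; cod1 K (dom2 K \<alpha>) = dom1 K (dom2 K \<beta>)\<rbrakk>
        \<Longrightarrow> dom2 K (hcomp K \<beta> \<alpha>) = comp1 K (dom2 K \<beta>) (dom2 K \<alpha>)"
    and two_category_cod2_hcomp:
      "\<lbrakk>\<alpha> \<in> cell2 K; \<beta> \<in> cell2 K; cod1 K (dom2 K \<alpha>) = dom1 K (dom2 K \<beta>)\<rbrakk>
        \<Longrightarrow> cod2 K (hcomp K \<beta> \<alpha>) = comp1 K (cod2 K \<beta>) (cod2 K \<alpha>)"
    and two_category_hcomp_id1: "\<alpha> \<in> cell2 K \<Longrightarrow> hcomp K \<alpha> (id2 K (id1 K (dom1 K (dom2 K \<alpha>)))) = \<alpha>"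
    and two_category_id1_hcomp: "\<alpha> \<in> cell2 K \<Longrightarrow> hcomp K (id2 K (id1 K (cod1 K (dom2 K \<alpha>)))) \<alpha> = \<alpha>"
    and two_category_hcomp_assoc:
      "\<lbrakk>\<alpha> \<in> cell2 K; \<beta> \<in> cell2 K; \<gamma> \<in> cell2 K;
        cod1 K (dom2 K \<alpha>) = dom1 K (dom2 K \<beta>); cod1 K (dom2 K \<beta>) = dom1 K (dom2 K \<gamma>)\<rbrakk>
        \<Longrightarrow> hcomp K \<gamma> (hcomp K \<beta> \<alpha>) = hcomp K (hcomp K \<gamma> \<beta>) \<alpha>"
    and two_category_id2_comp1:
      "\<lbrakk>f \<in> cell1 K; g \<in> cell1 K; cod1 K f = dom1 K g\<rbrakk>
        \<Longrightarrow> id2 K (comp1 K g f) = hcomp K (id2 K g) (id2 K f)"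
    and two_category_interchange:
      "\<lbrakk>\<alpha> \<in> cell2 K; \<alpha>' \<in> cell2 K; \<beta> \<in> cell2 K; \<beta>' \<in> cell2 K;
        cod2 K \<alpha> = dom2 K \<alpha>'; cod2 K \<beta> = dom2 K \<beta>'; cod1 K (dom2 K \<alpha>) = dom1 K (dom2 K \<beta>)\<rbrakk>
        \<Longrightarrow> hcomp K (vcomp K \<beta>' \<beta>) (vcomp K \<alpha>' \<alpha>) = vcomp K (hcomp K \<beta>' \<alpha>') (hcomp K \<beta> \<alpha>)"
  by (insert assms; unfold two_category_def category_def underlying_cat_def vertical_cat_def
      horizontal_cat_def cat.simps; elim conjE; simp)+

lemmas two_category_cells =
  two_category_dom1 two_category_cod1 two_category_id1 two_category_dom1_id1 two_category_cod1_id1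
  two_category_comp1 two_category_dom1_comp1 two_category_cod1_comp1
  two_category_dom2 two_category_cod2 two_category_id2 two_category_dom2_id2 two_category_cod2_id2
  two_category_vcomp two_category_dom2_vcomp two_category_cod2_vcomp
  two_category_dom1_cod2 two_category_cod1_cod2
  two_category_hcomp two_category_dom2_hcomp two_category_cod2_hcomp

lemmas two_category_units =
  two_category_comp1_id1 two_category_id1_comp1 two_category_vcomp_id2 two_category_id2_vcomp
  two_category_hcomp_id1 two_category_id1_hcomp

lemma two_functorD:
  assumes "two_functor A K F"
  shows two_functor_dom: "two_category A" and two_functor_cod: "two_category K"
    and two_functor_map0: "x \<in> cell0 A \<Longrightarrow> map0 F x \<in> cell0 K"
    and two_functor_map1: "f \<in> cell1 A \<Longrightarrow> map1 F f \<in> cell1 K"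
    and two_functor_dom1: "f \<in> cell1 A \<Longrightarrow> dom1 K (map1 F f) = map0 F (dom1 A f)"
    and two_functor_cod1: "f \<in> cell1 A \<Longrightarrow> cod1 K (map1 F f) = map0 F (cod1 A f)"
    and two_functor_map2: "\<alpha> \<in> cell2 A \<Longrightarrow> map2 F \<alpha> \<in> cell2 K"
    and two_functor_dom2: "\<alpha> \<in> cell2 A \<Longrightarrow> dom2 K (map2 F \<alpha>) = map1 F (dom2 A \<alpha>)"
    and two_functor_cod2: "\<alpha> \<in> cell2 A \<Longrightarrow> cod2 K (map2 F \<alpha>) = map1 F (cod2 A \<alpha>)"
    and two_functor_id1: "x \<in> cell0 A \<Longrightarrow> map1 F (id1 A x) = id1 K (map0 F x)"
    and two_functor_id2: "f \<in> cell1 A \<Longrightarrow> map2 F (id2 A f) = id2 K (map1 F f)"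
    and two_functor_comp1: "\<lbrakk>f \<in> cell1 A; g \<in> cell1 A; cod1 A f = dom1 A g\<rbrakk>
        \<Longrightarrow> map1 F (comp1 A g f) = comp1 K (map1 F g) (map1 F f)"
    and two_functor_vcomp: "\<lbrakk>\<alpha> \<in> cell2 A; \<beta> \<in> cell2 A; cod2 A \<alpha> = dom2 A \<beta>\<rbrakk>
        \<Longrightarrow> map2 F (vcomp A \<beta> \<alpha>) = vcomp K (map2 F \<beta>) (map2 F \<alpha>)"
    and two_functor_hcomp: "\<lbrakk>\<alpha> \<in> cell2 A; \<beta> \<in> cell2 A; cod1 A (dom2 A \<alpha>) = dom1 A (dom2 A \<beta>)\<rbrakk>
        \<Longrightarrow> map2 F (hcomp A \<beta> \<alpha>) = hcomp K (map2 F \<beta>) (map2 F \<alpha>)"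
  by (insert assms; unfold two_functor_def; elim conjE; blast)+

lemmas two_functor_cells =
  two_functor_map0 two_functor_map1 two_functor_dom1 two_functor_cod1
  two_functor_map2 two_functor_dom2 two_functor_cod2

lemmas two_functor_ops =
  two_functor_id1 two_functor_id2 two_functor_comp1 two_functor_vcomp two_functor_hcomp

text \<open>\<open>twofun_eq\<close> compares on cells only, so being a 2-functor has to be shown
  invariant under it. The cells of \<open>A\<close> are closed under its operations, hence every
  equation is evaluated where \<open>F\<close> and \<open>G\<close> agree.\<close>

lemma two_functor_cong:
  assumes "two_functor A K F" "twofun_eq A F G"
  shows "two_functor A K G"
proof -
  note A = two_functor_dom[OF assms(1)]
  have [simp]: "\<And>x. x \<in> cell0 A \<Longrightarrow> map0 G x = map0 F x" "\<And>f. f \<in> cell1 A \<Longrightarrow> map1 G f = map1 F f"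
    "\<And>\<alpha>. \<alpha> \<in> cell2 A \<Longrightarrow> map2 G \<alpha> = map2 F \<alpha>"
    using assms(2) by (auto simp: twofun_eq_def)
  show ?thesis
    using assms(1) unfolding two_functor_def by (simp add: two_category_cells[OF A])
qed

lemma two_functor_id: "two_category K \<Longrightarrow> two_functor K K twofun_id"
  by (simp add: two_functor_def twofun_id_def)

lemma two_functor_comp:
  assumes "two_functor A K F" "two_functor K L G"
  shows "two_functor A L (twofun_comp G F)"
  unfolding two_functor_def
  using two_functor_dom[OF assms(1)] two_functor_cod[OF assms(2)]
  by (simp add: twofun_comp_def two_category_cells[OF two_functor_dom[OF assms(1)]]
      two_functor_cells[OF assms(1)] two_functor_cells[OF assms(2)]
      two_functor_ops[OF assms(1)] two_functor_ops[OF assms(2)])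

text \<open>Needed because a composite \<open>U L\<close> agrees with the 2-functor of a monad on
  cells without being the same record.\<close>

lemma two_natural_cong:
  assumes n: "two_natural A K F G \<tau>"
    and F: "twofun_eq A F F'" and G: "twofun_eq A G G'"
    and \<tau>: "\<And>x. x \<in> cell0 A \<Longrightarrow> \<tau>' x = \<tau> x"
  shows "two_natural A K F' G' \<tau>'"
proof -
  have f: "two_functor A K F" "two_functor A K G" using n by (auto simp: two_natural_def)
  note A = two_functor_dom[OF f(1)]
  have [simp]: "\<And>x. x \<in> cell0 A \<Longrightarrow> map0 F' x = map0 F x" "\<And>f. f \<in> cell1 A \<Longrightarrow> map1 F' f = map1 F f"
    "\<And>\<alpha>. \<alpha> \<in> cell2 A \<Longrightarrow> map2 F' \<alpha> = map2 F \<alpha>"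
    "\<And>x. x \<in> cell0 A \<Longrightarrow> map0 G' x = map0 G x" "\<And>f. f \<in> cell1 A \<Longrightarrow> map1 G' f = map1 G f"
    "\<And>\<alpha>. \<alpha> \<in> cell2 A \<Longrightarrow> map2 G' \<alpha> = map2 G \<alpha>"
    using F G by (auto simp: twofun_eq_def)
  show ?thesis
    using n two_functor_cong[OF f(1) F] two_functor_cong[OF f(2) G] \<tau>
    unfolding two_natural_def by (simp add: two_category_cells[OF A])
qed

text \<open>Flattens the three auxiliary categories of the definition. The endpoints of a horizontal
  composite and of a horizontal identity follow from the laws for 1-cells, so an instance checks
  each law just once.\<close>

lemma two_categoryI:
  assumes
    "\<And>f. f \<in> cell1 K \<Longrightarrow> dom1 K f \<in> cell0 K \<and> cod1 K f \<in> cell0 K"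
    "\<And>x. x \<in> cell0 K \<Longrightarrow> id1 K x \<in> cell1 K \<and> dom1 K (id1 K x) = x \<and> cod1 K (id1 K x) = x"
    "\<And>f g. \<lbrakk>f \<in> cell1 K; g \<in> cell1 K; cod1 K f = dom1 K g\<rbrakk>
      \<Longrightarrow> comp1 K g f \<in> cell1 K \<and> dom1 K (comp1 K g f) = dom1 K f \<and> cod1 K (comp1 K g f) = cod1 K g"
    "\<And>f. f \<in> cell1 K \<Longrightarrow> comp1 K f (id1 K (dom1 K f)) = f \<and> comp1 K (id1 K (cod1 K f)) f = f"
    "\<And>f g h. \<lbrakk>f \<in> cell1 K; g \<in> cell1 K; h \<in> cell1 K; cod1 K f = dom1 K g; cod1 K g = dom1 K h\<rbrakk>
      \<Longrightarrow> comp1 K h (comp1 K g f) = comp1 K (comp1 K h g) f"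
    "\<And>\<alpha>. \<alpha> \<in> cell2 K \<Longrightarrow> dom2 K \<alpha> \<in> cell1 K \<and> cod2 K \<alpha> \<in> cell1 K \<and>
      dom1 K (dom2 K \<alpha>) = dom1 K (cod2 K \<alpha>) \<and> cod1 K (dom2 K \<alpha>) = cod1 K (cod2 K \<alpha>)"
    "\<And>f. f \<in> cell1 K \<Longrightarrow> id2 K f \<in> cell2 K \<and> dom2 K (id2 K f) = f \<and> cod2 K (id2 K f) = f"
    "\<And>\<alpha> \<beta>. \<lbrakk>\<alpha> \<in> cell2 K; \<beta> \<in> cell2 K; cod2 K \<alpha> = dom2 K \<beta>\<rbrakk>
      \<Longrightarrow> vcomp K \<beta> \<alpha> \<in> cell2 K \<and> dom2 K (vcomp K \<beta> \<alpha>) = dom2 K \<alpha> \<and> cod2 K (vcomp K \<beta> \<alpha>) = cod2 K \<beta>"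
    "\<And>\<alpha>. \<alpha> \<in> cell2 K \<Longrightarrow> vcomp K \<alpha> (id2 K (dom2 K \<alpha>)) = \<alpha> \<and> vcomp K (id2 K (cod2 K \<alpha>)) \<alpha> = \<alpha>"
    "\<And>\<alpha> \<beta> \<gamma>. \<lbrakk>\<alpha> \<in> cell2 K; \<beta> \<in> cell2 K; \<gamma> \<in> cell2 K; cod2 K \<alpha> = dom2 K \<beta>; cod2 K \<beta> = dom2 K \<gamma>\<rbrakk>
      \<Longrightarrow> vcomp K \<gamma> (vcomp K \<beta> \<alpha>) = vcomp K (vcomp K \<gamma> \<beta>) \<alpha>"
    "\<And>\<alpha> \<beta>. \<lbrakk>\<alpha> \<in> cell2 K; \<beta> \<in> cell2 K; cod1 K (dom2 K \<alpha>) = dom1 K (dom2 K \<beta>)\<rbrakk>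
      \<Longrightarrow> hcomp K \<beta> \<alpha> \<in> cell2 K \<and> dom2 K (hcomp K \<beta> \<alpha>) = comp1 K (dom2 K \<beta>) (dom2 K \<alpha>) \<and>
        cod2 K (hcomp K \<beta> \<alpha>) = comp1 K (cod2 K \<beta>) (cod2 K \<alpha>)"
    "\<And>\<alpha>. \<alpha> \<in> cell2 K \<Longrightarrow> hcomp K \<alpha> (id2 K (id1 K (dom1 K (dom2 K \<alpha>)))) = \<alpha> \<and>
      hcomp K (id2 K (id1 K (cod1 K (dom2 K \<alpha>)))) \<alpha> = \<alpha>"
    "\<And>\<alpha> \<beta> \<gamma>. \<lbrakk>\<alpha> \<in> cell2 K; \<beta> \<in> cell2 K; \<gamma> \<in> cell2 K;
        cod1 K (dom2 K \<alpha>) = dom1 K (dom2 K \<beta>); cod1 K (dom2 K \<beta>) = dom1 K (dom2 K \<gamma>)\<rbrakk>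
      \<Longrightarrow> hcomp K \<gamma> (hcomp K \<beta> \<alpha>) = hcomp K (hcomp K \<gamma> \<beta>) \<alpha>"
    "\<And>f g. \<lbrakk>f \<in> cell1 K; g \<in> cell1 K; cod1 K f = dom1 K g\<rbrakk>
      \<Longrightarrow> id2 K (comp1 K g f) = hcomp K (id2 K g) (id2 K f)"
    "\<And>\<alpha> \<alpha>' \<beta> \<beta>'. \<lbrakk>\<alpha> \<in> cell2 K; \<alpha>' \<in> cell2 K; \<beta> \<in> cell2 K; \<beta>' \<in> cell2 K;
        cod2 K \<alpha> = dom2 K \<alpha>'; cod2 K \<beta> = dom2 K \<beta>'; cod1 K (dom2 K \<alpha>) = dom1 K (dom2 K \<beta>)\<rbrakk>
      \<Longrightarrow> hcomp K (vcomp K \<beta>' \<beta>) (vcomp K \<alpha>' \<alpha>) = vcomp K (hcomp K \<beta>' \<alpha>') (hcomp K \<beta> \<alpha>)"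
  shows "two_category K"
proof -
  have "category (underlying_cat K)"
    unfolding category_def underlying_cat_def cat.simps using assms(1-5) by blast
  moreover have "category (vertical_cat K)"
    unfolding category_def vertical_cat_def cat.simps using assms(6-10) by blast
  moreover have "category (horizontal_cat K)"
    unfolding category_def horizontal_cat_def cat.simps
    using assms(1-3,6,7,11-13) by (intro conjI ballI impI) simp_all
  moreover have "\<forall>\<alpha>\<in>cell2 K. dom1 K (dom2 K \<alpha>) = dom1 K (cod2 K \<alpha>) \<and> cod1 K (dom2 K \<alpha>) = cod1 K (cod2 K \<alpha>)"
    using assms(6) by simp
  moreover have "\<forall>f\<in>cell1 K. \<forall>g\<in>cell1 K. cod1 K f = dom1 K g \<longrightarrow>
      id2 K (comp1 K g f) = hcomp K (id2 K g) (id2 K f)"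
    using assms(14) by simp
  moreover have "\<forall>\<alpha>\<in>cell2 K. \<forall>\<beta>\<in>cell2 K. cod1 K (dom2 K \<alpha>) = dom1 K (dom2 K \<beta>) \<longrightarrow>
      dom2 K (hcomp K \<beta> \<alpha>) = comp1 K (dom2 K \<beta>) (dom2 K \<alpha>) \<and>
      cod2 K (hcomp K \<beta> \<alpha>) = comp1 K (cod2 K \<beta>) (cod2 K \<alpha>)"
    using assms(11) by simp
  moreover have "\<forall>\<alpha>\<in>cell2 K. \<forall>\<alpha>'\<in>cell2 K. \<forall>\<beta>\<in>cell2 K. \<forall>\<beta>'\<in>cell2 K.
      cod2 K \<alpha> = dom2 K \<alpha>' \<and> cod2 K \<beta> = dom2 K \<beta>' \<and> cod1 K (dom2 K \<alpha>) = dom1 K (dom2 K \<beta>) \<longrightarrow>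
      hcomp K (vcomp K \<beta>' \<beta>) (vcomp K \<alpha>' \<alpha>) = vcomp K (hcomp K \<beta>' \<alpha>') (hcomp K \<beta> \<alpha>)"
    using assms(15) by simp
  ultimately show ?thesis
    unfolding two_category_def by (intro conjI)
qed

lemma two_category_prod:
  assumes "two_category K" "two_category L"
  shows "two_category (prod_twocat K L)"
  by (rule two_categoryI) (auto simp: prod_twocat_def two_category_cells[OF assms(1)] two_category_cells[OF assms(2)]
      two_category_units[OF assms(1)] two_category_units[OF assms(2)]
      two_category_comp1_assoc[OF assms(1)] two_category_comp1_assoc[OF assms(2)]
      two_category_vcomp_assoc[OF assms(1)] two_category_vcomp_assoc[OF assms(2)]
      two_category_hcomp_assoc[OF assms(1)] two_category_hcomp_assoc[OF assms(2)]
      two_category_id2_comp1[OF assms(1)] two_category_id2_comp1[OF assms(2)]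
      two_category_interchange[OF assms(1)] two_category_interchange[OF assms(2)])

lemma two_functor_fst:
  assumes "two_category K" "two_category L"
  shows "two_functor (prod_twocat K L) K \<lparr>map0 = fst, map1 = fst, map2 = fst\<rparr>"
  using two_category_prod[OF assms] assms(1)
  by (auto simp: two_functor_def prod_twocat_def)

lemma two_functor_snd:
  assumes "two_category K" "two_category L"
  shows "two_functor (prod_twocat K L) L \<lparr>map0 = snd, map1 = snd, map2 = snd\<rparr>"
  using two_category_prod[OF assms] assms(2)
  by (auto simp: two_functor_def prod_twocat_def)

subsection \<open>2-categories of structured objects\<close>

lemma structured_cell0 [simp]: "cell0 (structured K X p ok1 ok2) = X"
  by (simp add: structured_def Let_def)

lemma structured_cell1:
  "h \<in> cell1 (structured K X p ok1 ok2) \<longleftrightarrow>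
     osrc h \<in> X \<and> otgt h \<in> X \<and> und h \<in> cell1 K \<and>
     dom1 K (und h) = p (osrc h) \<and> cod1 K (und h) = p (otgt h) \<and> ok1 (osrc h) (otgt h) (und h)"
  by (cases h) (auto simp: structured_def Let_def)

lemma structured_cell2:
  "\<theta> \<in> cell2 (structured K X p ok1 ok2) \<longleftrightarrow>
     osrc \<theta> \<in> X \<and> otgt \<theta> \<in> X \<and> und \<theta> \<in> cell2 K \<and>
     dom2 K (und \<theta>) \<in> cell1 K \<and> cod2 K (und \<theta>) \<in> cell1 K \<and>
     dom1 K (dom2 K (und \<theta>)) = p (osrc \<theta>) \<and> cod1 K (dom2 K (und \<theta>)) = p (otgt \<theta>) \<and>
     dom1 K (cod2 K (und \<theta>)) = p (osrc \<theta>) \<and> cod1 K (cod2 K (und \<theta>)) = p (otgt \<theta>) \<and>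
     ok1 (osrc \<theta>) (otgt \<theta>) (dom2 K (und \<theta>)) \<and> ok1 (osrc \<theta>) (otgt \<theta>) (cod2 K (und \<theta>)) \<and>
     ok2 (osrc \<theta>) (otgt \<theta>) (und \<theta>)"
  by (cases \<theta>) (auto simp: structured_def Let_def)

lemma structured_sel [simp]:
  "dom1 (structured K X p ok1 ok2) = osrc"
  "cod1 (structured K X p ok1 ok2) = otgt"
  "dom2 (structured K X p ok1 ok2) \<theta> = \<lparr>osrc = osrc \<theta>, otgt = otgt \<theta>, und = dom2 K (und \<theta>)\<rparr>"
  "cod2 (structured K X p ok1 ok2) \<theta> = \<lparr>osrc = osrc \<theta>, otgt = otgt \<theta>, und = cod2 K (und \<theta>)\<rparr>"
  "id1 (structured K X p ok1 ok2) x = \<lparr>osrc = x, otgt = x, und = id1 K (p x)\<rparr>"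
  "id2 (structured K X p ok1 ok2) h = \<lparr>osrc = osrc h, otgt = otgt h, und = id2 K (und h)\<rparr>"
  "comp1 (structured K X p ok1 ok2) k h = \<lparr>osrc = osrc h, otgt = otgt k, und = comp1 K (und k) (und h)\<rparr>"
  "vcomp (structured K X p ok1 ok2) \<theta>' \<theta> = \<lparr>osrc = osrc \<theta>, otgt = otgt \<theta>, und = vcomp K (und \<theta>') (und \<theta>)\<rparr>"
  "hcomp (structured K X p ok1 ok2) \<theta>' \<theta> = \<lparr>osrc = osrc \<theta>, otgt = otgt \<theta>', und = hcomp K (und \<theta>') (und \<theta>)\<rparr>"
  by (simp_all add: structured_def Let_def)

lemma tagged_eq_iff: "h = k \<longleftrightarrow> osrc h = osrc k \<and> otgt h = otgt k \<and> und h = und k"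
  for h k :: "('x, 'k) tagged"
  by auto

text \<open>All equations are inherited from \<open>K\<close>, the tags being bookkeeping. What
  remains is that the conditions are closed under identities and composition.\<close>

lemma two_category_structured:
  assumes K: "two_category K" and p: "\<And>x. x \<in> X \<Longrightarrow> p x \<in> cell0 K"
    and i1: "\<And>x. x \<in> X \<Longrightarrow> ok1 x x (id1 K (p x))"
    and c1: "\<And>x y z f g. \<lbrakk>x \<in> X; y \<in> X; z \<in> X; f \<in> cell1 K; g \<in> cell1 K;
       dom1 K f = p x; cod1 K f = p y; dom1 K g = p y; cod1 K g = p z; ok1 x y f; ok1 y z g\<rbrakk>
       \<Longrightarrow> ok1 x z (comp1 K g f)"
    and i2: "\<And>x y f. \<lbrakk>x \<in> X; y \<in> X; f \<in> cell1 K; dom1 K f = p x; cod1 K f = p y; ok1 x y f\<rbrakk>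
       \<Longrightarrow> ok2 x y (id2 K f)"
    and v2: "\<And>x y \<alpha> \<beta>. \<lbrakk>x \<in> X; y \<in> X; \<alpha> \<in> cell2 K; \<beta> \<in> cell2 K; cod2 K \<alpha> = dom2 K \<beta>;
       dom1 K (dom2 K \<alpha>) = p x; cod1 K (dom2 K \<alpha>) = p y; ok2 x y \<alpha>; ok2 x y \<beta>\<rbrakk>
       \<Longrightarrow> ok2 x y (vcomp K \<beta> \<alpha>)"
    and h2: "\<And>x y z \<alpha> \<beta>. \<lbrakk>x \<in> X; y \<in> X; z \<in> X; \<alpha> \<in> cell2 K; \<beta> \<in> cell2 K;
       dom1 K (dom2 K \<alpha>) = p x; cod1 K (dom2 K \<alpha>) = p y; dom1 K (dom2 K \<beta>) = p y; cod1 K (dom2 K \<beta>) = p z;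
       ok2 x y \<alpha>; ok2 y z \<beta>\<rbrakk>
       \<Longrightarrow> ok2 x z (hcomp K \<beta> \<alpha>)"
  shows "two_category (structured K X p ok1 ok2)"
proof -
  \<comment> \<open>An endpoint occurs here as \<open>p x\<close> and not as
    \<open>dom1 K f\<close>; with the endpoint as a side condition the unit laws still
    match.\<close>
  have u1: "comp1 K f (id1 K x) = f" if "f \<in> cell1 K" "dom1 K f = x" for f x
    using two_category_units[OF K] that by metis
  have u2: "comp1 K (id1 K x) f = f" if "f \<in> cell1 K" "cod1 K f = x" for f x
    using two_category_units[OF K] that by metis
  have u3: "hcomp K f (id2 K (id1 K x)) = f" if "f \<in> cell2 K" "dom1 K (dom2 K f) = x" for f x
    using two_category_units[OF K] that by metis
  have u4: "hcomp K (id2 K (id1 K x)) f = f" if "f \<in> cell2 K" "cod1 K (dom2 K f) = x" for f x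
    using two_category_units[OF K] that by metis
  note u = u1 u2 u3 u4 two_category_units[OF K]
  note cells = structured_cell1 structured_cell2 tagged_eq_iff two_category_cells[OF K] u p
  show ?thesis
    apply (rule two_categoryI)
                  apply (simp_all add: cells i1)[2]
                apply (simp add: cells, metis c1)
               apply (simp add: cells)
              apply (simp add: cells two_category_comp1_assoc[OF K])
             apply (simp_all add: cells i2)[2]
           apply (simp add: cells, metis v2)
          apply (simp add: cells)
         apply (simp add: cells two_category_vcomp_assoc[OF K])
        \<comment> \<open>A horizontal composite has composites as source and as target, so
          \<open>c1\<close> is used on both boundaries in addition to \<open>h2\<close>.\<close>
        subgoal for \<alpha> \<beta>
          using c1[of "osrc \<alpha>" "otgt \<alpha>" "otgt \<beta>" "dom2 K (und \<alpha>)" "dom2 K (und \<beta>)"]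
            c1[of "osrc \<alpha>" "otgt \<alpha>" "otgt \<beta>" "cod2 K (und \<alpha>)" "cod2 K (und \<beta>)"]
            h2[of "osrc \<alpha>" "otgt \<alpha>" "otgt \<beta>" "und \<alpha>" "und \<beta>"]
          by (simp add: cells)
       apply (simp add: cells)
      apply (simp add: cells two_category_hcomp_assoc[OF K])
     apply (simp add: cells two_category_id2_comp1[OF K])
    apply (simp add: structured_cell2 tagged_eq_iff)
    apply (rule two_category_interchange[OF K]; simp)
    done
qed

text \<open>A common generalization of arrow 2-categories and algebras: objects carry a cell
  \<sigma> x from F (p x) to G (p x), and cells must commute with it. Closure under composition is
  the pasting of commuting squares.\<close>

lemma two_category_inserter:
  assumes F: "two_functor K L F" and G: "two_functor K L G"
    and p: "\<And>x. x \<in> X \<Longrightarrow> p x \<in> cell0 K"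
    and \<sigma>: "\<And>x. x \<in> X \<Longrightarrow> \<sigma> x \<in> cell1 L"
      "\<And>x. x \<in> X \<Longrightarrow> dom1 L (\<sigma> x) = map0 F (p x)" "\<And>x. x \<in> X \<Longrightarrow> cod1 L (\<sigma> x) = map0 G (p x)"
  shows "two_category (structured K X p
     (\<lambda>x y f. comp1 L (\<sigma> y) (map1 F f) = comp1 L (map1 G f) (\<sigma> x))
     (\<lambda>x y \<alpha>. hcomp L (id2 L (\<sigma> y)) (map2 F \<alpha>) = hcomp L (map2 G \<alpha>) (id2 L (\<sigma> x))))"
proof -
  note K = two_functor_dom[OF F] and L = two_functor_cod[OF F]
  note cells = two_category_cells[OF K] two_category_cells[OF L] two_functor_cells[OF F] two_functor_cells[OF G]
    two_functor_ops[OF F] two_functor_ops[OF G] p \<sigma>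
  show ?thesis
  proof (rule two_category_structured[OF K p])
    fix x assume x: "x \<in> X"
    show "comp1 L (\<sigma> x) (map1 F (id1 K (p x))) = comp1 L (map1 G (id1 K (p x))) (\<sigma> x)"
      using two_category_comp1_id1[OF L \<sigma>(1)[OF x]] two_category_id1_comp1[OF L \<sigma>(1)[OF x]] x
      by (simp add: cells)
  next
    fix x y z f g
    assume a: "x \<in> X" "y \<in> X" "z \<in> X" "f \<in> cell1 K" "g \<in> cell1 K"
      "dom1 K f = p x" "cod1 K f = p y" "dom1 K g = p y" "cod1 K g = p z"
      and f: "comp1 L (\<sigma> y) (map1 F f) = comp1 L (map1 G f) (\<sigma> x)"
      and g: "comp1 L (\<sigma> z) (map1 F g) = comp1 L (map1 G g) (\<sigma> y)"
    have "comp1 L (\<sigma> z) (comp1 L (map1 F g) (map1 F f)) = comp1 L (comp1 L (\<sigma> z) (map1 F g)) (map1 F f)"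
      using a by (simp add: two_category_comp1_assoc[OF L] cells)
    also have "\<dots> = comp1 L (map1 G g) (comp1 L (\<sigma> y) (map1 F f))"
      using a by (simp add: g two_category_comp1_assoc[OF L] cells)
    also have "\<dots> = comp1 L (comp1 L (map1 G g) (map1 G f)) (\<sigma> x)"
      using a by (simp add: f two_category_comp1_assoc[OF L] cells)
    finally show "comp1 L (\<sigma> z) (map1 F (comp1 K g f)) = comp1 L (map1 G (comp1 K g f)) (\<sigma> x)"
      using a by (simp add: cells)
  next
    fix x y f
    assume a: "x \<in> X" "y \<in> X" "f \<in> cell1 K" "dom1 K f = p x" "cod1 K f = p y"
      and f: "comp1 L (\<sigma> y) (map1 F f) = comp1 L (map1 G f) (\<sigma> x)"
    show "hcomp L (id2 L (\<sigma> y)) (map2 F (id2 K f)) = hcomp L (map2 G (id2 K f)) (id2 L (\<sigma> x))"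
      using a two_category_id2_comp1[OF L, of "map1 F f" "\<sigma> y"]
        two_category_id2_comp1[OF L, of "\<sigma> x" "map1 G f"]
      by (simp add: cells f)
  next
    fix x y \<alpha> \<beta>
    assume a: "x \<in> X" "y \<in> X" "\<alpha> \<in> cell2 K" "\<beta> \<in> cell2 K" "cod2 K \<alpha> = dom2 K \<beta>"
       "dom1 K (dom2 K \<alpha>) = p x" "cod1 K (dom2 K \<alpha>) = p y"
      and \<alpha>: "hcomp L (id2 L (\<sigma> y)) (map2 F \<alpha>) = hcomp L (map2 G \<alpha>) (id2 L (\<sigma> x))"
      and \<beta>: "hcomp L (id2 L (\<sigma> y)) (map2 F \<beta>) = hcomp L (map2 G \<beta>) (id2 L (\<sigma> x))"
    have b: "dom1 K (dom2 K \<beta>) = p x" "cod1 K (dom2 K \<beta>) = p y"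
      using a two_category_dom1_cod2[OF K a(3)] two_category_cod1_cod2[OF K a(3)] by auto
    \<comment> \<open>Writing the whiskering identity as a vertical composite of two copies of
      itself brings the goal into the form of the interchange law.\<close>
    have i: "vcomp L (id2 L (\<sigma> z)) (id2 L (\<sigma> z)) = id2 L (\<sigma> z)" if "z \<in> X" for z
      using two_category_vcomp_id2[OF L two_category_id2[OF L \<sigma>(1)[OF that]]]
      by (simp add: cells that)
    have "hcomp L (id2 L (\<sigma> y)) (vcomp L (map2 F \<beta>) (map2 F \<alpha>))
        = hcomp L (vcomp L (id2 L (\<sigma> y)) (id2 L (\<sigma> y))) (vcomp L (map2 F \<beta>) (map2 F \<alpha>))"
      using a by (simp add: i)
    also have "\<dots> = vcomp L (hcomp L (id2 L (\<sigma> y)) (map2 F \<beta>)) (hcomp L (id2 L (\<sigma> y)) (map2 F \<alpha>))"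
      by (rule two_category_interchange[OF L]) (use a b in \<open>simp_all add: cells\<close>)
    also have "\<dots> = hcomp L (vcomp L (map2 G \<beta>) (map2 G \<alpha>)) (vcomp L (id2 L (\<sigma> x)) (id2 L (\<sigma> x)))"
      unfolding \<alpha> \<beta>
      by (rule two_category_interchange[OF L, symmetric]) (use a b in \<open>simp_all add: cells\<close>)
    finally show "hcomp L (id2 L (\<sigma> y)) (map2 F (vcomp K \<beta> \<alpha>)) = hcomp L (map2 G (vcomp K \<beta> \<alpha>)) (id2 L (\<sigma> x))"
      using a by (simp add: i cells)
  next
    fix x y z f g
    assume a: "x \<in> X" "y \<in> X" "z \<in> X" "f \<in> cell2 K" "g \<in> cell2 K"
      "dom1 K (dom2 K f) = p x" "cod1 K (dom2 K f) = p y" "dom1 K (dom2 K g) = p y" "cod1 K (dom2 K g) = p z"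
      and f: "hcomp L (id2 L (\<sigma> y)) (map2 F f) = hcomp L (map2 G f) (id2 L (\<sigma> x))"
      and g: "hcomp L (id2 L (\<sigma> z)) (map2 F g) = hcomp L (map2 G g) (id2 L (\<sigma> y))"
    have "hcomp L (id2 L (\<sigma> z)) (hcomp L (map2 F g) (map2 F f)) = hcomp L (hcomp L (id2 L (\<sigma> z)) (map2 F g)) (map2 F f)"
      using a by (simp add: two_category_hcomp_assoc[OF L] cells)
    also have "\<dots> = hcomp L (map2 G g) (hcomp L (id2 L (\<sigma> y)) (map2 F f))"
      using a by (simp add: g two_category_hcomp_assoc[OF L] cells)
    also have "\<dots> = hcomp L (hcomp L (map2 G g) (map2 G f)) (id2 L (\<sigma> x))"
      using a by (simp add: f two_category_hcomp_assoc[OF L] cells)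
    finally show "hcomp L (id2 L (\<sigma> z)) (map2 F (hcomp K g f)) = hcomp L (map2 G (hcomp K g f)) (id2 L (\<sigma> x))"
      using a by (simp add: cells)
  qed
qed

text \<open>An inserter with \<open>F\<close> and \<open>G\<close> the two projections of the
  product and \<sigma> P = P.\<close>

lemma two_category_arrow_twocat:
  assumes K: "two_category K"
  shows "two_category (arrow_twocat K)"
proof -
  have "arrow_twocat K = structured (prod_twocat K K) (cell1 K) (\<lambda>P. (dom1 K P, cod1 K P))
     (\<lambda>P Q h. comp1 K Q (fst h) = comp1 K (snd h) P)
     (\<lambda>P Q h. hcomp K (id2 K Q) (fst h) = hcomp K (snd h) (id2 K P))"
    by (simp add: arrow_twocat_def case_prod_unfold)
  then show ?thesis
    using two_category_inserter[OF two_functor_fst[OF K K] two_functor_snd[OF K K],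
        of "cell1 K" "\<lambda>P. (dom1 K P, cod1 K P)" "\<lambda>P. P"]
    by (simp add: prod_twocat_def two_category_cells[OF K])
qed

lemma two_functor_forget:
  assumes "two_category (structured K X p ok1 ok2)" "two_category K" "\<And>x. x \<in> X \<Longrightarrow> p x \<in> cell0 K"
  shows "two_functor (structured K X p ok1 ok2) K (forget p)"
  using assms by (auto simp: two_functor_def forget_def structured_cell1 structured_cell2)

text \<open>Only the tags change. \<open>Gamma_f\<close> has this form for \<open>action\<close>,
  and so has its inverse.\<close>

abbreviation structured_fun ::
  "('x \<Rightarrow> 'y) \<Rightarrow> ('x, ('x, 'f) tagged, ('x, 'c) tagged, 'y, ('y, 'f) tagged, ('y, 'c) tagged) twofun" where
  "structured_fun \<phi> \<equiv>
     \<lparr>map0 = \<phi>, map1 = (\<lambda>h. \<lparr>osrc = \<phi> (osrc h), otgt = \<phi> (otgt h), und = und h\<rparr>),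
      map2 = (\<lambda>\<theta>. \<lparr>osrc = \<phi> (osrc \<theta>), otgt = \<phi> (otgt \<theta>), und = und \<theta>\<rparr>)\<rparr>"

lemma two_functor_structured:
  assumes A: "two_category (structured K X p ok1 ok2)" "two_category (structured K X' p' ok1' ok2')"
    and X: "\<And>x. x \<in> X \<Longrightarrow> \<phi> x \<in> X'" and p: "\<And>x. x \<in> X \<Longrightarrow> p' (\<phi> x) = p x"
    and ok1: "\<And>x y f. \<lbrakk>x \<in> X; y \<in> X; f \<in> cell1 K; dom1 K f = p x; cod1 K f = p y; ok1 x y f\<rbrakk>
      \<Longrightarrow> ok1' (\<phi> x) (\<phi> y) f"
    and ok2: "\<And>x y \<alpha>. \<lbrakk>x \<in> X; y \<in> X; \<alpha> \<in> cell2 K; dom2 K \<alpha> \<in> cell1 K; cod2 K \<alpha> \<in> cell1 K;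
       dom1 K (dom2 K \<alpha>) = p x; cod1 K (dom2 K \<alpha>) = p y; dom1 K (cod2 K \<alpha>) = p x; cod1 K (cod2 K \<alpha>) = p y;
       ok1 x y (dom2 K \<alpha>); ok1 x y (cod2 K \<alpha>); ok2 x y \<alpha>\<rbrakk>
      \<Longrightarrow> ok2' (\<phi> x) (\<phi> y) \<alpha>"
  shows "two_functor (structured K X p ok1 ok2) (structured K X' p' ok1' ok2')
     (structured_fun \<phi>)"
  using A by (auto simp: two_functor_def structured_cell1 structured_cell2 X p ok1 ok2)

text \<open>A bijection on objects over \<open>K\<close> that preserves and reflects the conditions
  only retags cells, and the inverse bijection retags them back. The conditions on 2-cells are
  compared under \<open>ok1\<close> for source and target: with a trivial \<open>ok2\<close> the
  condition \<open>ok2'\<close> can only follow from these.\<close>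

lemma two_iso_over_structured:
  assumes K: "two_category K" "\<And>x. x \<in> X \<Longrightarrow> p x \<in> cell0 K"
    and A: "two_category (structured K X p ok1 ok2)" "two_category (structured K X' p' ok1' ok2')"
    and \<phi>: "bij_betw \<phi> X X'" and p: "\<And>x. x \<in> X \<Longrightarrow> p' (\<phi> x) = p x"
    and ok1: "\<And>x y f. \<lbrakk>x \<in> X; y \<in> X; f \<in> cell1 K; dom1 K f = p x; cod1 K f = p y\<rbrakk>
      \<Longrightarrow> ok1' (\<phi> x) (\<phi> y) f \<longleftrightarrow> ok1 x y f"
    and ok2: "\<And>x y \<alpha>. \<lbrakk>x \<in> X; y \<in> X; \<alpha> \<in> cell2 K; dom2 K \<alpha> \<in> cell1 K; cod2 K \<alpha> \<in> cell1 K;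
       dom1 K (dom2 K \<alpha>) = p x; cod1 K (dom2 K \<alpha>) = p y; dom1 K (cod2 K \<alpha>) = p x; cod1 K (cod2 K \<alpha>) = p y;
       ok1 x y (dom2 K \<alpha>); ok1 x y (cod2 K \<alpha>)\<rbrakk>
      \<Longrightarrow> ok2' (\<phi> x) (\<phi> y) \<alpha> \<longleftrightarrow> ok2 x y \<alpha>"
  shows "two_iso_over K (structured K X p ok1 ok2) (forget p) (structured K X' p' ok1' ok2') (forget p')
     (structured_fun \<phi>)"
proof -
  define \<psi> where "\<psi> = inv_into X \<phi>"
  have X: "\<And>x. x \<in> X \<Longrightarrow> \<phi> x \<in> X'" "\<And>x. x \<in> X' \<Longrightarrow> \<psi> x \<in> X"
    and inv: "\<And>x. x \<in> X \<Longrightarrow> \<psi> (\<phi> x) = x" "\<And>x. x \<in> X' \<Longrightarrow> \<phi> (\<psi> x) = x"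
    using \<phi> unfolding \<psi>_def bij_betw_def
    by (auto intro: inv_into_into f_inv_into_f)
  have p': "p (\<psi> x) = p' x" if "x \<in> X'" for x
    using p[OF X(2)[OF that]] that by (simp add: inv)
  have p0: "p' x \<in> cell0 K" if "x \<in> X'" for x
    using K(2)[OF X(2)[OF that]] that by (simp add: p')
  have 1: "two_functor (structured K X p ok1 ok2) (structured K X' p' ok1' ok2')
     (structured_fun \<phi>)"
    by (rule two_functor_structured[OF A]) (simp_all add: X p ok1 ok2)
  have ok1': "ok1 (\<psi> x) (\<psi> y) f \<longleftrightarrow> ok1' x y f"
    if "x \<in> X'" "y \<in> X'" "f \<in> cell1 K" "dom1 K f = p' x" "cod1 K f = p' y" for x y f
    using ok1[of "\<psi> x" "\<psi> y" f] that by (simp add: X inv p')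
  have 2: "two_functor (structured K X' p' ok1' ok2') (structured K X p ok1 ok2)
     (structured_fun \<psi>)"
  proof (rule two_functor_structured[OF A(2,1)])
    fix x y \<alpha> assume "x \<in> X'" "y \<in> X'" "\<alpha> \<in> cell2 K" "dom2 K \<alpha> \<in> cell1 K" "cod2 K \<alpha> \<in> cell1 K"
      "dom1 K (dom2 K \<alpha>) = p' x" "cod1 K (dom2 K \<alpha>) = p' y"
      "dom1 K (cod2 K \<alpha>) = p' x" "cod1 K (cod2 K \<alpha>) = p' y"
      "ok1' x y (dom2 K \<alpha>)" "ok1' x y (cod2 K \<alpha>)" "ok2' x y \<alpha>"
    then show "ok2 (\<psi> x) (\<psi> y) \<alpha>"
      using ok2[of "\<psi> x" "\<psi> y" \<alpha>] by (simp add: X inv p' ok1')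
  qed (simp_all add: X p' ok1')
  show ?thesis
    unfolding two_iso_over_def two_iso_def
    using 1 2 two_functor_forget[OF A(1) K] two_functor_forget[OF A(2) K(1) p0]
    by (intro conjI exI[of _ "structured_fun \<psi>"])
      (auto simp: twofun_eq_def twofun_comp_def twofun_id_def forget_def structured_cell1 structured_cell2 inv p)
qed

subsection \<open>Strict algebras of a 2-monad\<close>

lemma two_monadD:
  assumes "two_monad K T"
  shows two_monad_unit: "two_natural K K twofun_id (mfun T) (munit T)"
    and two_monad_mult: "two_natural K K (twofun_comp (mfun T) (mfun T)) (mfun T) (mmult T)"
    and two_monad_fun: "two_functor K K (mfun T)"
    and two_monad_mult_unit: "x \<in> cell0 K \<Longrightarrow> comp1 K (mmult T x) (munit T (map0 (mfun T) x)) = id1 K (map0 (mfun T) x)"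
    and two_monad_mult_map_unit: "x \<in> cell0 K \<Longrightarrow> comp1 K (mmult T x) (map1 (mfun T) (munit T x)) = id1 K (map0 (mfun T) x)"
    and two_monad_mult_assoc: "x \<in> cell0 K \<Longrightarrow>
      comp1 K (mmult T x) (mmult T (map0 (mfun T) x)) = comp1 K (mmult T x) (map1 (mfun T) (mmult T x))"
  using assms unfolding two_monad_def by (auto simp: two_natural_def)

lemma two_naturalD:
  assumes "two_natural A K F G \<tau>"
  shows two_natural_cell: "x \<in> cell0 A \<Longrightarrow> \<tau> x \<in> cell1 K"
    and two_natural_dom1: "x \<in> cell0 A \<Longrightarrow> dom1 K (\<tau> x) = map0 F x"
    and two_natural_cod1: "x \<in> cell0 A \<Longrightarrow> cod1 K (\<tau> x) = map0 G x"
    and two_natural_square: "f \<in> cell1 A \<Longrightarrow> comp1 K (\<tau> (cod1 A f)) (map1 F f) = comp1 K (map1 G f) (\<tau> (dom1 A f))"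
    and two_natural_square2: "\<alpha> \<in> cell2 A \<Longrightarrow> hcomp K (id2 K (\<tau> (cod1 A (dom2 A \<alpha>)))) (map2 F \<alpha>)
                   = hcomp K (map2 G \<alpha>) (id2 K (\<tau> (dom1 A (dom2 A \<alpha>))))"
  using assms unfolding two_natural_def by auto

text \<open>Turns the equations around so that they have the shape of an inserter.\<close>

lemma Alg_eq:
  "Alg K T = structured K (algebras K T) (cod1 K)
     (\<lambda>a b f. comp1 K b (map1 (mfun T) f) = comp1 K f a)
     (\<lambda>a b \<alpha>. hcomp K (id2 K b) (map2 (mfun T) \<alpha>) = hcomp K \<alpha> (id2 K a))"
proof -
  have "(\<lambda>a b f. comp1 K f a = comp1 K b (map1 (mfun T) f)) = (\<lambda>a b f. comp1 K b (map1 (mfun T) f) = comp1 K f a)"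
    by (intro ext) (rule eq_commute)
  moreover have "(\<lambda>a b \<alpha>. hcomp K \<alpha> (id2 K a) = hcomp K (id2 K b) (map2 (mfun T) \<alpha>))
      = (\<lambda>a b \<alpha>. hcomp K (id2 K b) (map2 (mfun T) \<alpha>) = hcomp K \<alpha> (id2 K a))"
    by (intro ext) (rule eq_commute)
  ultimately show ?thesis by (simp add: Alg_def)
qed

text \<open>An inserter with \<open>F\<close> the 2-functor of the monad, \<open>G\<close> the
  identity and \<sigma> the action itself.\<close>

lemma two_category_Alg:
  assumes T: "two_functor K K (mfun T)"
  shows "two_category (Alg K T)"
proof -
  note K = two_functor_dom[OF T]
  have a: "cod1 K a \<in> cell0 K" "a \<in> cell1 K" "dom1 K a = map0 (mfun T) (cod1 K a)"
    "cod1 K a = map0 twofun_id (cod1 K a)" if "a \<in> algebras K T" for a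
    using that by (simp_all add: algebras_def twofun_id_def two_category_cod1[OF K])
  show ?thesis
    using two_category_inserter[OF T two_functor_id[OF K], where X = "algebras K T" and p = "cod1 K" and \<sigma> = "\<lambda>a. a", OF a]
    by (simp add: Alg_eq twofun_id_def)
qed

lemma two_functor_forget_Alg:
  assumes T: "two_functor K K (mfun T)"
  shows "two_functor (Alg K T) K (forget (cod1 K))"
  using two_category_Alg[OF T] two_functor_dom[OF T] unfolding Alg_def
  by (intro two_functor_forget) (auto simp: algebras_def two_category_cod1)

text \<open>The free algebra on x is the multiplication at x, and the counit at an algebra
  \<open>a\<close> is \<open>a\<close>, a morphism by the multiplication law of \<open>a\<close>.
  The triangle identities are a unit law of the monad and the unit law of the algebra. Values of
  \<open>L\<close> and underlying cells of \<epsilon> are exported since the comparison is computed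
  from them.\<close>

lemma two_adjunction_Alg:
  assumes "two_monad K T"
  obtains L \<epsilon> where "two_adjunction (Alg K T) K L (forget (cod1 K)) (munit T) \<epsilon>"
    and "twofun_eq K (twofun_comp (forget (cod1 K)) L) (mfun T)"
    and "\<And>x. x \<in> cell0 K \<Longrightarrow> map0 L x = mmult T x"
    and "\<And>a. und (\<epsilon> a) = a"
proof -
  note T = two_monad_fun[OF assms]
  note K = two_functor_dom[OF T]
  note A = two_category_Alg[OF T] and U = two_functor_forget_Alg[OF T]
  note cells = two_category_cells[OF K] two_functor_cells[OF T]
  define L where "L = \<lparr>map0 = mmult T,
      map1 = (\<lambda>f. \<lparr>osrc = mmult T (dom1 K f), otgt = mmult T (cod1 K f), und = map1 (mfun T) f\<rparr>),
      map2 = (\<lambda>\<alpha>. \<lparr>osrc = mmult T (dom1 K (dom2 K \<alpha>)), otgt = mmult T (cod1 K (dom2 K \<alpha>)), und = map2 (mfun T) \<alpha>\<rparr>)\<rparr>"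
  define \<epsilon> where "\<epsilon> = (\<lambda>a. \<lparr>osrc = mmult T (cod1 K a), otgt = a, und = a\<rparr>)"
  have m: "mmult T x \<in> cell1 K" "dom1 K (mmult T x) = map0 (mfun T) (map0 (mfun T) x)"
    "cod1 K (mmult T x) = map0 (mfun T) x" if "x \<in> cell0 K" for x
    using two_naturalD(1-3)[OF two_monad_mult[OF assms]] that by (simp_all add: twofun_comp_def)
  have n: "munit T x \<in> cell1 K" "dom1 K (munit T x) = x"
    "cod1 K (munit T x) = map0 (mfun T) x" if "x \<in> cell0 K" for x
    using two_naturalD(1-3)[OF two_monad_unit[OF assms]] that by (simp_all add: twofun_id_def)
  have alg: "mmult T x \<in> algebras K T" if "x \<in> cell0 K" for x
    using that two_monad_mult_unit[OF assms that] two_monad_mult_assoc[OF assms that]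
    by (simp add: algebras_def m)
  have sq: "comp1 K (mmult T (cod1 K f)) (map1 (mfun T) (map1 (mfun T) f)) = comp1 K (map1 (mfun T) f) (mmult T (dom1 K f))"
    if "f \<in> cell1 K" for f
    using two_natural_square[OF two_monad_mult[OF assms] that] by (simp add: twofun_comp_def)
  have sq2: "hcomp K (id2 K (mmult T (cod1 K (dom2 K \<alpha>)))) (map2 (mfun T) (map2 (mfun T) \<alpha>))
      = hcomp K (map2 (mfun T) \<alpha>) (id2 K (mmult T (dom1 K (dom2 K \<alpha>))))"
    if "\<alpha> \<in> cell2 K" for \<alpha>
    using two_natural_square2[OF two_monad_mult[OF assms] that] by (simp add: twofun_comp_def)
  \<comment> \<open>Naturality at the target of \<alpha>, with the endpoints expressed through its
    source as the simplifier leaves them.\<close>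
  have sq': "comp1 K (mmult T (cod1 K (dom2 K \<alpha>))) (map1 (mfun T) (map1 (mfun T) (cod2 K \<alpha>)))
      = comp1 K (map1 (mfun T) (cod2 K \<alpha>)) (mmult T (dom1 K (dom2 K \<alpha>)))" if "\<alpha> \<in> cell2 K" for \<alpha>
    using sq[of "cod2 K \<alpha>"] that by (simp add: cells)
  have L: "two_functor K (Alg K T) L"
    using K A
    by (auto simp: two_functor_def L_def Alg_eq structured_cell1 structured_cell2 cells two_functor_ops[OF T] m alg sq sq' sq2)
  have UL: "twofun_eq K (twofun_comp (forget (cod1 K)) L) (mfun T)"
    by (simp add: twofun_eq_def twofun_comp_def L_def forget_def m)
  have \<eta>: "two_natural K K twofun_id (twofun_comp (forget (cod1 K)) L) (munit T)"
    by (rule two_natural_cong[OF two_monad_unit[OF assms]]) (use UL in \<open>simp_all add: twofun_eq_def\<close>)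
  have algD: "a \<in> cell1 K" "dom1 K a = map0 (mfun T) (cod1 K a)" "comp1 K a (munit T (cod1 K a)) = id1 K (cod1 K a)"
    "comp1 K a (mmult T (cod1 K a)) = comp1 K a (map1 (mfun T) a)" "cod1 K a \<in> cell0 K" if "a \<in> algebras K T" for a
    using that by (auto simp: algebras_def cells)
  have cell: "\<epsilon> a \<in> cell1 (Alg K T)" if "a \<in> algebras K T" for a
    using that algD[OF that] by (simp add: Alg_eq structured_cell1 \<epsilon>_def alg m)
  have \<epsilon>: "two_natural (Alg K T) (Alg K T) (twofun_comp L (forget (cod1 K))) twofun_id \<epsilon>"
    unfolding two_natural_def
  proof (intro conjI ballI)
    fix a assume a: "a \<in> cell0 (Alg K T)"
    show "\<epsilon> a \<in> cell1 (Alg K T)" using cell a by (simp add: Alg_eq)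
    show "dom1 (Alg K T) (\<epsilon> a) = map0 (twofun_comp L (forget (cod1 K))) a"
      by (simp add: \<epsilon>_def L_def twofun_comp_def forget_def Alg_eq)
    show "cod1 (Alg K T) (\<epsilon> a) = map0 twofun_id a"
      by (simp add: \<epsilon>_def twofun_id_def Alg_eq)
  next
    fix f assume "f \<in> cell1 (Alg K T)"
    then show "comp1 (Alg K T) (\<epsilon> (cod1 (Alg K T) f)) (map1 (twofun_comp L (forget (cod1 K))) f)
        = comp1 (Alg K T) (map1 twofun_id f) (\<epsilon> (dom1 (Alg K T) f))"
      by (simp add: \<epsilon>_def L_def twofun_comp_def twofun_id_def forget_def Alg_eq structured_cell1)
  next
    fix \<alpha> assume "\<alpha> \<in> cell2 (Alg K T)"
    then show "hcomp (Alg K T) (id2 (Alg K T) (\<epsilon> (cod1 (Alg K T) (dom2 (Alg K T) \<alpha>))))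
          (map2 (twofun_comp L (forget (cod1 K))) \<alpha>)
        = hcomp (Alg K T) (map2 twofun_id \<alpha>) (id2 (Alg K T) (\<epsilon> (dom1 (Alg K T) (dom2 (Alg K T) \<alpha>))))"
      by (simp add: \<epsilon>_def L_def twofun_comp_def twofun_id_def forget_def Alg_eq structured_cell2)
  qed (rule two_functor_comp[OF U L] two_functor_id[OF A])+
  have "two_adjunction (Alg K T) K L (forget (cod1 K)) (munit T) \<epsilon>"
    unfolding two_adjunction_def
    using L U \<eta> \<epsilon>
  proof (intro conjI ballI)
    fix x assume "x \<in> cell0 K"
    then show "comp1 (Alg K T) (\<epsilon> (map0 L x)) (map1 L (munit T x)) = id1 (Alg K T) (map0 L x)"
      by (simp add: \<epsilon>_def L_def Alg_eq m n two_monad_mult_map_unit[OF assms])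
  next
    fix a assume "a \<in> cell0 (Alg K T)"
    then show "comp1 K (map1 (forget (cod1 K)) (\<epsilon> a)) (munit T (map0 (forget (cod1 K)) a))
        = id1 K (map0 (forget (cod1 K)) a)"
      by (simp add: \<epsilon>_def forget_def Alg_eq algD)
  qed
  then show ?thesis
    using that[of L \<epsilon>] UL by (auto simp: \<epsilon>_def L_def)
qed

text \<open>\<open>strictly_two_monadic\<close> speaks of the algebras of the induced monad, which
  agrees with \<open>T\<close> on cells only. The definition of \<open>Alg\<close> evaluates the
  monad at cells alone, so the two records are literally equal.\<close>

lemma Alg_cong:
  assumes K: "two_category K" and F: "twofun_eq K (mfun T) (mfun T')"
    and u: "\<And>x. x \<in> cell0 K \<Longrightarrow> munit T x = munit T' x" and m: "\<And>x. x \<in> cell0 K \<Longrightarrow> mmult T x = mmult T' x"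
  shows "Alg K T = Alg K T'"
proof -
  have F': "\<And>x. x \<in> cell0 K \<Longrightarrow> map0 (mfun T') x = map0 (mfun T) x"
    "\<And>f. f \<in> cell1 K \<Longrightarrow> map1 (mfun T') f = map1 (mfun T) f"
    "\<And>\<alpha>. \<alpha> \<in> cell2 K \<Longrightarrow> map2 (mfun T') \<alpha> = map2 (mfun T) \<alpha>"
    using F by (simp_all add: twofun_eq_def)
  have X: "algebras K T = algebras K T'"
    by (auto simp: algebras_def F' u m two_category_cod1[OF K])
  show ?thesis
    unfolding Alg_def structured_def Let_def twocat.simps X
    by (auto simp: F' two_category_dom2[OF K] two_category_cod2[OF K])
qed

text \<open>The same inverse serves both 2-functors, since they agree wherever it takes its
  values.\<close>

lemma two_iso_over_cong:
  assumes iso: "two_iso_over K A U A' U' F" and eq: "twofun_eq A F F'"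
  shows "two_iso_over K A U A' U' F'"
proof -
  obtain G where F: "two_functor A A' F" and G: "two_functor A' A G"
    and GF: "twofun_eq A (twofun_comp G F) twofun_id" and FG: "twofun_eq A' (twofun_comp F G) twofun_id"
    using iso by (auto simp: two_iso_over_def two_iso_def)
  have F': "two_functor A A' F'" by (rule two_functor_cong[OF F eq])
  have "twofun_eq A (twofun_comp G F') twofun_id" "twofun_eq A' (twofun_comp F' G) twofun_id"
    using GF FG eq two_functor_cells[OF G] by (auto simp: twofun_eq_def twofun_comp_def)
  moreover have "twofun_eq A (twofun_comp U' F') U"
    using iso eq by (auto simp: two_iso_over_def twofun_eq_def twofun_comp_def)
  ultimately show ?thesis
    using iso F' G by (auto simp: two_iso_over_def two_iso_def)
qed

text \<open>With \<open>G\<close> inverse to \<Gamma>, the left adjoint is G L' and the counit at y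
  is the image under \<open>G\<close> of \<epsilon>' at \<Gamma> y; the unit stays that of
  \<open>T\<close>. The point is that the comparison built from this adjunction is \<Gamma> again,
  because a counit component of the algebras has the action itself as underlying cell.\<close>

lemma strictly_two_monadicI:
  assumes T: "two_monad K T" and iso: "two_iso_over K A U (Alg K T) (forget (cod1 K)) \<Gamma>"
  shows "strictly_two_monadic A K U"
proof -
  let ?A = "Alg K T"
  obtain L' \<epsilon>' where adj: "two_adjunction ?A K L' (forget (cod1 K)) (munit T) \<epsilon>'"
    and UL': "twofun_eq K (twofun_comp (forget (cod1 K)) L') (mfun T)"
    and L'0: "\<And>x. x \<in> cell0 K \<Longrightarrow> map0 L' x = mmult T x"
    and und_\<epsilon>': "\<And>a. und (\<epsilon>' a) = a"
    using two_adjunction_Alg[OF T] by metis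
  obtain G where \<Gamma>: "two_functor A ?A \<Gamma>" and G: "two_functor ?A A G"
    and "twofun_eq A (twofun_comp G \<Gamma>) twofun_id" and "twofun_eq ?A (twofun_comp \<Gamma> G) twofun_id"
    using iso by (auto simp: two_iso_over_def two_iso_def)
  then have inv:
    "\<And>x. x \<in> cell0 A \<Longrightarrow> map0 G (map0 \<Gamma> x) = x" "\<And>x. x \<in> cell0 ?A \<Longrightarrow> map0 \<Gamma> (map0 G x) = x"
    "\<And>f. f \<in> cell1 A \<Longrightarrow> map1 G (map1 \<Gamma> f) = f" "\<And>f. f \<in> cell1 ?A \<Longrightarrow> map1 \<Gamma> (map1 G f) = f"
    "\<And>\<alpha>. \<alpha> \<in> cell2 A \<Longrightarrow> map2 G (map2 \<Gamma> \<alpha>) = \<alpha>" "\<And>\<alpha>. \<alpha> \<in> cell2 ?A \<Longrightarrow> map2 \<Gamma> (map2 G \<alpha>) = \<alpha>"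
    by (simp_all add: twofun_eq_def twofun_comp_def twofun_id_def)
  have U: "two_functor A K U" and "twofun_eq A (twofun_comp (forget (cod1 K)) \<Gamma>) U"
    using iso by (auto simp: two_iso_over_def)
  then have U\<Gamma>: "\<And>x. x \<in> cell0 A \<Longrightarrow> cod1 K (map0 \<Gamma> x) = map0 U x"
    "\<And>f. f \<in> cell1 A \<Longrightarrow> und (map1 \<Gamma> f) = map1 U f" "\<And>\<alpha>. \<alpha> \<in> cell2 A \<Longrightarrow> und (map2 \<Gamma> \<alpha>) = map2 U \<alpha>"
    by (simp_all add: twofun_eq_def twofun_comp_def forget_def)
  \<comment> \<open>The inverse lies over \<open>K\<close> as well, by substituting its values into
    the equations for \<Gamma>.\<close>
  have UG: "\<And>x. x \<in> cell0 ?A \<Longrightarrow> map0 U (map0 G x) = cod1 K x"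
    "\<And>f. f \<in> cell1 ?A \<Longrightarrow> map1 U (map1 G f) = und f" "\<And>\<alpha>. \<alpha> \<in> cell2 ?A \<Longrightarrow> map2 U (map2 G \<alpha>) = und \<alpha>"
    by (simp_all flip: U\<Gamma> add: inv two_functor_cells[OF G])
  have L': "two_functor K ?A L'" and \<epsilon>': "two_natural ?A ?A (twofun_comp L' (forget (cod1 K))) twofun_id \<epsilon>'"
    and tri: "\<And>x. x \<in> cell0 K \<Longrightarrow> comp1 ?A (\<epsilon>' (map0 L' x)) (map1 L' (munit T x)) = id1 ?A (map0 L' x)"
      "\<And>y. y \<in> cell0 ?A \<Longrightarrow> comp1 K y (munit T (cod1 K y)) = id1 K (cod1 K y)"
    using adj by (simp_all add: two_adjunction_def forget_def und_\<epsilon>')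
  note K = two_functor_dom[OF L'] and A = two_functor_dom[OF \<Gamma>] and AT = two_functor_dom[OF G]
  have e: "\<epsilon>' y \<in> cell1 ?A" "osrc (\<epsilon>' y) = map0 L' (cod1 K y)" "otgt (\<epsilon>' y) = y" if "y \<in> cell0 ?A" for y
    using two_naturalD(1-3)[OF \<epsilon>' that] by (simp_all add: twofun_comp_def twofun_id_def forget_def Alg_eq)
  define L where "L = twofun_comp G L'"
  define \<epsilon> where "\<epsilon> = (\<lambda>y. map1 G (\<epsilon>' (map0 \<Gamma> y)))"
  have L: "two_functor K A L"
    unfolding L_def by (rule two_functor_comp[OF L' G])
  have L_simps: "map0 L x = map0 G (map0 L' x)" "map1 L f = map1 G (map1 L' f)" "map2 L \<alpha> = map2 G (map2 L' \<alpha>)" for x f \<alpha>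
    by (simp_all add: L_def twofun_comp_def)
  have UL: "twofun_eq K (twofun_comp U L) (mfun T)"
    using UL' by (simp add: twofun_eq_def twofun_comp_def L_simps UG two_functor_cells[OF L'] forget_def)
  have \<eta>: "two_natural K K twofun_id (twofun_comp U L) (munit T)"
    by (rule two_natural_cong[OF two_monad_unit[OF T]]) (use UL in \<open>simp_all add: twofun_eq_def\<close>)
  have dom1_\<Gamma>: "osrc (map1 \<Gamma> f) = map0 \<Gamma> (dom1 A f)" "otgt (map1 \<Gamma> f) = map0 \<Gamma> (cod1 A f)"
    if "f \<in> cell1 A" for f
    using two_functor_dom1[OF \<Gamma> that] two_functor_cod1[OF \<Gamma> that] by (simp_all add: Alg_eq)
  have dom1_\<Gamma>2: "osrc (map2 \<Gamma> \<alpha>) = map0 \<Gamma> (dom1 A (dom2 A \<alpha>))" "otgt (map2 \<Gamma> \<alpha>) = map0 \<Gamma> (cod1 A (dom2 A \<alpha>))"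
    if "\<alpha> \<in> cell2 A" for \<alpha>
    using two_functor_dom2[OF \<Gamma> that] dom1_\<Gamma>[of "dom2 A \<alpha>"] two_category_dom2[OF A that]
    by (simp_all add: Alg_eq tagged_eq_iff)
  have sel: "dom1 ?A = osrc" "cod1 ?A = otgt" by (simp_all add: Alg_eq)
  have \<epsilon>_cell: "\<epsilon> y \<in> cell1 A" "dom1 A (\<epsilon> y) = map0 L (map0 U y)" "cod1 A (\<epsilon> y) = y" if "y \<in> cell0 A" for y
    using that e[of "map0 \<Gamma> y"]
    by (simp_all add: \<epsilon>_def L_simps inv U\<Gamma> two_functor_cells[OF \<Gamma>] two_functor_cells[OF G] sel)
  have \<epsilon>: "two_natural A A (twofun_comp L U) twofun_id \<epsilon>"
    unfolding two_natural_def
  proof (intro conjI ballI)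
    fix f assume f: "f \<in> cell1 A"
    let ?h = "map1 \<Gamma> f"
    have h: "?h \<in> cell1 ?A" using f by (simp add: two_functor_cells[OF \<Gamma>])
    have Uf: "map1 U f \<in> cell1 K" "map0 U (cod1 A f) = cod1 K (map1 U f)" "map0 U (dom1 A f) = dom1 K (map1 U f)"
      using f by (simp_all add: two_functor_cells[OF U])
    have c: "dom1 A f \<in> cell0 A" "cod1 A f \<in> cell0 A" using f by (simp_all add: two_category_cells[OF A])
    \<comment> \<open>Naturality of the counit of the algebras at \<Gamma> f, pushed through
      \<open>G\<close>; functoriality of \<open>G\<close> then splits both sides.\<close>
    have "map1 G (comp1 ?A (\<epsilon>' (map0 \<Gamma> (cod1 A f))) (map1 L' (map1 U f)))
        = map1 G (comp1 ?A ?h (\<epsilon>' (map0 \<Gamma> (dom1 A f))))"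
      using two_natural_square[OF \<epsilon>' h] f
      by (simp add: twofun_comp_def twofun_id_def forget_def U\<Gamma> sel dom1_\<Gamma>)
    then show "comp1 A (\<epsilon> (cod1 A f)) (map1 (twofun_comp L U) f) = comp1 A (map1 twofun_id f) (\<epsilon> (dom1 A f))"
      using f h c Uf e[of "map0 \<Gamma> (cod1 A f)"] e[of "map0 \<Gamma> (dom1 A f)"] two_functor_cod1[OF L' Uf(1)]
      by (simp add: \<epsilon>_def L_simps twofun_comp_def twofun_id_def two_functor_comp1[OF G] inv sel U\<Gamma> dom1_\<Gamma>
        two_functor_cells[OF \<Gamma>] two_functor_cells[OF L'])
  next
    fix \<alpha> assume \<alpha>: "\<alpha> \<in> cell2 A"
    let ?h = "map2 \<Gamma> \<alpha>"
    have h: "?h \<in> cell2 ?A" using \<alpha> by (simp add: two_functor_cells[OF \<Gamma>])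
    let ?s = "dom1 A (dom2 A \<alpha>)" and ?t = "cod1 A (dom2 A \<alpha>)"
    have c: "dom2 A \<alpha> \<in> cell1 A" "?s \<in> cell0 A" "?t \<in> cell0 A" using \<alpha> by (simp_all add: two_category_cells[OF A])
    have U\<alpha>: "map2 U \<alpha> \<in> cell2 K" "map0 U ?t = cod1 K (dom2 K (map2 U \<alpha>))"
      using \<alpha> c by (simp_all add: two_functor_cells[OF U])
    have es: "\<epsilon>' (map0 \<Gamma> ?s) \<in> cell1 ?A" "osrc (\<epsilon>' (map0 \<Gamma> ?s)) = map0 L' (map0 U ?s)" "otgt (\<epsilon>' (map0 \<Gamma> ?s)) = map0 \<Gamma> ?s"
      and et: "\<epsilon>' (map0 \<Gamma> ?t) \<in> cell1 ?A" "osrc (\<epsilon>' (map0 \<Gamma> ?t)) = map0 L' (map0 U ?t)" "otgt (\<epsilon>' (map0 \<Gamma> ?t)) = map0 \<Gamma> ?t"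
      using e[of "map0 \<Gamma> ?s"] e[of "map0 \<Gamma> ?t"] c by (simp_all add: two_functor_cells[OF \<Gamma>] U\<Gamma>)
    have L2: "map2 L' (map2 U \<alpha>) \<in> cell2 ?A" "cod1 ?A (dom2 ?A (map2 L' (map2 U \<alpha>))) = map0 L' (map0 U ?t)"
      using U\<alpha> by (simp_all add: two_functor_cells[OF L'] two_category_cells[OF K])
    have h2: "dom1 ?A (dom2 ?A ?h) = map0 \<Gamma> ?s" "cod1 ?A (dom2 ?A ?h) = map0 \<Gamma> ?t"
      using \<alpha> c by (simp_all add: two_functor_cells[OF \<Gamma>])
    have i: "id2 ?A (\<epsilon>' (map0 \<Gamma> ?s)) \<in> cell2 ?A" "dom2 ?A (id2 ?A (\<epsilon>' (map0 \<Gamma> ?s))) = \<epsilon>' (map0 \<Gamma> ?s)"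
      "id2 ?A (\<epsilon>' (map0 \<Gamma> ?t)) \<in> cell2 ?A" "dom2 ?A (id2 ?A (\<epsilon>' (map0 \<Gamma> ?t))) = \<epsilon>' (map0 \<Gamma> ?t)"
      using es et two_category_id2[OF AT] two_category_dom2_id2[OF AT] by blast+
    have "hcomp ?A (id2 ?A (\<epsilon>' (map0 \<Gamma> ?t))) (map2 L' (map2 U \<alpha>)) = hcomp ?A ?h (id2 ?A (\<epsilon>' (map0 \<Gamma> ?s)))"
      using two_natural_square2[OF \<epsilon>' h] unfolding h2
      by (simp add: twofun_comp_def twofun_id_def forget_def U\<Gamma> \<alpha>)
    then have "map2 G (hcomp ?A (id2 ?A (\<epsilon>' (map0 \<Gamma> ?t))) (map2 L' (map2 U \<alpha>)))
        = map2 G (hcomp ?A ?h (id2 ?A (\<epsilon>' (map0 \<Gamma> ?s))))" by simp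
    also have "map2 G (hcomp ?A (id2 ?A (\<epsilon>' (map0 \<Gamma> ?t))) (map2 L' (map2 U \<alpha>)))
        = hcomp A (id2 A (\<epsilon> ?t)) (map2 L (map2 U \<alpha>))"
      using two_functor_hcomp[OF G L2(1) i(3)] L2(2) et i(4)
      by (simp add: sel \<epsilon>_def L_simps two_functor_id2[OF G])
    also have "map2 G (hcomp ?A ?h (id2 ?A (\<epsilon>' (map0 \<Gamma> ?s)))) = hcomp A \<alpha> (id2 A (\<epsilon> ?s))"
      using two_functor_hcomp[OF G i(1) h] h2(1) es i(2)
      by (simp add: sel \<epsilon>_def two_functor_id2[OF G] inv \<alpha>)
    finally show "hcomp A (id2 A (\<epsilon> ?t)) (map2 (twofun_comp L U) \<alpha>) = hcomp A (map2 twofun_id \<alpha>) (id2 A (\<epsilon> ?s))"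
      by (simp add: twofun_comp_def twofun_id_def)
  qed (use two_functor_comp[OF U L] two_functor_id[OF A] \<epsilon>_cell in \<open>simp_all add: twofun_comp_def twofun_id_def\<close>)
  \<comment> \<open>This identifies the object part of the comparison with that of \<Gamma>.\<close>
  have und_\<epsilon>: "map1 U (\<epsilon> y) = map0 \<Gamma> y" if "y \<in> cell0 A" for y
    using that by (simp add: \<epsilon>_def UG e und_\<epsilon>' two_functor_cells[OF \<Gamma>])
  have adjunction: "two_adjunction A K L U (munit T) \<epsilon>"
    unfolding two_adjunction_def
  proof (intro conjI ballI L U \<eta> \<epsilon>)
    fix x assume x: "x \<in> cell0 K"
    have u: "munit T x \<in> cell1 K" "cod1 K (munit T x) = map0 (mfun T) x"
      using two_naturalD(1,3)[OF two_monad_unit[OF T] x] by simp_all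
    have "map0 (mfun T) x = cod1 K (map0 L' x)"
      using UL' x by (simp add: twofun_eq_def twofun_comp_def forget_def)
    then have "map1 G (comp1 ?A (\<epsilon>' (map0 L' x)) (map1 L' (munit T x)))
        = comp1 A (map1 G (\<epsilon>' (map0 L' x))) (map1 G (map1 L' (munit T x)))"
      using x u e[of "map0 L' x"]
      by (intro two_functor_comp1[OF G]) (simp_all add: two_functor_map0[OF L'] two_functor_map1[OF L'] two_functor_cod1[OF L'] sel flip: sel(2))
    then show "comp1 A (\<epsilon> (map0 L x)) (map1 L (munit T x)) = id1 A (map0 L x)"
      using x by (simp add: \<epsilon>_def L_simps inv two_functor_map0[OF L'] tri two_functor_id1[OF G])
  next
    fix y assume "y \<in> cell0 A"
    then show "comp1 K (map1 U (\<epsilon> y)) (munit T (map0 U y)) = id1 K (map0 U y)"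
      using tri(2)[of "map0 \<Gamma> y"] by (simp add: und_\<epsilon> U\<Gamma> two_functor_map0[OF \<Gamma>])
  qed
  \<comment> \<open>The induced multiplication is the original one: \<Gamma> sends L x to the free
    algebra on x, whose action is the multiplication.\<close>
  have "map1 U (\<epsilon> (map0 L x)) = mmult T x" if x: "x \<in> cell0 K" for x
    using und_\<epsilon>[OF two_functor_map0[OF L x]] x
    by (simp add: L_simps inv two_functor_map0[OF L'] L'0[OF x, symmetric])
  then have "Alg K (induced_monad L U (munit T) \<epsilon>) = ?A"
    using UL by (intro Alg_cong[OF K]) (simp_all add: induced_monad_def)
  \<comment> \<open>On 1-cells and 2-cells the tags are forced by the endpoints, and the underlying
    cells agree because \<Gamma> lies over \<open>K\<close>.\<close>
  moreover have "twofun_eq A \<Gamma> (comparison A U \<epsilon>)"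
    by (auto simp: twofun_eq_def comparison_def und_\<epsilon> tagged_eq_iff dom1_\<Gamma> dom1_\<Gamma>2 U\<Gamma>
        two_category_cells[OF A])
  ultimately show ?thesis
    unfolding strictly_two_monadic_def using adjunction two_iso_over_cong[OF iso] by metis
qed

section \<open>The 2-category of locally small categories\<close>

lemma categoryD:
  assumes "category C"
  shows cat_dom: "f \<in> Ar C \<Longrightarrow> Dom C f \<in> Ob C"
    and cat_cod: "f \<in> Ar C \<Longrightarrow> Cod C f \<in> Ob C"
    and cat_idn: "x \<in> Ob C \<Longrightarrow> Idn C x \<in> Ar C"
    and cat_dom_idn: "x \<in> Ob C \<Longrightarrow> Dom C (Idn C x) = x"
    and cat_cod_idn: "x \<in> Ob C \<Longrightarrow> Cod C (Idn C x) = x"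
    and cat_cmp: "\<lbrakk>f \<in> Ar C; g \<in> Ar C; Cod C f = Dom C g\<rbrakk> \<Longrightarrow> Cmp C g f \<in> Ar C"
    and cat_dom_cmp: "\<lbrakk>f \<in> Ar C; g \<in> Ar C; Cod C f = Dom C g\<rbrakk> \<Longrightarrow> Dom C (Cmp C g f) = Dom C f"
    and cat_cod_cmp: "\<lbrakk>f \<in> Ar C; g \<in> Ar C; Cod C f = Dom C g\<rbrakk> \<Longrightarrow> Cod C (Cmp C g f) = Cod C g"
    and cat_cmp_idn: "\<lbrakk>f \<in> Ar C; Dom C f = x\<rbrakk> \<Longrightarrow> Cmp C f (Idn C x) = f"
    and cat_idn_cmp: "\<lbrakk>f \<in> Ar C; Cod C f = x\<rbrakk> \<Longrightarrow> Cmp C (Idn C x) f = f"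
    and cat_assoc: "\<lbrakk>f \<in> Ar C; g \<in> Ar C; h \<in> Ar C; Cod C f = Dom C g; Cod C g = Dom C h\<rbrakk>
        \<Longrightarrow> Cmp C (Cmp C h g) f = Cmp C h (Cmp C g f)"
  using assms unfolding category_def by auto

lemmas cat_rules = cat_dom cat_cod cat_idn cat_dom_idn cat_cod_idn cat_cmp cat_dom_cmp cat_cod_cmp
  cat_cmp_idn cat_idn_cmp

lemma category_ls: "ls_category C \<Longrightarrow> category C"
  by (simp add: ls_category_def)

lemmas ls_rules [simp] = cat_rules[OF category_ls]
lemmas ls_assoc = cat_assoc[OF category_ls]

lemma is_funcD:
  assumes "is_func F"
  shows is_func_fdom [simp]: "ls_category (fdom F)" and is_func_fcod [simp]: "ls_category (fcod F)"
    and fob_ext: "fob F \<in> extensional (Ob (fdom F))" and far_ext: "far F \<in> extensional (Ar (fdom F))"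
    and fob_Ob [simp]: "x \<in> Ob (fdom F) \<Longrightarrow> fob F x \<in> Ob (fcod F)"
    and far_Ar [simp]: "f \<in> Ar (fdom F) \<Longrightarrow> far F f \<in> Ar (fcod F)"
    and Dom_far [simp]: "f \<in> Ar (fdom F) \<Longrightarrow> Dom (fcod F) (far F f) = fob F (Dom (fdom F) f)"
    and Cod_far [simp]: "f \<in> Ar (fdom F) \<Longrightarrow> Cod (fcod F) (far F f) = fob F (Cod (fdom F) f)"
    and far_Idn [simp]: "x \<in> Ob (fdom F) \<Longrightarrow> far F (Idn (fdom F) x) = Idn (fcod F) (fob F x)"
    and far_Cmp [simp]: "\<lbrakk>f \<in> Ar (fdom F); g \<in> Ar (fdom F); Cod (fdom F) f = Dom (fdom F) g\<rbrakk>
      \<Longrightarrow> far F (Cmp (fdom F) g f) = Cmp (fcod F) (far F g) (far F f)"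
  using assms unfolding is_func_def Let_def by auto

text \<open>Extensionality of the two maps turns agreement on the domain into equality of
  records.\<close>

lemma func_eqI:
  assumes "is_func F" "is_func G" "fdom F = fdom G" "fcod F = fcod G"
    and "\<And>x. x \<in> Ob (fdom F) \<Longrightarrow> fob F x = fob G x" "\<And>f. f \<in> Ar (fdom F) \<Longrightarrow> far F f = far G f"
  shows "F = G"
proof -
  have "fob F = fob G"
    using fob_ext[OF assms(1)] fob_ext[OF assms(2)] assms(3,5) by (auto intro: extensionalityI)
  moreover have "far F = far G"
    using far_ext[OF assms(1)] far_ext[OF assms(2)] assms(3,6) by (auto intro: extensionalityI)
  ultimately show ?thesis using assms(3,4) by simp
qed

lemma func_comp_sel [simp]:
  "fdom (func_comp G F) = fdom F" "fcod (func_comp G F) = fcod G"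
  "x \<in> Ob (fdom F) \<Longrightarrow> fob (func_comp G F) x = fob G (fob F x)"
  "f \<in> Ar (fdom F) \<Longrightarrow> far (func_comp G F) f = far G (far F f)"
  by (simp_all add: func_comp_def)

lemma func_id_sel [simp]:
  "fdom (func_id C) = C" "fcod (func_id C) = C"
  "x \<in> Ob C \<Longrightarrow> fob (func_id C) x = x"
  "f \<in> Ar C \<Longrightarrow> far (func_id C) f = f"
  by (simp_all add: func_id_def)

lemma is_func_id [simp]: "ls_category C \<Longrightarrow> is_func (func_id C)"
  by (simp add: is_func_def Let_def func_id_def)

lemma is_func_comp [simp]:
  assumes "is_func F" "is_func G" "fcod F = fdom G"
  shows "is_func (func_comp G F)"
  using assms is_funcD[OF assms(1)] unfolding is_func_def Let_def
  by (simp add: func_comp_def)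

lemma func_comp_assoc:
  assumes "is_func F" "is_func G" "is_func H" "fcod F = fdom G" "fcod G = fdom H"
  shows "func_comp H (func_comp G F) = func_comp (func_comp H G) F"
  by (rule func_eqI) (use assms is_funcD[OF assms(1)] in simp_all)

lemma func_comp_id [simp]: "is_func F \<Longrightarrow> fdom F = C \<Longrightarrow> func_comp F (func_id C) = F"
  by (rule func_eqI) auto

lemma func_id_comp [simp]:
  assumes "is_func F" "fcod F = C" shows "func_comp (func_id C) F = F"
  by (rule func_eqI) (use assms is_funcD[OF assms(1)] in simp_all)

section \<open>Natural transformations and their compositions\<close>

lemma is_ntD:
  assumes "is_nt \<alpha>"
  shows is_nt_ndom [simp]: "is_func (ndom \<alpha>)" and is_nt_ncod [simp]: "is_func (ncod \<alpha>)"
    and fdom_ncod [simp]: "fdom (ncod \<alpha>) = fdom (ndom \<alpha>)" and fcod_ncod [simp]: "fcod (ncod \<alpha>) = fcod (ndom \<alpha>)"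
    and ncmp_ext: "ncmp \<alpha> \<in> extensional (Ob (fdom (ndom \<alpha>)))"
    and ncmp_Ar [simp]: "x \<in> Ob (fdom (ndom \<alpha>)) \<Longrightarrow> ncmp \<alpha> x \<in> Ar (fcod (ndom \<alpha>))"
    and Dom_ncmp [simp]: "x \<in> Ob (fdom (ndom \<alpha>)) \<Longrightarrow> Dom (fcod (ndom \<alpha>)) (ncmp \<alpha> x) = fob (ndom \<alpha>) x"
    and Cod_ncmp [simp]: "x \<in> Ob (fdom (ndom \<alpha>)) \<Longrightarrow> Cod (fcod (ndom \<alpha>)) (ncmp \<alpha> x) = fob (ncod \<alpha>) x"
    and nt_natural: "f \<in> Ar (fdom (ndom \<alpha>)) \<Longrightarrow>
      Cmp (fcod (ndom \<alpha>)) (ncmp \<alpha> (Cod (fdom (ndom \<alpha>)) f)) (far (ndom \<alpha>) f)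
       = Cmp (fcod (ndom \<alpha>)) (far (ncod \<alpha>) f) (ncmp \<alpha> (Dom (fdom (ndom \<alpha>)) f))"
  using assms unfolding is_nt_def Let_def hom_def by auto

lemma is_ntI:
  assumes "is_func F" "is_func G" "fdom G = fdom F" "fcod G = fcod F"
    and "n \<in> extensional (Ob (fdom F))"
    and "\<And>x. x \<in> Ob (fdom F) \<Longrightarrow> n x \<in> Ar (fcod F) \<and> Dom (fcod F) (n x) = fob F x \<and> Cod (fcod F) (n x) = fob G x"
    and "\<And>f. f \<in> Ar (fdom F) \<Longrightarrow> Cmp (fcod F) (n (Cod (fdom F) f)) (far F f) = Cmp (fcod F) (far G f) (n (Dom (fdom F) f))"
  shows "is_nt \<lparr>ndom = F, ncod = G, ncmp = n\<rparr>"
  using assms by (simp add: is_nt_def Let_def hom_def)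

lemma nt_eqI:
  assumes "is_nt \<alpha>" "is_nt \<beta>" "ndom \<alpha> = ndom \<beta>" "ncod \<alpha> = ncod \<beta>"
    and "\<And>x. x \<in> Ob (fdom (ndom \<alpha>)) \<Longrightarrow> ncmp \<alpha> x = ncmp \<beta> x"
  shows "\<alpha> = \<beta>"
proof -
  have "ncmp \<alpha> = ncmp \<beta>"
    using ncmp_ext[OF assms(1)] ncmp_ext[OF assms(2)] assms(3,5) by (auto intro: extensionalityI)
  then show ?thesis using assms(3,4) by simp
qed

lemma nt_sel [simp]:
  "ndom (nt_id F) = F" "ncod (nt_id F) = F"
  "x \<in> Ob (fdom F) \<Longrightarrow> ncmp (nt_id F) x = Idn (fcod F) (fob F x)"
  "ndom (nt_vcomp \<beta> \<alpha>) = ndom \<alpha>" "ncod (nt_vcomp \<beta> \<alpha>) = ncod \<beta>"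
  "x \<in> Ob (fdom (ndom \<alpha>)) \<Longrightarrow> ncmp (nt_vcomp \<beta> \<alpha>) x = Cmp (fcod (ndom \<alpha>)) (ncmp \<beta> x) (ncmp \<alpha> x)"
  "ndom (nt_hcomp \<beta> \<alpha>) = func_comp (ndom \<beta>) (ndom \<alpha>)" "ncod (nt_hcomp \<beta> \<alpha>) = func_comp (ncod \<beta>) (ncod \<alpha>)"
  "x \<in> Ob (fdom (ndom \<alpha>)) \<Longrightarrow> ncmp (nt_hcomp \<beta> \<alpha>) x =
     Cmp (fcod (ndom \<beta>)) (ncmp \<beta> (fob (ncod \<alpha>) x)) (far (ndom \<beta>) (ncmp \<alpha> x))"
  by (simp_all add: nt_id_def nt_vcomp_def nt_hcomp_def)

lemma is_nt_id [simp]: "is_func F \<Longrightarrow> is_nt (nt_id F)"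
  unfolding nt_id_def by (rule is_ntI) auto

lemma is_nt_vcomp [simp]:
  assumes "is_nt \<alpha>" "is_nt \<beta>" "ncod \<alpha> = ndom \<beta>"
  shows "is_nt (nt_vcomp \<beta> \<alpha>)"
proof -
  have d: "fdom (ndom \<beta>) = fdom (ndom \<alpha>)" "fcod (ndom \<beta>) = fcod (ndom \<alpha>)"
    using fdom_ncod[OF assms(1)] fcod_ncod[OF assms(1)] by (simp_all add: assms(3))
  have b: "x \<in> Ob (fdom (ndom \<alpha>)) \<Longrightarrow> ncmp \<beta> x \<in> Ar (fcod (ndom \<alpha>))"
     "x \<in> Ob (fdom (ndom \<alpha>)) \<Longrightarrow> Dom (fcod (ndom \<alpha>)) (ncmp \<beta> x) = fob (ndom \<beta>) x"
     "x \<in> Ob (fdom (ndom \<alpha>)) \<Longrightarrow> Cod (fcod (ndom \<alpha>)) (ncmp \<beta> x) = fob (ncod \<beta>) x" for x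
    using is_ntD[OF assms(2)] by (simp_all add: d)
  show ?thesis
    unfolding nt_vcomp_def
  proof (rule is_ntI)
    fix f assume f: "f \<in> Ar (fdom (ndom \<alpha>))"
    let ?C = "fdom (ndom \<alpha>)" and ?D = "fcod (ndom \<alpha>)"
    have fr: "far (ndom \<alpha>) f \<in> Ar ?D" "far (ncod \<alpha>) f \<in> Ar ?D" "far (ncod \<beta>) f \<in> Ar ?D"
      "Dom ?D (far (ndom \<alpha>) f) = fob (ndom \<alpha>) (Dom ?C f)" "Cod ?D (far (ndom \<alpha>) f) = fob (ndom \<alpha>) (Cod ?C f)"
      "Dom ?D (far (ncod \<alpha>) f) = fob (ndom \<beta>) (Dom ?C f)" "Cod ?D (far (ncod \<alpha>) f) = fob (ndom \<beta>) (Cod ?C f)"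
      "Dom ?D (far (ncod \<beta>) f) = fob (ncod \<beta>) (Dom ?C f)"
      using f far_Ar[OF is_nt_ncod[OF assms(1)]] far_Ar[OF is_nt_ncod[OF assms(2)]]
       Dom_far[OF is_nt_ncod[OF assms(1)]] Cod_far[OF is_nt_ncod[OF assms(1)]]
       Dom_far[OF is_nt_ncod[OF assms(2)]] is_ntD(3,4)[OF assms(1)] is_ntD(3,4)[OF assms(2)]
        is_ntD(1)[OF assms(1)]
      by (simp_all add: d assms(3))
    have "Cmp ?D (Cmp ?D (ncmp \<beta> (Cod ?C f)) (ncmp \<alpha> (Cod ?C f))) (far (ndom \<alpha>) f)
        = Cmp ?D (ncmp \<beta> (Cod ?C f)) (Cmp ?D (ncmp \<alpha> (Cod ?C f)) (far (ndom \<alpha>) f))"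
      using assms f by (intro ls_assoc) (simp_all add: b)
    also have "\<dots> = Cmp ?D (Cmp ?D (ncmp \<beta> (Cod ?C f)) (far (ndom \<beta>) f)) (ncmp \<alpha> (Dom ?C f))"
      unfolding nt_natural[OF assms(1) f] using assms f fr
      by (subst ls_assoc) (simp_all add: b)
    also have "\<dots> = Cmp ?D (far (ncod \<beta>) f) (Cmp ?D (ncmp \<beta> (Dom ?C f)) (ncmp \<alpha> (Dom ?C f)))"
      using nt_natural[OF assms(2), of f] f fr assms
      by (simp add: d b) (intro ls_assoc; simp add: b)
    finally show "Cmp ?D ((\<lambda>x\<in>Ob ?C. Cmp ?D (ncmp \<beta> x) (ncmp \<alpha> x)) (Cod ?C f)) (far (ndom \<alpha>) f)
       = Cmp ?D (far (ncod \<beta>) f) ((\<lambda>x\<in>Ob ?C. Cmp ?D (ncmp \<beta> x) (ncmp \<alpha> x)) (Dom ?C f))"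
      using f assms(1) by simp
  qed (use assms in \<open>simp_all add: b d\<close>)
qed

lemma is_nt_hcomp [simp]:
  assumes a: "is_nt \<alpha>" and b: "is_nt \<beta>" and m: "fcod (ndom \<alpha>) = fdom (ndom \<beta>)"
  shows "is_nt (nt_hcomp \<beta> \<alpha>)"
proof -
  \<comment> \<open>The middle category has two names, as target of \<alpha> and as source of
    \<beta>. All facts are rewritten to the second one so that composability is visible to the
    simplifier.\<close>
  let ?C = "fdom (ndom \<alpha>)" and ?D = "fdom (ndom \<beta>)" and ?E = "fcod (ndom \<beta>)"
  note A = is_ntD(1-4)[OF a] is_ntD(6-8)[OF a, unfolded m]
    is_funcD[OF is_nt_ndom[OF a], unfolded m] is_funcD[OF is_nt_ncod[OF a], unfolded fdom_ncod[OF a] fcod_ncod[OF a] m]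
  note B = is_ntD(1-4)[OF b] is_ntD(6-8)[OF b]
    is_funcD[OF is_nt_ndom[OF b]] is_funcD[OF is_nt_ncod[OF b], unfolded fdom_ncod[OF b] fcod_ncod[OF b]]
  show ?thesis
    unfolding nt_hcomp_def
  proof (rule is_ntI)
    fix f assume "f \<in> Ar (fdom (func_comp (ndom \<beta>) (ndom \<alpha>)))"
    then have f: "f \<in> Ar ?C" by simp
    let ?x = "Dom ?C f" and ?y = "Cod ?C f"
    have "Cmp ?E (Cmp ?E (ncmp \<beta> (fob (ncod \<alpha>) ?y)) (far (ndom \<beta>) (ncmp \<alpha> ?y))) (far (ndom \<beta>) (far (ndom \<alpha>) f))
        = Cmp ?E (ncmp \<beta> (fob (ncod \<alpha>) ?y)) (far (ndom \<beta>) (Cmp ?D (ncmp \<alpha> ?y) (far (ndom \<alpha>) f)))"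
      using f by (simp add: A B ls_assoc)
    also have "\<dots> = Cmp ?E (ncmp \<beta> (fob (ncod \<alpha>) ?y)) (far (ndom \<beta>) (Cmp ?D (far (ncod \<alpha>) f) (ncmp \<alpha> ?x)))"
      using nt_natural[OF a f] by (simp add: m)
    also have "\<dots> = Cmp ?E (Cmp ?E (ncmp \<beta> (fob (ncod \<alpha>) ?y)) (far (ndom \<beta>) (far (ncod \<alpha>) f))) (far (ndom \<beta>) (ncmp \<alpha> ?x))"
      using f by (simp add: A B ls_assoc)
    \<comment> \<open>Naturality of \<alpha> has been used under \<open>ndom \<beta>\<close>; now
      naturality of \<beta> is applied to the image of f under \<open>ncod \<alpha>\<close>.\<close>
    also have "\<dots> = Cmp ?E (Cmp ?E (far (ncod \<beta>) (far (ncod \<alpha>) f)) (ncmp \<beta> (fob (ncod \<alpha>) ?x))) (far (ndom \<beta>) (ncmp \<alpha> ?x))"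
      using nt_natural[OF b, of "far (ncod \<alpha>) f"] f by (simp add: A)
    also have "\<dots> = Cmp ?E (far (ncod \<beta>) (far (ncod \<alpha>) f)) (Cmp ?E (ncmp \<beta> (fob (ncod \<alpha>) ?x)) (far (ndom \<beta>) (ncmp \<alpha> ?x)))"
      using f by (simp add: A B ls_assoc)
    finally show "Cmp (fcod (func_comp (ndom \<beta>) (ndom \<alpha>)))
        ((\<lambda>x\<in>Ob ?C. Cmp ?E (ncmp \<beta> (fob (ncod \<alpha>) x)) (far (ndom \<beta>) (ncmp \<alpha> x))) (Cod (fdom (func_comp (ndom \<beta>) (ndom \<alpha>))) f))
        (far (func_comp (ndom \<beta>) (ndom \<alpha>)) f)
      = Cmp (fcod (func_comp (ndom \<beta>) (ndom \<alpha>))) (far (func_comp (ncod \<beta>) (ncod \<alpha>)) f)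
        ((\<lambda>x\<in>Ob ?C. Cmp ?E (ncmp \<beta> (fob (ncod \<alpha>) x)) (far (ndom \<beta>) (ncmp \<alpha> x))) (Dom (fdom (func_comp (ndom \<beta>) (ndom \<alpha>))) f))"
      using f by (simp add: A B)
  qed (simp_all add: A B m)
qed

lemma two_category_CAT: "two_category CAT"
proof (rule two_categoryI)
  fix \<alpha> :: "'a nt" assume "\<alpha> \<in> cell2 CAT"
  then have a: "is_nt \<alpha>" by (simp add: CAT_def)
  have "nt_vcomp \<alpha> (nt_id (ndom \<alpha>)) = \<alpha>" "nt_vcomp (nt_id (ncod \<alpha>)) \<alpha> = \<alpha>"
    using a is_ntD[OF a] by (auto intro!: nt_eqI)
  then show "vcomp CAT \<alpha> (id2 CAT (dom2 CAT \<alpha>)) = \<alpha> \<and> vcomp CAT (id2 CAT (cod2 CAT \<alpha>)) \<alpha> = \<alpha>"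
    by (simp add: CAT_def)
  have "nt_hcomp \<alpha> (nt_id (func_id (fdom (ndom \<alpha>)))) = \<alpha>" "nt_hcomp (nt_id (func_id (fcod (ndom \<alpha>)))) \<alpha> = \<alpha>"
    using a is_ntD[OF a] is_funcD[OF is_nt_ncod[OF a]] by (auto intro!: nt_eqI)
  then show "hcomp CAT \<alpha> (id2 CAT (id1 CAT (dom1 CAT (dom2 CAT \<alpha>)))) = \<alpha> \<and>
      hcomp CAT (id2 CAT (id1 CAT (cod1 CAT (dom2 CAT \<alpha>)))) \<alpha> = \<alpha>"
    by (simp add: CAT_def)
next
  fix \<alpha> \<beta> \<gamma> :: "'a nt" assume "\<alpha> \<in> cell2 CAT" "\<beta> \<in> cell2 CAT" "\<gamma> \<in> cell2 CAT"
    "cod2 CAT \<alpha> = dom2 CAT \<beta>" "cod2 CAT \<beta> = dom2 CAT \<gamma>"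
  then have a: "is_nt \<alpha>" "is_nt \<beta>" "is_nt \<gamma>" "ncod \<alpha> = ndom \<beta>" "ncod \<beta> = ndom \<gamma>"
    by (simp_all add: CAT_def)
  have d: "fdom (ndom \<beta>) = fdom (ndom \<alpha>)" "fcod (ndom \<beta>) = fcod (ndom \<alpha>)"
     "fdom (ndom \<gamma>) = fdom (ndom \<alpha>)" "fcod (ndom \<gamma>) = fcod (ndom \<alpha>)"
    using a fdom_ncod[OF a(1)] fcod_ncod[OF a(1)] fdom_ncod[OF a(2)] fcod_ncod[OF a(2)] by simp_all
  have "nt_vcomp \<gamma> (nt_vcomp \<beta> \<alpha>) = nt_vcomp (nt_vcomp \<gamma> \<beta>) \<alpha>"
  proof (rule nt_eqI)
    fix x assume "x \<in> Ob (fdom (ndom (nt_vcomp \<gamma> (nt_vcomp \<beta> \<alpha>))))"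
    then show "ncmp (nt_vcomp \<gamma> (nt_vcomp \<beta> \<alpha>)) x = ncmp (nt_vcomp (nt_vcomp \<gamma> \<beta>) \<alpha>) x"
      using a is_ntD[OF a(1)] is_ntD[OF a(2), unfolded d] is_ntD[OF a(3), unfolded d] by (simp add: d ls_assoc)
  qed (use a in simp_all)
  then show "vcomp CAT \<gamma> (vcomp CAT \<beta> \<alpha>) = vcomp CAT (vcomp CAT \<gamma> \<beta>) \<alpha>"
    by (simp add: CAT_def)
next
  fix \<alpha> \<beta> \<gamma> :: "'a nt" assume "\<alpha> \<in> cell2 CAT" "\<beta> \<in> cell2 CAT" "\<gamma> \<in> cell2 CAT"
    "cod1 CAT (dom2 CAT \<alpha>) = dom1 CAT (dom2 CAT \<beta>)" "cod1 CAT (dom2 CAT \<beta>) = dom1 CAT (dom2 CAT \<gamma>)"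
  then have a: "is_nt \<alpha>" "is_nt \<beta>" "is_nt \<gamma>" "fcod (ndom \<alpha>) = fdom (ndom \<beta>)" "fcod (ndom \<beta>) = fdom (ndom \<gamma>)"
    by (simp_all add: CAT_def)
  note A = is_ntD(1-4,6-8)[OF a(1), unfolded a(4)]
    is_funcD[OF is_nt_ndom[OF a(1)], unfolded a(4)] is_funcD[OF is_nt_ncod[OF a(1)], unfolded fdom_ncod[OF a(1)] fcod_ncod[OF a(1)] a(4)]
  note B = is_ntD(1-4,6-8)[OF a(2), unfolded a(5)]
    is_funcD[OF is_nt_ndom[OF a(2)], unfolded a(5)] is_funcD[OF is_nt_ncod[OF a(2)], unfolded fdom_ncod[OF a(2)] fcod_ncod[OF a(2)] a(5)]
  have "nt_hcomp \<gamma> (nt_hcomp \<beta> \<alpha>) = nt_hcomp (nt_hcomp \<gamma> \<beta>) \<alpha>"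
  proof (rule nt_eqI)
    fix x assume "x \<in> Ob (fdom (ndom (nt_hcomp \<gamma> (nt_hcomp \<beta> \<alpha>))))"
    then show "ncmp (nt_hcomp \<gamma> (nt_hcomp \<beta> \<alpha>)) x = ncmp (nt_hcomp (nt_hcomp \<gamma> \<beta>) \<alpha>) x"
      using a by (simp add: A B ls_assoc)
  qed (use a in \<open>simp_all add: A B func_comp_assoc\<close>)
  then show "hcomp CAT \<gamma> (hcomp CAT \<beta> \<alpha>) = hcomp CAT (hcomp CAT \<gamma> \<beta>) \<alpha>"
    by (simp add: CAT_def)
next
  fix F G :: "'a func" assume "F \<in> cell1 CAT" "G \<in> cell1 CAT" "cod1 CAT F = dom1 CAT G"
  then have a: "is_func F" "is_func G" "fcod F = fdom G" by (simp_all add: CAT_def)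
  have "nt_id (func_comp G F) = nt_hcomp (nt_id G) (nt_id F)"
    using a is_funcD[OF a(1)] by (auto intro!: nt_eqI)
  then show "id2 CAT (comp1 CAT G F) = hcomp CAT (id2 CAT G) (id2 CAT F)"
    by (simp add: CAT_def)
next
  fix \<alpha> \<alpha>' \<beta> \<beta>' :: "'a nt"
  assume "\<alpha> \<in> cell2 CAT" "\<alpha>' \<in> cell2 CAT" "\<beta> \<in> cell2 CAT" "\<beta>' \<in> cell2 CAT"
    "cod2 CAT \<alpha> = dom2 CAT \<alpha>'" "cod2 CAT \<beta> = dom2 CAT \<beta>'" "cod1 CAT (dom2 CAT \<alpha>) = dom1 CAT (dom2 CAT \<beta>)"
  then have a: "is_nt \<alpha>" "is_nt \<alpha>'" "is_nt \<beta>" "is_nt \<beta>'" "ncod \<alpha> = ndom \<alpha>'" "ncod \<beta> = ndom \<beta>'"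
    "fcod (ndom \<alpha>) = fdom (ndom \<beta>)"
    by (simp_all add: CAT_def)
  let ?C = "fdom (ndom \<alpha>)" and ?D = "fdom (ndom \<beta>)" and ?E = "fcod (ndom \<beta>)"
  have d: "fdom (ndom \<alpha>') = ?C" "fcod (ndom \<alpha>') = ?D" "fdom (ndom \<beta>') = ?D" "fcod (ndom \<beta>') = ?E"
    using a fdom_ncod[OF a(1)] fcod_ncod[OF a(1)] fdom_ncod[OF a(3)] fcod_ncod[OF a(3)] by simp_all
  note A = is_ntD(1-4,6-8)[OF a(1), unfolded a(5,7)] is_ntD(1-4,6-8)[OF a(2), unfolded d]
    is_funcD[OF is_nt_ndom[OF a(1)], unfolded a(7)] is_funcD[OF is_nt_ndom[OF a(2)], unfolded d]
    is_funcD[OF is_nt_ncod[OF a(2)], unfolded fdom_ncod[OF a(2)] fcod_ncod[OF a(2)] d]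
  note B = is_ntD(1-4,6-8)[OF a(3), unfolded a(6)] is_ntD(1-4,6-8)[OF a(4), unfolded d]
    is_funcD[OF is_nt_ndom[OF a(3)]] is_funcD[OF is_nt_ndom[OF a(4)], unfolded d]
    is_funcD[OF is_nt_ncod[OF a(4)], unfolded fdom_ncod[OF a(4)] fcod_ncod[OF a(4)] d]
  have "nt_hcomp (nt_vcomp \<beta>' \<beta>) (nt_vcomp \<alpha>' \<alpha>) = nt_vcomp (nt_hcomp \<beta>' \<alpha>') (nt_hcomp \<beta> \<alpha>)"
  proof (rule nt_eqI)
    fix x assume "x \<in> Ob (fdom (ndom (nt_hcomp (nt_vcomp \<beta>' \<beta>) (nt_vcomp \<alpha>' \<alpha>))))"
    then have x: "x \<in> Ob ?C" by simp
    let ?y = "fob (ncod \<alpha>') x"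
    have "Cmp ?E (Cmp ?E (ncmp \<beta>' ?y) (ncmp \<beta> ?y)) (Cmp ?E (far (ndom \<beta>) (ncmp \<alpha>' x)) (far (ndom \<beta>) (ncmp \<alpha> x)))
        = Cmp ?E (ncmp \<beta>' ?y) (Cmp ?E (Cmp ?E (ncmp \<beta> ?y) (far (ndom \<beta>) (ncmp \<alpha>' x))) (far (ndom \<beta>) (ncmp \<alpha> x)))"
      using x by (simp add: A B ls_assoc)
    \<comment> \<open>The whole content of interchange: naturality of \<beta> at the component of
      \<alpha>' moves the latter past \<beta>. Everything else is reassociation.\<close>
    also have "\<dots> = Cmp ?E (ncmp \<beta>' ?y) (Cmp ?E (Cmp ?E (far (ndom \<beta>') (ncmp \<alpha>' x)) (ncmp \<beta> (fob (ndom \<alpha>') x))) (far (ndom \<beta>) (ncmp \<alpha> x)))"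
      using nt_natural[OF a(3), of "ncmp \<alpha>' x"] x by (simp add: A B a(6))
    also have "\<dots> = Cmp ?E (Cmp ?E (ncmp \<beta>' ?y) (far (ndom \<beta>') (ncmp \<alpha>' x))) (Cmp ?E (ncmp \<beta> (fob (ndom \<alpha>') x)) (far (ndom \<beta>) (ncmp \<alpha> x)))"
      using x by (simp add: A B ls_assoc)
    finally show "ncmp (nt_hcomp (nt_vcomp \<beta>' \<beta>) (nt_vcomp \<alpha>' \<alpha>)) x = ncmp (nt_vcomp (nt_hcomp \<beta>' \<alpha>') (nt_hcomp \<beta> \<alpha>)) x"
      using x by (simp add: A B a(5-7) d)
  qed (use a in \<open>simp_all add: A B d\<close>)
  then show "hcomp CAT (vcomp CAT \<beta>' \<beta>) (vcomp CAT \<alpha>' \<alpha>) = vcomp CAT (hcomp CAT \<beta>' \<alpha>') (hcomp CAT \<beta> \<alpha>)"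
    by (simp add: CAT_def)
qed (auto simp: CAT_def func_comp_assoc)

lemma two_category_CAT2: "two_category CAT2"
  unfolding CAT2_def by (rule two_category_arrow_twocat[OF two_category_CAT])

lemma is_func_rules [simp]:
  assumes "is_func F"
  shows "\<lbrakk>fcod F = D; x \<in> Ob (fdom F)\<rbrakk> \<Longrightarrow> fob F x \<in> Ob D"
    and "\<lbrakk>fcod F = D; f \<in> Ar (fdom F)\<rbrakk> \<Longrightarrow> far F f \<in> Ar D"
    and "\<lbrakk>fcod F = D; f \<in> Ar (fdom F)\<rbrakk> \<Longrightarrow> Dom D (far F f) = fob F (Dom (fdom F) f)"
    and "\<lbrakk>fcod F = D; f \<in> Ar (fdom F)\<rbrakk> \<Longrightarrow> Cod D (far F f) = fob F (Cod (fdom F) f)"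
    and "\<lbrakk>fdom F = C; x \<in> Ob C\<rbrakk> \<Longrightarrow> far F (Idn C x) = Idn (fcod F) (fob F x)"
    and "\<lbrakk>fdom F = C; f \<in> Ar C; g \<in> Ar C; Cod C f = Dom C g\<rbrakk>
      \<Longrightarrow> far F (Cmp C g f) = Cmp (fcod F) (far F g) (far F f)"
  using assms by auto

lemma is_nt_rules [simp]:
  assumes "is_nt \<alpha>"
  shows "\<lbrakk>fcod (ndom \<alpha>) = D; x \<in> Ob (fdom (ndom \<alpha>))\<rbrakk> \<Longrightarrow> ncmp \<alpha> x \<in> Ar D"
    and "\<lbrakk>fcod (ndom \<alpha>) = D; x \<in> Ob (fdom (ndom \<alpha>))\<rbrakk> \<Longrightarrow> Dom D (ncmp \<alpha> x) = fob (ndom \<alpha>) x"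
    and "\<lbrakk>fcod (ndom \<alpha>) = D; x \<in> Ob (fdom (ndom \<alpha>))\<rbrakk> \<Longrightarrow> Cod D (ncmp \<alpha> x) = fob (ncod \<alpha>) x"
  using assms by auto

text \<open>Whiskering composes each component with an identity arrow. The equations between
  boundary functors are needed because a transformation records its source and target. This is the
  pointwise form of every 2-cell equation below.\<close>

lemma whisker_eq_iff:
  assumes "is_nt \<beta>" "is_nt \<gamma>" "is_func F" "is_func G"
    and "fcod (ndom \<beta>) = fdom G" "fcod F = fdom (ndom \<gamma>)" "fdom (ndom \<beta>) = fdom F" "fcod (ndom \<gamma>) = fcod G"
    and "func_comp G (ndom \<beta>) = func_comp (ndom \<gamma>) F" "func_comp G (ncod \<beta>) = func_comp (ncod \<gamma>) F"
  shows "nt_hcomp (nt_id G) \<beta> = nt_hcomp \<gamma> (nt_id F) \<longleftrightarrow> (\<forall>x\<in>Ob (fdom F). far G (ncmp \<beta> x) = ncmp \<gamma> (fob F x))"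
    (is "?l = ?r \<longleftrightarrow> _")
proof -
  note [simp] = assms(1-8)
  have l: "ncmp ?l x = far G (ncmp \<beta> x)" if "x \<in> Ob (fdom F)" for x
    using that by simp
  have r: "ncmp ?r x = ncmp \<gamma> (fob F x)" if "x \<in> Ob (fdom F)" for x
    using that by simp
  have "?l = ?r" if "\<forall>x\<in>Ob (fdom F). far G (ncmp \<beta> x) = ncmp \<gamma> (fob F x)"
    by (rule nt_eqI) (use assms(9,10) that l r in simp_all)
  then show ?thesis using l r by metis
qed

lemma is_func_restrictI:
  assumes "ls_category C" "ls_category D"
    and "\<And>x. x \<in> Ob C \<Longrightarrow> p x \<in> Ob D"
    and "\<And>f. f \<in> Ar C \<Longrightarrow> a f \<in> Ar D \<and> Dom D (a f) = p (Dom C f) \<and> Cod D (a f) = p (Cod C f)"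
    and "\<And>x. x \<in> Ob C \<Longrightarrow> a (Idn C x) = Idn D (p x)"
    and "\<And>f g. \<lbrakk>f \<in> Ar C; g \<in> Ar C; Cod C f = Dom C g\<rbrakk> \<Longrightarrow> a (Cmp C g f) = Cmp D (a g) (a f)"
  shows "is_func \<lparr>fdom = C, fcod = D, fob = restrict p (Ob C), far = restrict a (Ar C)\<rparr>"
  using assms by (simp add: is_func_def Let_def)

lemma is_nt_restrictI:
  assumes "is_func F" "is_func G" "fdom G = fdom F" "fcod G = fcod F" "C = fdom F"
    and "\<And>x. x \<in> Ob (fdom F) \<Longrightarrow> n x \<in> Ar (fcod F) \<and> Dom (fcod F) (n x) = fob F x \<and> Cod (fcod F) (n x) = fob G x"
    and "\<And>f. f \<in> Ar (fdom F) \<Longrightarrow> Cmp (fcod F) (n (Cod (fdom F) f)) (far F f) = Cmp (fcod F) (far G f) (n (Dom (fdom F) f))"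
  shows "is_nt \<lparr>ndom = F, ncod = G, ncmp = restrict n (Ob C)\<rparr>"
  using assms by (intro is_ntI) auto

subsection \<open>Cells of the arrow 2-category\<close>

text \<open>The commutation Q T = S P is spelled out on objects and arrows so that it can serve as a
  family of rewrite rules.\<close>

definition square :: "'u::universe func \<Rightarrow> 'u func \<Rightarrow> 'u func \<Rightarrow> 'u func \<Rightarrow> bool" where
  "square P Q T S \<longleftrightarrow> is_func P \<and> is_func Q \<and> is_func T \<and> is_func S \<and>
     fdom T = fdom P \<and> fcod T = fdom Q \<and> fdom S = fcod P \<and> fcod S = fcod Q \<and>
     (\<forall>x\<in>Ob (fdom P). fob Q (fob T x) = fob S (fob P x)) \<and>
     (\<forall>f\<in>Ar (fdom P). far Q (far T f) = far S (far P f))"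

definition square_nt :: "'u::universe func \<Rightarrow> 'u func \<Rightarrow> 'u nt \<Rightarrow> 'u nt \<Rightarrow> bool" where
  "square_nt P Q \<beta> \<alpha> \<longleftrightarrow> is_nt \<beta> \<and> is_nt \<alpha> \<and> square P Q (ndom \<beta>) (ndom \<alpha>) \<and> square P Q (ncod \<beta>) (ncod \<alpha>) \<and>
     (\<forall>x\<in>Ob (fdom P). far Q (ncmp \<beta> x) = ncmp \<alpha> (fob P x))"

lemma squareD:
  assumes "square P Q T S"
  shows "is_func P" "is_func Q" "is_func T" "is_func S"
    "fdom T = fdom P" "fcod T = fdom Q" "fdom S = fcod P" "fcod S = fcod Q"
    "\<And>x. x \<in> Ob (fdom P) \<Longrightarrow> fob Q (fob T x) = fob S (fob P x)"
    "\<And>f. f \<in> Ar (fdom P) \<Longrightarrow> far Q (far T f) = far S (far P f)"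
  using assms by (auto simp: square_def)

lemma square_ntD:
  assumes "square_nt P Q \<beta> \<alpha>"
  shows "is_nt \<beta>" "is_nt \<alpha>" "square P Q (ndom \<beta>) (ndom \<alpha>)" "square P Q (ncod \<beta>) (ncod \<alpha>)"
    "\<And>x. x \<in> Ob (fdom P) \<Longrightarrow> far Q (ncmp \<beta> x) = ncmp \<alpha> (fob P x)"
  using assms by (auto simp: square_nt_def)

lemma CAT2_cell0: "cell0 CAT2 = {P. is_func P}"
  by (simp add: CAT2_def arrow_twocat_def CAT_def)

lemma CAT2_sel [simp]:
  "dom1 CAT2 = osrc" "cod1 CAT2 = otgt"
  "dom2 CAT2 \<theta> = \<lparr>osrc = osrc \<theta>, otgt = otgt \<theta>, und = (ndom (fst (und \<theta>)), ndom (snd (und \<theta>)))\<rparr>"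
  "cod2 CAT2 \<theta> = \<lparr>osrc = osrc \<theta>, otgt = otgt \<theta>, und = (ncod (fst (und \<theta>)), ncod (snd (und \<theta>)))\<rparr>"
  "id1 CAT2 P = \<lparr>osrc = P, otgt = P, und = (func_id (fdom P), func_id (fcod P))\<rparr>"
  "id2 CAT2 h = \<lparr>osrc = osrc h, otgt = otgt h, und = (nt_id (fst (und h)), nt_id (snd (und h)))\<rparr>"
  "comp1 CAT2 k h = \<lparr>osrc = osrc h, otgt = otgt k,
     und = (func_comp (fst (und k)) (fst (und h)), func_comp (snd (und k)) (snd (und h)))\<rparr>"
  "vcomp CAT2 \<theta>' \<theta> = \<lparr>osrc = osrc \<theta>, otgt = otgt \<theta>,
     und = (nt_vcomp (fst (und \<theta>')) (fst (und \<theta>)), nt_vcomp (snd (und \<theta>')) (snd (und \<theta>)))\<rparr>"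
  "hcomp CAT2 \<theta>' \<theta> = \<lparr>osrc = osrc \<theta>, otgt = otgt \<theta>',
     und = (nt_hcomp (fst (und \<theta>')) (fst (und \<theta>)), nt_hcomp (snd (und \<theta>')) (snd (und \<theta>)))\<rparr>"
  by (simp_all add: CAT2_def arrow_twocat_def CAT_def prod_twocat_def split_beta)

lemma func_comp_eq_iff:
  assumes "is_func F" "is_func G" "is_func F'" "is_func G'"
    "fcod F = fdom G" "fcod F' = fdom G'" "fdom F = fdom F'" "fcod G = fcod G'"
  shows "func_comp G F = func_comp G' F' \<longleftrightarrow>
    (\<forall>x\<in>Ob (fdom F). fob G (fob F x) = fob G' (fob F' x)) \<and> (\<forall>f\<in>Ar (fdom F). far G (far F f) = far G' (far F' f))"
    (is "?l \<longleftrightarrow> ?r")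
proof
  assume l: ?l
  have "fob (func_comp G F) x = fob (func_comp G' F') x" "far (func_comp G F) x = far (func_comp G' F') x" for x
    using l by simp_all
  then show ?r using assms(7) by (auto simp: func_comp_def restrict_def split: if_splits) metis+
next
  assume ?r then show ?l using assms by (intro func_eqI) auto
qed

lemma CAT2_cell1:
  "h \<in> cell1 CAT2 \<longleftrightarrow> square (osrc h) (otgt h) (fst (und h)) (snd (und h))"
proof (cases "und h")
  case (Pair T S)
  let ?P = "osrc h" and ?Q = "otgt h"
  have "h \<in> cell1 CAT2 \<longleftrightarrow> is_func ?P \<and> is_func ?Q \<and> is_func T \<and> is_func S \<and>
     fdom T = fdom ?P \<and> fdom S = fcod ?P \<and> fcod T = fdom ?Q \<and> fcod S = fcod ?Q \<and> func_comp ?Q T = func_comp S ?P"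
    by (auto simp: CAT2_def arrow_twocat_def CAT_def prod_twocat_def structured_cell1 Pair)
  also have "\<dots> \<longleftrightarrow> square ?P ?Q T S"
    using func_comp_eq_iff[of T ?Q ?P S] by (auto simp: square_def)
  finally show ?thesis by (simp add: Pair)
qed

text \<open>The whiskered equation becomes a pointwise one only once both boundaries are known to be
  squares, so the boundaries are treated before it.\<close>

lemma CAT2_cell2:
  "\<theta> \<in> cell2 CAT2 \<longleftrightarrow> square_nt (osrc \<theta>) (otgt \<theta>) (fst (und \<theta>)) (snd (und \<theta>))"
proof (cases "und \<theta>")
  case (Pair \<beta> \<alpha>)
  let ?P = "osrc \<theta>" and ?Q = "otgt \<theta>"
  have c1: "\<lparr>osrc = ?P, otgt = ?Q, und = (T, S)\<rparr> \<in> cell1 CAT2 \<longleftrightarrow> square ?P ?Q T S" for T S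
    by (simp add: CAT2_cell1)
  have "\<theta> \<in> cell2 CAT2 \<longleftrightarrow> is_nt \<beta> \<and> is_nt \<alpha> \<and>
      \<lparr>osrc = ?P, otgt = ?Q, und = (ndom \<beta>, ndom \<alpha>)\<rparr> \<in> cell1 CAT2 \<and>
      \<lparr>osrc = ?P, otgt = ?Q, und = (ncod \<beta>, ncod \<alpha>)\<rparr> \<in> cell1 CAT2 \<and>
      nt_hcomp (nt_id ?Q) \<beta> = nt_hcomp \<alpha> (nt_id ?P)"
    by (auto simp: CAT2_def arrow_twocat_def CAT_def prod_twocat_def structured_cell1 structured_cell2 Pair)
  also have "\<dots> \<longleftrightarrow> is_nt \<beta> \<and> is_nt \<alpha> \<and> square ?P ?Q (ndom \<beta>) (ndom \<alpha>) \<and> square ?P ?Q (ncod \<beta>) (ncod \<alpha>) \<and>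
      nt_hcomp (nt_id ?Q) \<beta> = nt_hcomp \<alpha> (nt_id ?P)"
    unfolding c1 ..
  also have "\<dots> \<longleftrightarrow> square_nt ?P ?Q \<beta> \<alpha>"
  proof -
    have "nt_hcomp (nt_id ?Q) \<beta> = nt_hcomp \<alpha> (nt_id ?P) \<longleftrightarrow> (\<forall>x\<in>Ob (fdom ?P). far ?Q (ncmp \<beta> x) = ncmp \<alpha> (fob ?P x))"
      if n: "is_nt \<beta>" "is_nt \<alpha>" and s: "square ?P ?Q (ndom \<beta>) (ndom \<alpha>)" and t: "square ?P ?Q (ncod \<beta>) (ncod \<alpha>)"
    proof -
      note [simp] = n squareD[OF s] squareD[OF t]
      show ?thesis by (rule whisker_eq_iff) (simp_all add: func_comp_eq_iff)
    qed
    then show ?thesis unfolding square_nt_def by blast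
  qed
  finally show ?thesis by (simp add: Pair)
qed

section \<open>The dual comma 2-monad\<close>

lemma pair_eq_iff [simp]: "pair a b = pair c d \<longleftrightarrow> a = c \<and> b = d"
  by (auto dest: pair_inject)

lemma pfst_pair [simp]: "pfst (pair a b) = a" and psnd_pair [simp]: "psnd (pair a b) = b"
  by (auto simp: pfst_def psnd_def)

lemma cobj_sel [simp]: "cbase (cobj b u x) = b" "cmor (cobj b u x) = u" "ctop (cobj b u x) = x"
  by (simp_all add: cobj_def cbase_def cmor_def ctop_def)

lemma carr_sel [simp]:
  "adom (carr X Y s f) = X" "acod (carr X Y s f) = Y" "abase (carr X Y s f) = s" "atop (carr X Y s f) = f"
  by (simp_all add: carr_def adom_def acod_def abase_def atop_def)

lemma cobj_eq_iff [simp]: "cobj b u x = cobj b' u' x' \<longleftrightarrow> b = b' \<and> u = u' \<and> x = x'"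
  by (simp add: cobj_def)

lemma carr_eq_iff [simp]: "carr X Y s f = carr X' Y' s' f' \<longleftrightarrow> X = X' \<and> Y = Y' \<and> s = s' \<and> f = f'"
  by (auto simp: carr_def)

lemma comma_Ob: "Ob (comma P) = {cobj b u x | b u x. x \<in> Ob (fdom P) \<and> u \<in> hom (fcod P) b (fob P x)}"
  by (simp add: comma_def Let_def)

lemma cobj_in_comma [simp]: "cobj b u x \<in> Ob (comma P) \<longleftrightarrow>
    x \<in> Ob (fdom P) \<and> u \<in> Ar (fcod P) \<and> Dom (fcod P) u = b \<and> Cod (fcod P) u = fob P x"
  by (auto simp: comma_Ob hom_def)

lemma comma_ObD:
  assumes "X \<in> Ob (comma P)"
  shows "ctop X \<in> Ob (fdom P)" "cmor X \<in> Ar (fcod P)"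
    "Dom (fcod P) (cmor X) = cbase X" "Cod (fcod P) (cmor X) = fob P (ctop X)"
  using assms by (auto simp: comma_Ob hom_def)

lemma cobj_collapse: "X \<in> Ob (comma P) \<Longrightarrow> cobj (cbase X) (cmor X) (ctop X) = X"
  by (auto simp: comma_Ob)

lemma comma_Ob_cbase:
  assumes "is_func P" "X \<in> Ob (comma P)" shows "cbase X \<in> Ob (fcod P)"
  using comma_ObD[OF assms(2)] cat_dom[OF category_ls[OF is_func_fcod[OF assms(1)]], of "cmor X"] by simp

lemma comma_Ar: "Ar (comma P) = {carr X Y s f | X Y s f. X \<in> Ob (comma P) \<and> Y \<in> Ob (comma P) \<and>
               s \<in> hom (fcod P) (cbase X) (cbase Y) \<and> f \<in> hom (fdom P) (ctop X) (ctop Y) \<and>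
               Cmp (fcod P) (far P f) (cmor X) = Cmp (fcod P) (cmor Y) s}"
  by (simp add: comma_def Let_def)

lemma carr_in_comma [simp]: "carr X Y s f \<in> Ar (comma P) \<longleftrightarrow> X \<in> Ob (comma P) \<and> Y \<in> Ob (comma P) \<and>
    s \<in> Ar (fcod P) \<and> Dom (fcod P) s = cbase X \<and> Cod (fcod P) s = cbase Y \<and>
    f \<in> Ar (fdom P) \<and> Dom (fdom P) f = ctop X \<and> Cod (fdom P) f = ctop Y \<and>
    Cmp (fcod P) (far P f) (cmor X) = Cmp (fcod P) (cmor Y) s"
  by (auto simp: comma_Ar hom_def)

lemma comma_ArD:
  assumes "h \<in> Ar (comma P)"
  shows "adom h \<in> Ob (comma P)" "acod h \<in> Ob (comma P)" "abase h \<in> Ar (fcod P)" "atop h \<in> Ar (fdom P)"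
    "Dom (fcod P) (abase h) = cbase (adom h)" "Cod (fcod P) (abase h) = cbase (acod h)"
    "Dom (fdom P) (atop h) = ctop (adom h)" "Cod (fdom P) (atop h) = ctop (acod h)"
  using assms by (auto simp: comma_Ar hom_def)

lemma comma_Ar_square: "h \<in> Ar (comma P) \<Longrightarrow>
    Cmp (fcod P) (far P (atop h)) (cmor (adom h)) = Cmp (fcod P) (cmor (acod h)) (abase h)"
  by (auto simp: comma_Ar hom_def)

lemma carr_collapse: "h \<in> Ar (comma P) \<Longrightarrow> carr (adom h) (acod h) (abase h) (atop h) = h"
  by (auto simp: comma_Ar)

lemma comma_sel [simp]:
  "h \<in> Ar (comma P) \<Longrightarrow> Dom (comma P) h = adom h"
  "h \<in> Ar (comma P) \<Longrightarrow> Cod (comma P) h = acod h"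
  "X \<in> Ob (comma P) \<Longrightarrow> Idn (comma P) X = carr X X (Idn (fcod P) (cbase X)) (Idn (fdom P) (ctop X))"
  "\<lbrakk>h \<in> Ar (comma P); k \<in> Ar (comma P); acod h = adom k\<rbrakk> \<Longrightarrow>
    Cmp (comma P) k h = carr (adom h) (acod k) (Cmp (fcod P) (abase k) (abase h)) (Cmp (fdom P) (atop k) (atop h))"
  by (simp_all add: comma_def Let_def)

text \<open>Two commuting squares pasted side by side.\<close>

lemma comma_Cmp_Ar:
  assumes P: "is_func P" and f: "f \<in> Ar (comma P)" and g: "g \<in> Ar (comma P)" and m: "acod f = adom g"
  shows "Cmp (comma P) g f \<in> Ar (comma P)"
proof -
  note [simp] = P comma_ObD comma_ArD comma_Ob_cbase[OF P]
  let ?B = "fcod P"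
  have "Cmp ?B (Cmp ?B (far P (atop g)) (far P (atop f))) (cmor (adom f))
      = Cmp ?B (far P (atop g)) (Cmp ?B (far P (atop f)) (cmor (adom f)))"
    by (rule ls_assoc) (use f g m in simp_all)
  also have "\<dots> = Cmp ?B (far P (atop g)) (Cmp ?B (cmor (adom g)) (abase f))"
    using comma_Ar_square[OF f] m by simp
  also have "\<dots> = Cmp ?B (Cmp ?B (far P (atop g)) (cmor (adom g))) (abase f)"
    by (rule ls_assoc[symmetric]) (use f g m in simp_all)
  also have "\<dots> = Cmp ?B (cmor (acod g)) (Cmp ?B (abase g) (abase f))"
    unfolding comma_Ar_square[OF g] by (rule ls_assoc) (use f g m in simp_all)
  finally show ?thesis
    using f g m by simp
qed

lemma ls_category_comma [simp]:
  assumes P: "is_func P"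
  shows "ls_category (comma P)"
proof -
  note [simp] = P comma_ObD comma_ArD comma_Ob_cbase[OF P]
  have "category (comma P)"
    unfolding category_def
  proof (intro conjI ballI impI)
    fix f g assume f: "f \<in> Ar (comma P)" and g: "g \<in> Ar (comma P)" and "Cod (comma P) f = Dom (comma P) g"
    then have m: "acod f = adom g" by simp
    show "Cmp (comma P) g f \<in> Ar (comma P)"
      by (rule comma_Cmp_Ar[OF P f g m])
    \<comment> \<open>Membership of the composite is available as one fact.
      \<open>carr_in_comma\<close> would break it into conditions on the components, so it is
      switched off here and in the similar computations below.\<close>
    then show "Dom (comma P) (Cmp (comma P) g f) = Dom (comma P) f"
      "Cod (comma P) (Cmp (comma P) g f) = Cod (comma P) g"
      using f g m by (simp_all del: carr_in_comma)
  next
    fix f g h assume f: "f \<in> Ar (comma P)" and g: "g \<in> Ar (comma P)" and h: "h \<in> Ar (comma P)"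
      and "Cod (comma P) f = Dom (comma P) g \<and> Cod (comma P) g = Dom (comma P) h"
    then have m: "acod f = adom g" "acod g = adom h" by simp_all
    show "Cmp (comma P) h (Cmp (comma P) g f) = Cmp (comma P) (Cmp (comma P) h g) f"
      using f g h m comma_Cmp_Ar[OF P f g m(1)] comma_Cmp_Ar[OF P g h m(2)]
      by (simp add: ls_assoc del: carr_in_comma)
  next
    fix f assume f: "f \<in> Ar (comma P)"
    show "Cmp (comma P) f (Idn (comma P) (Dom (comma P) f)) = f" "Cmp (comma P) (Idn (comma P) (Cod (comma P) f)) f = f"
      using f carr_collapse[OF f] by simp_all
  qed simp_all
  \<comment> \<open>For fixed ends an arrow is coded by its two components, so the hom-set embeds
    into the image of a set of pairs taken from two small hom-sets.\<close>
  moreover have "small (hom (comma P) X Y)" if "X \<in> Ob (comma P)" "Y \<in> Ob (comma P)" for X Y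
  proof -
    let ?H = "{pair s f | s f. s \<in> hom (fcod P) (cbase X) (cbase Y) \<and> f \<in> hom (fdom P) (ctop X) (ctop Y)}"
    have "small (hom (fcod P) (cbase X) (cbase Y))" "small (hom (fdom P) (ctop X) (ctop Y))"
      using that is_func_fcod[OF P] is_func_fdom[OF P] unfolding ls_category_def by simp_all
    then have "small (pair (pair X Y) ` ?H)" by (intro small_image small_pairs)
    moreover have "hom (comma P) X Y \<subseteq> pair (pair X Y) ` ?H"
    proof
      fix h assume "h \<in> hom (comma P) X Y"
      then have h: "h \<in> Ar (comma P)" "adom h = X" "acod h = Y" by (auto simp: hom_def)
      then have "h = pair (pair X Y) (pair (abase h) (atop h))"
        using carr_collapse[OF h(1)] by (simp add: carr_def)
      moreover have "pair (abase h) (atop h) \<in> ?H"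
        using comma_ArD[OF h(1)] h by (auto simp: hom_def)
      ultimately show "h \<in> pair (pair X Y) ` ?H" by blast
    qed
    ultimately show ?thesis by (rule small_subset)
  qed
  moreover have "Cmp (comma P) g f = undefined"
    if "\<not> (f \<in> Ar (comma P) \<and> g \<in> Ar (comma P) \<and> Cod (comma P) f = Dom (comma P) g)" for f g
  proof -
    have "\<not> (f \<in> Ar (comma P) \<and> g \<in> Ar (comma P) \<and> acod f = adom g)" using that by auto
    then show ?thesis unfolding comma_Ar comma_Ob by (auto simp: comma_def Let_def)
  qed
  ultimately show ?thesis
    unfolding ls_category_def by (auto simp: comma_def Let_def)
qed

lemma DomF_sel [simp]:
  "fdom (DomF P) = comma P" "fcod (DomF P) = fcod P"
  "X \<in> Ob (comma P) \<Longrightarrow> fob (DomF P) X = cbase X" "h \<in> Ar (comma P) \<Longrightarrow> far (DomF P) h = abase h"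
  by (simp_all add: DomF_def)

lemma is_func_DomF [simp]:
  assumes "is_func P" shows "is_func (DomF P)"
  unfolding DomF_def
  by (rule is_func_restrictI) (use assms in \<open>simp_all add: comma_ObD comma_ArD comma_Ob_cbase\<close>)

section \<open>The 2-functor on squares and on their 2-cells\<close>

lemma square_comp:
  assumes s: "square P Q T S" and t: "square Q R T' S'"
  shows "square P R (func_comp T' T) (func_comp S' S)"
  unfolding square_def using squareD[OF s] squareD[OF t] by simp

lemma square_id: "is_func P \<Longrightarrow> square P P (func_id (fdom P)) (func_id (fcod P))"
  by (simp add: square_def)

abbreviation comma_arr :: "'u::universe func \<Rightarrow> 'u func \<Rightarrow> 'u \<Rightarrow> 'u" where
  "comma_arr T S h \<equiv> carr (comma_ob T S (adom h)) (comma_ob T S (acod h)) (far S (abase h)) (far T (atop h))"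

abbreviation comma_cmp :: "'u::universe nt \<Rightarrow> 'u nt \<Rightarrow> 'u \<Rightarrow> 'u" where
  "comma_cmp \<beta> \<alpha> X \<equiv> carr (comma_ob (ndom \<beta>) (ndom \<alpha>) X) (comma_ob (ncod \<beta>) (ncod \<alpha>) X)
     (ncmp \<alpha> (cbase X)) (ncmp \<beta> (ctop X))"

abbreviation comma_M_arr :: "'u::universe func \<Rightarrow> 'u \<Rightarrow> 'u" where
  "comma_M_arr P k \<equiv> carr (comma_M_ob P (adom k)) (comma_M_ob P (acod k)) (abase k) (atop (atop k))"

lemma comma_ob_sel [simp]:
  "cbase (comma_ob T S X) = fob S (cbase X)" "cmor (comma_ob T S X) = far S (cmor X)"
  "ctop (comma_ob T S X) = fob T (ctop X)"
  by (simp_all add: comma_ob_def)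

lemma comma_map_sel [simp]:
  "fdom (comma_map P Q T S) = comma P" "fcod (comma_map P Q T S) = comma Q"
  "X \<in> Ob (comma P) \<Longrightarrow> fob (comma_map P Q T S) X = comma_ob T S X"
  "h \<in> Ar (comma P) \<Longrightarrow> far (comma_map P Q T S) h =
     comma_arr T S h"
  by (simp_all add: comma_map_def)

lemma comma_ob_in:
  assumes s: "square P Q T S" and X: "X \<in> Ob (comma P)"
  shows "comma_ob T S X \<in> Ob (comma Q)"
  using squareD[OF s] comma_ObD[OF X] by (simp add: comma_ob_def)

lemma comma_map_in:
  assumes s: "square P Q T S" and h: "h \<in> Ar (comma P)"
  shows "comma_arr T S h \<in> Ar (comma Q)"
proof -
  note [simp] = squareD[OF s] comma_ArD[OF h] comma_ObD[of _ P]
  \<comment> \<open>The commuting square of \<open>h\<close> is carried along \<open>S\<close>, and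
    Q T = S P rewrites its left leg.\<close>
  show ?thesis
    using arg_cong[OF comma_Ar_square[OF h], of "far S"] by (simp add: comma_ob_in[OF s])
qed

lemma is_func_comma_map:
  assumes s: "square P Q T S"
  shows "is_func (comma_map P Q T S)"
  unfolding comma_map_def
proof (rule is_func_restrictI)
  note [simp] = squareD[OF s] comma_ArD[of _ P] comma_ObD[of _ P] comma_Ob_cbase[of P]
  show "ls_category (comma P)" "ls_category (comma Q)" by simp_all
  fix X assume X: "X \<in> Ob (comma P)"
  show "comma_ob T S X \<in> Ob (comma Q)" by (rule comma_ob_in[OF s X])
  then show "comma_arr T S (Idn (comma P) X)
      = Idn (comma Q) (comma_ob T S X)"
    using X by simp
next
  note [simp] = squareD[OF s] comma_ArD[of _ P] comma_ObD[of _ P]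
  fix h assume h: "h \<in> Ar (comma P)"
  show "comma_arr T S h \<in> Ar (comma Q) \<and>
      Dom (comma Q) (comma_arr T S h) = comma_ob T S (Dom (comma P) h) \<and>
      Cod (comma Q) (comma_arr T S h) = comma_ob T S (Cod (comma P) h)"
    using comma_map_in[OF s h] h by (simp del: carr_in_comma)
next
  note [simp] = squareD[OF s] comma_ArD[of _ P] comma_ObD[of _ P]
  fix f g assume f: "f \<in> Ar (comma P)" and g: "g \<in> Ar (comma P)" and m: "Cod (comma P) f = Dom (comma P) g"
  have m': "acod f = adom g" using f g m by simp
  show "comma_arr T S (Cmp (comma P) g f)
      = Cmp (comma Q) (comma_arr T S g)
         (comma_arr T S f)"
    using f g m' comma_map_in[OF s f] comma_map_in[OF s g] by (simp del: carr_in_comma)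
qed

lemma square_comma_map:
  assumes s: "square P Q T S"
  shows "square (DomF P) (DomF Q) (comma_map P Q T S) S"
  unfolding square_def
  using squareD[OF s] is_func_comma_map[OF s] comma_ob_in[OF s] comma_map_in[OF s]
  by (simp del: carr_in_comma)

lemma comma_nt_sel [simp]:
  "ndom (comma_nt P Q \<beta> \<alpha>) = comma_map P Q (ndom \<beta>) (ndom \<alpha>)"
  "ncod (comma_nt P Q \<beta> \<alpha>) = comma_map P Q (ncod \<beta>) (ncod \<alpha>)"
  "X \<in> Ob (comma P) \<Longrightarrow> ncmp (comma_nt P Q \<beta> \<alpha>) X =
     comma_cmp \<beta> \<alpha> X"
  by (simp_all add: comma_nt_def)

lemma comma_nt_in:
  assumes n: "square_nt P Q \<beta> \<alpha>" and X: "X \<in> Ob (comma P)"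
  shows "comma_cmp \<beta> \<alpha> X
     \<in> Ar (comma Q)"
proof -
  note s = square_ntD(3)[OF n] and t = square_ntD(4)[OF n]
  note [simp] = squareD[OF s] squareD[OF t] square_ntD[OF n] comma_ObD[OF X] comma_Ob_cbase[OF _ X]
    comma_ob_in[OF s X] comma_ob_in[OF t X]
  \<comment> \<open>The required square is naturality of \<alpha> at the arrow
    \<open>cmor X\<close>, after replacing the image of the \<beta>-component under Q by a component
    of \<alpha>.\<close>
  show ?thesis
    using nt_natural[OF square_ntD(2)[OF n], of "cmor X"] by simp
qed

lemma square_nt_comma_nt:
  assumes n: "square_nt P Q \<beta> \<alpha>"
  shows "square_nt (DomF P) (DomF Q) (comma_nt P Q \<beta> \<alpha>) \<alpha>"
proof -
  let ?F = "comma_map P Q (ndom \<beta>) (ndom \<alpha>)"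
  note s = square_ntD(3)[OF n] and t = square_ntD(4)[OF n]
  note [simp] = squareD[OF s] squareD[OF t] square_ntD(1,2,5)[OF n] is_func_comma_map[OF s] is_func_comma_map[OF t]
  have "is_nt (comma_nt P Q \<beta> \<alpha>)"
    unfolding comma_nt_def
  proof (rule is_nt_restrictI)
    fix h assume "h \<in> Ar (fdom ?F)"
    then have h: "h \<in> Ar (comma P)" by simp
    note [simp] = comma_ArD[OF h] comma_ObD[of _ P] h
    show "Cmp (fcod ?F)
        (comma_cmp \<beta> \<alpha> (Cod (fdom ?F) h))
        (far ?F h)
      = Cmp (fcod ?F) (far (comma_map P Q (ncod \<beta>) (ncod \<alpha>)) h)
        (comma_cmp \<beta> \<alpha> (Dom (fdom ?F) h))"
      using comma_nt_in[OF n, of "adom h"] comma_nt_in[OF n, of "acod h"] comma_map_in[OF s h] comma_map_in[OF t h]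
        nt_natural[OF square_ntD(2)[OF n], of "abase h"] nt_natural[OF square_ntD(1)[OF n], of "atop h"]
      by (simp del: carr_in_comma)
  qed (use comma_nt_in[OF n] in \<open>simp_all del: carr_in_comma\<close>)
  then show ?thesis
    unfolding square_nt_def
    using comma_nt_in[OF n] square_comma_map[OF s] square_comma_map[OF t] by (simp del: carr_in_comma)
qed

lemma comma_map_id:
  assumes "is_func P"
  shows "comma_map P P (func_id (fdom P)) (func_id (fcod P)) = func_id (comma P)"
    (is "?L = ?R")
proof (rule func_eqI)
  note [simp] = assms comma_ObD[of _ P] comma_ArD[of _ P] comma_Ob_cbase[of P]
  note s = square_id[OF assms]
  show "is_func ?L" by (rule is_func_comma_map[OF s])
  have ob: "comma_ob (func_id (fdom P)) (func_id (fcod P)) X = X" if "X \<in> Ob (comma P)" for X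
    using that cobj_collapse[OF that] by (simp add: comma_ob_def)
  then show "fob ?L X = fob ?R X"
    if "X \<in> Ob (fdom ?L)" for X
    using that by simp
  show "far ?L h = far ?R h"
    if "h \<in> Ar (fdom ?L)" for h
    using that carr_collapse[of h P] by (simp add: ob)
qed (use assms in simp_all)

lemma comma_map_comp:
  assumes s: "square P Q T S" and t: "square Q R T' S'"
  shows "comma_map P R (func_comp T' T) (func_comp S' S) = func_comp (comma_map Q R T' S') (comma_map P Q T S)"
    (is "?L = ?R")
proof (rule func_eqI)
  note [simp] = squareD[OF s] squareD[OF t] comma_ObD[of _ P] comma_ArD[of _ P] comma_Ob_cbase[of P]
    is_func_comma_map[OF s] is_func_comma_map[OF t] is_func_comma_map[OF square_comp[OF s t]]
  show "is_func ?L"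
    "is_func ?R" by simp_all
  have ob: "comma_ob (func_comp T' T) (func_comp S' S) X = comma_ob T' S' (comma_ob T S X)"
    if "X \<in> Ob (comma P)" for X
    using that by (simp add: comma_ob_def)
  then show "fob ?L X = fob ?R X"
    if "X \<in> Ob (fdom ?L)" for X
    using that comma_ob_in[OF s, of X] by simp
  show "far ?L h = far ?R h"
    if "h \<in> Ar (fdom ?L)" for h
    using that comma_map_in[OF s, of h] by (simp add: ob del: carr_in_comma)
qed simp_all

lemma square_nt_id:
  assumes s: "square P Q T S" shows "square_nt P Q (nt_id T) (nt_id S)"
  using s squareD[OF s] by (simp add: square_nt_def)

text \<open>Read off from the fact that \<open>CAT2\<close> is a 2-category, instead of recomputing
  components.\<close>

lemma square_nt_vcomp:
  assumes "square_nt P Q \<beta> \<alpha>" "square_nt P Q \<beta>' \<alpha>'" "ncod \<beta> = ndom \<beta>'" "ncod \<alpha> = ndom \<alpha>'"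
  shows "square_nt P Q (nt_vcomp \<beta>' \<beta>) (nt_vcomp \<alpha>' \<alpha>)"
proof -
  have "\<lparr>osrc = P, otgt = Q, und = (nt_vcomp \<beta>' \<beta>, nt_vcomp \<alpha>' \<alpha>)\<rparr> \<in> cell2 CAT2"
    using two_category_vcomp[OF two_category_CAT2, of "\<lparr>osrc = P, otgt = Q, und = (\<beta>, \<alpha>)\<rparr>" "\<lparr>osrc = P, otgt = Q, und = (\<beta>', \<alpha>')\<rparr>"]
      assms by (simp add: CAT2_cell2)
  then show ?thesis by (simp add: CAT2_cell2)
qed

lemma square_nt_hcomp:
  assumes "square_nt P Q \<beta> \<alpha>" "square_nt Q R \<beta>' \<alpha>'"
  shows "square_nt P R (nt_hcomp \<beta>' \<beta>) (nt_hcomp \<alpha>' \<alpha>)"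
proof -
  have "\<lparr>osrc = P, otgt = R, und = (nt_hcomp \<beta>' \<beta>, nt_hcomp \<alpha>' \<alpha>)\<rparr> \<in> cell2 CAT2"
    using two_category_hcomp[OF two_category_CAT2, of "\<lparr>osrc = P, otgt = Q, und = (\<beta>, \<alpha>)\<rparr>" "\<lparr>osrc = Q, otgt = R, und = (\<beta>', \<alpha>')\<rparr>"]
      assms by (simp add: CAT2_cell2)
  then show ?thesis by (simp add: CAT2_cell2)
qed

lemma comma_nt_id:
  assumes s: "square P Q T S"
  shows "comma_nt P Q (nt_id T) (nt_id S) = nt_id (comma_map P Q T S)"
    (is "?L = ?R")
proof (rule nt_eqI)
  note [simp] = squareD[OF s] comma_ObD[of _ P] comma_Ob_cbase[of P] is_func_comma_map[OF s]
  show "is_nt ?L"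
    using square_nt_comma_nt[OF square_nt_id[OF s]] by (rule square_ntD)
  fix X assume "X \<in> Ob (fdom (ndom ?L))"
  then show "ncmp ?L X = ncmp ?R X"
    using comma_ob_in[OF s, of X] by simp
qed (simp_all add: is_func_comma_map[OF s])

lemma comma_nt_vcomp:
  assumes n: "square_nt P Q \<beta> \<alpha>" and m: "square_nt P Q \<beta>' \<alpha>'" and e: "ncod \<beta> = ndom \<beta>'" "ncod \<alpha> = ndom \<alpha>'"
  shows "comma_nt P Q (nt_vcomp \<beta>' \<beta>) (nt_vcomp \<alpha>' \<alpha>) = nt_vcomp (comma_nt P Q \<beta>' \<alpha>') (comma_nt P Q \<beta> \<alpha>)"
    (is "?L = ?R")
proof (rule nt_eqI)
  note s = square_ntD(3)[OF n] and t = square_ntD(3)[OF m]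
  note [simp] = squareD[OF s] squareD[OF t] square_ntD(1,2,5)[OF n] square_ntD(1,2,5)[OF m] e
    square_ntD(1)[OF square_nt_comma_nt[OF n]] square_ntD(1)[OF square_nt_comma_nt[OF m]]
    comma_ObD[of _ P] comma_Ob_cbase[of P]
  show "is_nt ?L"
    using square_nt_comma_nt[OF square_nt_vcomp[OF n m e]] by (rule square_ntD)
  fix X assume "X \<in> Ob (fdom (ndom ?L))"
  then show "ncmp ?L X = ncmp ?R X"
    using comma_nt_in[OF n, of X] comma_nt_in[OF m, of X] by (simp del: carr_in_comma)
qed (simp_all add: square_ntD(1)[OF square_nt_comma_nt[OF n]] square_ntD(1)[OF square_nt_comma_nt[OF m]] e)

lemma comma_nt_hcomp:
  assumes n: "square_nt P Q \<beta> \<alpha>" and m: "square_nt Q R \<beta>' \<alpha>'"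
  shows "comma_nt P R (nt_hcomp \<beta>' \<beta>) (nt_hcomp \<alpha>' \<alpha>) = nt_hcomp (comma_nt Q R \<beta>' \<alpha>') (comma_nt P Q \<beta> \<alpha>)"
    (is "?L = ?R")
proof (rule nt_eqI)
  note s = square_ntD(3)[OF n] and t = square_ntD(3)[OF m]
  note s' = square_ntD(4)[OF n] and t' = square_ntD(4)[OF m]
  note [simp] = squareD[OF s] squareD[OF t] squareD[OF s'] squareD[OF t']
    square_ntD(1,2,5)[OF n] square_ntD(1,2,5)[OF m]
    square_ntD(1)[OF square_nt_comma_nt[OF n]] square_ntD(1)[OF square_nt_comma_nt[OF m]]
    comma_ObD[of _ P] comma_Ob_cbase[of P]
  show "is_nt ?L"
    using square_nt_comma_nt[OF square_nt_hcomp[OF n m]] by (rule square_ntD)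
  show "is_nt ?R" by simp
  show "ndom ?L = ndom ?R"
    "ncod ?L = ncod ?R"
    by (simp_all add: comma_map_comp[OF s t] comma_map_comp[OF s' t'])
  fix X assume "X \<in> Ob (fdom (ndom ?L))"
  then have X: "X \<in> Ob (comma P)" by simp
  have ob: "comma_ob (func_comp T' T) (func_comp S' S) X = comma_ob T' S' (comma_ob T S X)"
    if "square P Q T S" for T T' S S'
    using X squareD[OF that] by (simp add: comma_ob_def)
  show "ncmp ?L X = ncmp ?R X"
    using X comma_nt_in[OF n X] comma_ob_in[OF s' X] comma_nt_in[OF m comma_ob_in[OF s' X]] comma_map_in[OF t comma_nt_in[OF n X]]
    by (simp add: ob[OF s] ob[OF s'] del: carr_in_comma)
qed

lemma comma_fun_sel [simp]:
  "map0 comma_fun P = DomF P"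
  "map1 comma_fun h = \<lparr>osrc = DomF (osrc h), otgt = DomF (otgt h),
     und = (comma_map (osrc h) (otgt h) (fst (und h)) (snd (und h)), snd (und h))\<rparr>"
  "map2 comma_fun \<theta> = \<lparr>osrc = DomF (osrc \<theta>), otgt = DomF (otgt \<theta>),
     und = (comma_nt (osrc \<theta>) (otgt \<theta>) (fst (und \<theta>)) (snd (und \<theta>)), snd (und \<theta>))\<rparr>"
  by (simp_all add: comma_fun_def split_beta)

lemma two_functor_comma_fun: "two_functor CAT2 CAT2 comma_fun"
  unfolding two_functor_def
  by (auto simp: two_category_CAT2 CAT2_cell0 CAT2_cell1 CAT2_cell2 square_comma_map square_nt_comma_nt
     comma_map_id comma_map_comp comma_nt_id comma_nt_vcomp comma_nt_hcomp)

section \<open>The unit\<close>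

lemma comma_J_sel [simp]:
  "fdom (comma_J P) = fdom P" "fcod (comma_J P) = comma P"
  "x \<in> Ob (fdom P) \<Longrightarrow> fob (comma_J P) x = comma_J_ob P x"
  "f \<in> Ar (fdom P) \<Longrightarrow> far (comma_J P) f =
     carr (comma_J_ob P (Dom (fdom P) f)) (comma_J_ob P (Cod (fdom P) f)) (far P f) f"
  by (simp_all add: comma_J_def)

lemma comma_J_ob_sel [simp]:
  "cbase (comma_J_ob P x) = fob P x" "cmor (comma_J_ob P x) = Idn (fcod P) (fob P x)" "ctop (comma_J_ob P x) = x"
  by (simp_all add: comma_J_ob_def)

lemma comma_J_ob_in [simp]: "\<lbrakk>is_func P; x \<in> Ob (fdom P)\<rbrakk> \<Longrightarrow> comma_J_ob P x \<in> Ob (comma P)"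
  by (simp add: comma_J_ob_def)

lemma is_func_comma_J [simp]:
  assumes "is_func P" shows "is_func (comma_J P)"
  unfolding comma_J_def by (rule is_func_restrictI) (use assms in simp_all)

lemma square_comma_J: "is_func P \<Longrightarrow> square P (DomF P) (comma_J P) (func_id (fcod P))"
  by (simp add: square_def)

section \<open>The multiplication\<close>

lemma comma_DomF_ObD:
  assumes "Z \<in> Ob (comma (DomF P))"
  shows "ctop Z \<in> Ob (comma P)" "cmor Z \<in> Ar (fcod P)"
    "Dom (fcod P) (cmor Z) = cbase Z" "Cod (fcod P) (cmor Z) = cbase (ctop Z)"
  using comma_ObD[OF assms] by simp_all

lemma comma_DomF_ArD:
  assumes "k \<in> Ar (comma (DomF P))"
  shows "adom k \<in> Ob (comma (DomF P))" "acod k \<in> Ob (comma (DomF P))" "abase k \<in> Ar (fcod P)" "atop k \<in> Ar (comma P)"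
    "Dom (fcod P) (abase k) = cbase (adom k)" "Cod (fcod P) (abase k) = cbase (acod k)"
    "adom (atop k) = ctop (adom k)" "acod (atop k) = ctop (acod k)"
  using comma_ArD[OF assms] by simp_all

lemma comma_M_sel [simp]:
  "fdom (comma_M P) = comma (DomF P)" "fcod (comma_M P) = comma P"
  "Z \<in> Ob (comma (DomF P)) \<Longrightarrow> fob (comma_M P) Z = comma_M_ob P Z"
  "k \<in> Ar (comma (DomF P)) \<Longrightarrow> far (comma_M P) k =
     comma_M_arr P k"
  by (simp_all add: comma_M_def)

lemma comma_M_ob_sel [simp]:
  "cbase (comma_M_ob P Z) = cbase Z" "cmor (comma_M_ob P Z) = Cmp (fcod P) (cmor (ctop Z)) (cmor Z)"
  "ctop (comma_M_ob P Z) = ctop (ctop Z)"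
  by (simp_all add: comma_M_ob_def)

lemma comma_M_ob_in:
  assumes "is_func P" "Z \<in> Ob (comma (DomF P))" shows "comma_M_ob P Z \<in> Ob (comma P)"
  using assms comma_DomF_ObD[OF assms(2)] comma_ObD[of "ctop Z" P] by (simp add: comma_M_ob_def)

text \<open>The square of \<open>k\<close> itself is pasted with the square of its top component,
  which is again an arrow of a comma category.\<close>

lemma comma_M_in:
  assumes P: "is_func P" and k: "k \<in> Ar (comma (DomF P))"
  shows "comma_M_arr P k \<in> Ar (comma P)"
proof -
  let ?B = "fcod P"
  note [simp] = P comma_DomF_ArD[OF k] comma_DomF_ObD[of _ P] comma_ObD[of _ P] comma_ArD[of _ P] comma_M_ob_in[OF P]
  have "Cmp ?B (far P (atop (atop k))) (Cmp ?B (cmor (ctop (adom k))) (cmor (adom k)))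
      = Cmp ?B (Cmp ?B (far P (atop (atop k))) (cmor (adom (atop k)))) (cmor (adom k))"
    by (subst ls_assoc) simp_all
  also have "\<dots> = Cmp ?B (Cmp ?B (cmor (acod (atop k))) (abase (atop k))) (cmor (adom k))"
    using comma_Ar_square[of "atop k" P] by simp
  also have "\<dots> = Cmp ?B (cmor (acod (atop k))) (Cmp ?B (abase (atop k)) (cmor (adom k)))"
    by (rule ls_assoc) simp_all
  also have "\<dots> = Cmp ?B (cmor (ctop (acod k))) (Cmp ?B (cmor (acod k)) (abase k))"
    using comma_Ar_square[OF k] by simp
  also have "\<dots> = Cmp ?B (Cmp ?B (cmor (ctop (acod k))) (cmor (acod k))) (abase k)"
    by (rule ls_assoc[symmetric]) simp_all
  finally show ?thesis by simp
qed

lemma is_func_comma_M [simp]: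
  assumes P: "is_func P" shows "is_func (comma_M P)"
  unfolding comma_M_def
proof (rule is_func_restrictI)
  note [simp] = P comma_DomF_ArD[of _ P] comma_DomF_ObD[of _ P] comma_ObD[of _ P] comma_ArD[of _ P]
  show "ls_category (comma (DomF P))" "ls_category (comma P)" by simp_all
  fix Z assume Z: "Z \<in> Ob (comma (DomF P))"
  show "comma_M_ob P Z \<in> Ob (comma P)" by (rule comma_M_ob_in[OF P Z])
  then show "carr (comma_M_ob P (adom (Idn (comma (DomF P)) Z))) (comma_M_ob P (acod (Idn (comma (DomF P)) Z)))
        (abase (Idn (comma (DomF P)) Z)) (atop (atop (Idn (comma (DomF P)) Z))) = Idn (comma P) (comma_M_ob P Z)"
    using Z by simp
next
  note [simp] = P comma_DomF_ArD[of _ P]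
  fix k assume k: "k \<in> Ar (comma (DomF P))"
  show "comma_M_arr P k \<in> Ar (comma P) \<and>
     Dom (comma P) (comma_M_arr P k)
       = comma_M_ob P (Dom (comma (DomF P)) k) \<and>
     Cod (comma P) (comma_M_arr P k)
       = comma_M_ob P (Cod (comma (DomF P)) k)"
    using comma_M_in[OF P k] k by (simp del: carr_in_comma)
next
  note [simp] = P comma_DomF_ArD[of _ P]
  fix f g assume f: "f \<in> Ar (comma (DomF P))" and g: "g \<in> Ar (comma (DomF P))"
    and m: "Cod (comma (DomF P)) f = Dom (comma (DomF P)) g"
  have m': "acod f = adom g" using f g m by simp
  show "carr (comma_M_ob P (adom (Cmp (comma (DomF P)) g f))) (comma_M_ob P (acod (Cmp (comma (DomF P)) g f)))
         (abase (Cmp (comma (DomF P)) g f)) (atop (atop (Cmp (comma (DomF P)) g f)))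
      = Cmp (comma P) (comma_M_arr P g)
         (comma_M_arr P f)"
    using f g m' comma_M_in[OF P f] comma_M_in[OF P g] by (simp del: carr_in_comma)
qed

lemma square_comma_M:
  assumes P: "is_func P" shows "square (DomF (DomF P)) (DomF P) (comma_M P) (func_id (fcod P))"
  using P comma_M_ob_in[OF P] comma_M_in[OF P] comma_Ob_cbase[of "DomF P"] comma_DomF_ArD(3)[of _ P]
  by (simp add: square_def del: carr_in_comma)

lemma comma_unit_sel [simp]:
  "osrc (comma_unit P) = P" "otgt (comma_unit P) = DomF P" "und (comma_unit P) = (comma_J P, func_id (fcod P))"
  by (simp_all add: comma_unit_def)

lemma comma_mult_sel [simp]:
  "osrc (comma_mult P) = DomF (DomF P)" "otgt (comma_mult P) = DomF P" "und (comma_mult P) = (comma_M P, func_id (fcod P))"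
  by (simp_all add: comma_mult_def)

section \<open>Naturality of unit and multiplication, and the monad laws\<close>

lemma comma_J_natural:
  assumes s: "square P Q T S"
  shows "func_comp (comma_J Q) T = func_comp (comma_map P Q T S) (comma_J P)"
proof -
  note [simp] = squareD[OF s] is_func_comma_map[OF s]
  have ob: "comma_J_ob Q (fob T x) = comma_ob T S (comma_J_ob P x)" if "x \<in> Ob (fdom P)" for x
    using that by (simp add: comma_ob_def) (simp add: comma_J_ob_def)
  have "far (comma_J P) f \<in> Ar (comma P)" if "f \<in> Ar (fdom P)" for f
    using that by (intro is_func_rules) simp_all
  then show ?thesis
    by (simp add: func_comp_eq_iff ob del: carr_in_comma)
qed

lemma comma_M_natural:
  assumes s: "square P Q T S"
  shows "func_comp (comma_M Q) (comma_map (DomF P) (DomF Q) (comma_map P Q T S) S) = func_comp (comma_map P Q T S) (comma_M P)"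
proof -
  note s' = square_comma_map[OF s]
  note [simp] = squareD[OF s] is_func_comma_map[OF s] is_func_comma_map[OF s']
  have ob: "comma_M_ob Q (comma_ob (comma_map P Q T S) S Z) = comma_ob T S (comma_M_ob P Z)"
    if "Z \<in> Ob (comma (DomF P))" for Z
    using that comma_DomF_ObD[OF that] comma_ObD[of "ctop Z" P]
    by (simp add: comma_ob_def comma_M_ob_def)
  show ?thesis
    using comma_ob_in[OF s'] comma_map_in[OF s'] comma_M_in[of P] comma_M_ob_in[of P]
      comma_DomF_ArD[of _ P] comma_ArD[of _ "P"]
    by (simp add: func_comp_eq_iff ob del: carr_in_comma)
qed

lemma two_natural_comma_unit: "two_natural CAT2 CAT2 twofun_id comma_fun comma_unit"
  unfolding two_natural_def
proof (intro conjI ballI)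
  fix h :: "'a sq" assume "h \<in> cell1 CAT2"
  then have s: "square (osrc h) (otgt h) (fst (und h)) (snd (und h))" by (simp add: CAT2_cell1)
  then show "comp1 CAT2 (comma_unit (cod1 CAT2 h)) (map1 twofun_id h) = comp1 CAT2 (map1 comma_fun h) (comma_unit (dom1 CAT2 h))"
    using squareD[OF s] by (simp add: twofun_id_def comma_J_natural)
next
  fix \<theta> :: "'a sq2" assume "\<theta> \<in> cell2 CAT2"
  then have n: "square_nt (osrc \<theta>) (otgt \<theta>) (fst (und \<theta>)) (snd (und \<theta>))" by (simp add: CAT2_cell2)
  note s = square_ntD(3)[OF n] and t = square_ntD(4)[OF n]
  note [simp] = squareD[OF s] squareD[OF t] square_ntD(1,2,5)[OF n] square_ntD(1)[OF square_nt_comma_nt[OF n]]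
  have ob: "comma_J_ob (otgt \<theta>) (fob T x) = comma_ob T S (comma_J_ob (osrc \<theta>) x)"
    if "square (osrc \<theta>) (otgt \<theta>) T S" "x \<in> Ob (fdom (osrc \<theta>))" for T S x
    using that squareD[OF that(1)] by (simp add: comma_ob_def) (simp add: comma_J_ob_def)
  have "nt_hcomp (nt_id (comma_J (otgt \<theta>))) (fst (und \<theta>))
      = nt_hcomp (comma_nt (osrc \<theta>) (otgt \<theta>) (fst (und \<theta>)) (snd (und \<theta>))) (nt_id (comma_J (osrc \<theta>)))"
    by (subst whisker_eq_iff) (simp_all add: comma_J_natural[OF s] comma_J_natural[OF t] ob[OF s] ob[OF t])
  moreover have "nt_hcomp (nt_id (func_id (fcod (otgt \<theta>)))) (snd (und \<theta>)) = nt_hcomp (snd (und \<theta>)) (nt_id (func_id (fcod (osrc \<theta>))))"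
    by (subst whisker_eq_iff) simp_all
  ultimately show "hcomp CAT2 (id2 CAT2 (comma_unit (cod1 CAT2 (dom2 CAT2 \<theta>)))) (map2 twofun_id \<theta>)
      = hcomp CAT2 (map2 comma_fun \<theta>) (id2 CAT2 (comma_unit (dom1 CAT2 (dom2 CAT2 \<theta>))))"
    by (simp add: twofun_id_def)
qed (use two_functor_id[OF two_category_CAT2] in \<open>simp_all add: two_functor_comma_fun CAT2_cell0 CAT2_cell1 square_comma_J twofun_id_def\<close>)

lemma two_natural_comma_mult: "two_natural CAT2 CAT2 (twofun_comp comma_fun comma_fun) comma_fun comma_mult"
  unfolding two_natural_def
proof (intro conjI ballI)
  fix h :: "'a sq" assume "h \<in> cell1 CAT2"
  then have s: "square (osrc h) (otgt h) (fst (und h)) (snd (und h))" by (simp add: CAT2_cell1)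
  then show "comp1 CAT2 (comma_mult (cod1 CAT2 h)) (map1 (twofun_comp comma_fun comma_fun) h)
      = comp1 CAT2 (map1 comma_fun h) (comma_mult (dom1 CAT2 h))"
    using squareD[OF s] by (simp add: twofun_comp_def comma_M_natural)
next
  fix \<theta> :: "'a sq2" assume "\<theta> \<in> cell2 CAT2"
  then have n: "square_nt (osrc \<theta>) (otgt \<theta>) (fst (und \<theta>)) (snd (und \<theta>))" by (simp add: CAT2_cell2)
  let ?P = "osrc \<theta>" and ?Q = "otgt \<theta>" and ?\<beta> = "fst (und \<theta>)" and ?\<alpha> = "snd (und \<theta>)"
  note s = square_ntD(3)[OF n] and t = square_ntD(4)[OF n] and n' = square_nt_comma_nt[OF n]
  note [simp] = squareD[OF s] squareD[OF t] square_ntD(1,2,5)[OF n] square_ntD(1)[OF n'] square_ntD(1)[OF square_nt_comma_nt[OF n']]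
  have ob: "comma_M_ob ?Q (comma_ob (comma_map ?P ?Q T S) S Z) = comma_ob T S (comma_M_ob ?P Z)"
    if "square ?P ?Q T S" "Z \<in> Ob (comma (DomF ?P))" for T S Z
    using that squareD[OF that(1)] comma_DomF_ObD[OF that(2)] comma_ObD[of "ctop Z" ?P]
    by (simp add: comma_ob_def comma_M_ob_def)
  have "nt_hcomp (nt_id (comma_M ?Q)) (comma_nt (DomF ?P) (DomF ?Q) (comma_nt ?P ?Q ?\<beta> ?\<alpha>) ?\<alpha>)
      = nt_hcomp (comma_nt ?P ?Q ?\<beta> ?\<alpha>) (nt_id (comma_M ?P))"
  proof (subst whisker_eq_iff)
    show "\<forall>x\<in>Ob (fdom (comma_M ?P)). far (comma_M ?Q) (ncmp (comma_nt (DomF ?P) (DomF ?Q) (comma_nt ?P ?Q ?\<beta> ?\<alpha>) ?\<alpha>) x)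
        = ncmp (comma_nt ?P ?Q ?\<beta> ?\<alpha>) (fob (comma_M ?P) x)"
      using comma_nt_in[OF n'] comma_M_ob_in[of ?P]
      by (simp add: ob[OF s] ob[OF t] comma_DomF_ObD del: carr_in_comma)
  qed (simp_all add: comma_M_natural[OF s] comma_M_natural[OF t])
  moreover have "nt_hcomp (nt_id (func_id (fcod (otgt \<theta>)))) (snd (und \<theta>)) = nt_hcomp (snd (und \<theta>)) (nt_id (func_id (fcod (osrc \<theta>))))"
    by (subst whisker_eq_iff) simp_all
  ultimately show "hcomp CAT2 (id2 CAT2 (comma_mult (cod1 CAT2 (dom2 CAT2 \<theta>)))) (map2 (twofun_comp comma_fun comma_fun) \<theta>)
      = hcomp CAT2 (map2 comma_fun \<theta>) (id2 CAT2 (comma_mult (dom1 CAT2 (dom2 CAT2 \<theta>))))"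
    by (simp add: twofun_comp_def)
qed (use two_functor_comp[OF two_functor_comma_fun two_functor_comma_fun] in
    \<open>simp_all add: two_functor_comma_fun CAT2_cell0 CAT2_cell1 square_comma_M twofun_comp_def\<close>)

text \<open>The unit of the comma object sends (b, u, x) to (b, 1, (b, u, x)), and u 1 = u.\<close>

lemma comma_M_J:
  assumes P: "is_func P"
  shows "func_comp (comma_M P) (comma_J (DomF P)) = func_id (comma P)"
    (is "?L = ?R")
proof (rule func_eqI)
  note [simp] = P comma_ObD[of _ P] comma_ArD[of _ P] comma_Ob_cbase[of P]
  have ob: "comma_M_ob P (comma_J_ob (DomF P) X) = X" if "X \<in> Ob (comma P)" for X
    using that cobj_collapse[OF that] by (simp add: comma_M_ob_def)
  fix h assume "h \<in> Ar (fdom ?L)"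
  then have h: "h \<in> Ar (comma P)" by simp
  have "far (comma_J (DomF P)) h \<in> Ar (comma (DomF P))" using h by (intro is_func_rules) simp_all
  then show "far ?L h = far ?R h"
    using h carr_collapse[OF h] by (simp add: ob del: carr_in_comma)
next
  note [simp] = P comma_ObD[of _ P] comma_Ob_cbase[of P]
  fix X assume "X \<in> Ob (fdom ?L)"
  then show "fob ?L X = fob ?R X"
    using cobj_collapse[of X P] by (simp add: comma_M_ob_def)
qed (use P in simp_all)

text \<open>Applying the 2-functor to the unit sends (b, u, x) to (b, u, J x), whose inner arrow is
  an identity, and 1 u = u.\<close>

lemma comma_M_map_J:
  assumes P: "is_func P"
  shows "func_comp (comma_M P) (comma_map P (DomF P) (comma_J P) (func_id (fcod P))) = func_id (comma P)"
    (is "?L = ?R")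
proof (rule func_eqI)
  note s = square_comma_J[OF P]
  note [simp] = P comma_ObD[of _ P] comma_ArD[of _ P] comma_Ob_cbase[of P] is_func_comma_map[OF s]
  have ob: "comma_M_ob P (comma_ob (comma_J P) (func_id (fcod P)) X) = X" if "X \<in> Ob (comma P)" for X
    using that cobj_collapse[OF that] by (simp add: comma_M_ob_def)
  show "is_func ?L" by simp
  fix X assume "X \<in> Ob (fdom ?L)"
  then show "fob ?L X = fob ?R X"
    using comma_ob_in[OF s, of X] by (simp add: ob)
next
  note s = square_comma_J[OF P]
  note [simp] = P comma_ObD[of _ P] comma_ArD[of _ P] comma_Ob_cbase[of P]
  have ob: "comma_M_ob P (comma_ob (comma_J P) (func_id (fcod P)) X) = X" if "X \<in> Ob (comma P)" for X
    using that cobj_collapse[OF that] by (simp add: comma_M_ob_def)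
  fix h assume "h \<in> Ar (fdom ?L)"
  then have h: "h \<in> Ar (comma P)" by simp
  then show "far ?L h = far ?R h"
    using carr_collapse[OF h] comma_map_in[OF s h] by (simp add: ob del: carr_in_comma)
qed (use P in simp_all)

text \<open>On objects this is associativity of composition in the base; on arrows both sides keep
  the outermost base component and the innermost top component.\<close>

lemma comma_M_M:
  assumes P: "is_func P"
  shows "func_comp (comma_M P) (comma_M (DomF P)) = func_comp (comma_M P) (comma_map (DomF (DomF P)) (DomF P) (comma_M P) (func_id (fcod P)))"
proof -
  note s = square_comma_M[OF P]
  note D = comma_DomF_ObD[of _ "DomF P", simplified] comma_DomF_ArD[of _ "DomF P", simplified]
  note [simp] = P comma_ObD[of _ P] comma_ArD[of _ P] comma_Ob_cbase[of P] is_func_comma_map[OF s]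
    comma_DomF_ObD[of _ P] comma_DomF_ArD[of _ P]
  have ob: "comma_M_ob P (comma_M_ob (DomF P) Z) = comma_M_ob P (comma_ob (comma_M P) (func_id (fcod P)) Z)"
    if "Z \<in> Ob (comma (DomF (DomF P)))" for Z
    using that comma_Ob_cbase[of "DomF (DomF P)" Z] by (simp add: comma_M_ob_def comma_ob_def D ls_assoc)
  show ?thesis
    using comma_ob_in[OF s] comma_map_in[OF s] comma_M_in[of "DomF P"] comma_M_ob_in[of "DomF P"]
    by (simp add: func_comp_eq_iff ob D del: carr_in_comma)
qed

lemma two_monad_comma: "two_monad CAT2 comma_monad"
  unfolding two_monad_def comma_monad_def
  by (auto simp: two_natural_comma_unit two_natural_comma_mult CAT2_cell0 comma_M_J comma_M_map_J comma_M_M)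

section \<open>Split fibrations\<close>

lemma cartesian_lift:
  assumes "cartesian P e" "g \<in> Ar (fdom P)" "v \<in> Ar (fcod P)" "Cod (fdom P) g = Cod (fdom P) e"
    "Dom (fcod P) v = fob P (Dom (fdom P) g)" "Cod (fcod P) v = fob P (Dom (fdom P) e)"
    "far P g = Cmp (fcod P) (far P e) v"
  shows "\<exists>!h. h \<in> hom (fdom P) (Dom (fdom P) g) (Dom (fdom P) e) \<and> Cmp (fdom P) e h = g \<and> far P h = v"
  using assms unfolding cartesian_def Let_def by blast

text \<open>The uniqueness half of cartesianness, applied to the arrow \<open>e h\<close> over its
  own base component. Every definite description below is resolved by it.\<close>

lemma cartesian_cancel:
  assumes P: "is_func P" and e: "cartesian P e"
    and hk: "h \<in> Ar (fdom P)" "k \<in> Ar (fdom P)" "Dom (fdom P) h = Dom (fdom P) k"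
      "Cod (fdom P) h = Dom (fdom P) e" "Cod (fdom P) k = Dom (fdom P) e"
    and eq: "Cmp (fdom P) e h = Cmp (fdom P) e k" "far P h = far P k"
  shows "h = k"
proof -
  have e': "e \<in> Ar (fdom P)" using e by (simp add: cartesian_def Let_def)
  have "\<exists>!h'. h' \<in> hom (fdom P) (Dom (fdom P) (Cmp (fdom P) e h)) (Dom (fdom P) e) \<and>
      Cmp (fdom P) e h' = Cmp (fdom P) e h \<and> far P h' = far P h"
    by (rule cartesian_lift[OF e]) (use P e' hk in simp_all)
  moreover have "Dom (fdom P) (Cmp (fdom P) e h) = Dom (fdom P) h"
    using P e' hk by simp
  ultimately show ?thesis
    using hk eq by (auto simp: hom_def)
qed

lemma cleavageD:
  assumes P: "is_func P" and c: "cleavage P \<delta>" and xu: "x \<in> Ob (fdom P)" "u \<in> Ar (fcod P)" "Cod (fcod P) u = fob P x"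
  shows "cartesian P (\<delta> (x, u))" "\<delta> (x, u) \<in> Ar (fdom P)" "Cod (fdom P) (\<delta> (x, u)) = x" "far P (\<delta> (x, u)) = u"
    "fob P (Dom (fdom P) (\<delta> (x, u))) = Dom (fcod P) u"
proof -
  show 1: "cartesian P (\<delta> (x, u))" "Cod (fdom P) (\<delta> (x, u)) = x" "far P (\<delta> (x, u)) = u"
    using c xu by (auto simp: cleavage_def liftable_def)
  then show 2: "\<delta> (x, u) \<in> Ar (fdom P)" by (simp add: cartesian_def Let_def)
  show "fob P (Dom (fdom P) (\<delta> (x, u))) = Dom (fcod P) u"
    using Dom_far[OF P 2] 1(3) by simp
qed

lemma split_cleavageD:
  assumes "split_cleavage P \<delta>"
  shows "cleavage P \<delta>"
    and "x \<in> Ob (fdom P) \<Longrightarrow> \<delta> (x, Idn (fcod P) (fob P x)) = Idn (fdom P) x"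
    and "\<lbrakk>x \<in> Ob (fdom P); u \<in> Ar (fcod P); Cod (fcod P) u = fob P x; v \<in> Ar (fcod P); Cod (fcod P) v = Dom (fcod P) u\<rbrakk> \<Longrightarrow>
        \<delta> (x, Cmp (fcod P) u v) = Cmp (fdom P) (\<delta> (x, u)) (\<delta> (Dom (fdom P) (\<delta> (x, u)), v))"
  using assms unfolding split_cleavage_def Let_def liftable_def by auto

section \<open>Fibres and reindexing functors\<close>

lemma fibre_sel [simp]:
  "Ob (fibre P b) = {x \<in> Ob (fdom P). fob P x = b}"
  "Ar (fibre P b) = {f \<in> Ar (fdom P). far P f = Idn (fcod P) b}"
  by (simp_all add: fibre_def Let_def)

lemma fibre_hom:
  "f \<in> hom (fibre P b) x y \<longleftrightarrow> f \<in> Ar (fdom P) \<and> far P f = Idn (fcod P) b \<and> Dom (fdom P) f = x \<and> Cod (fdom P) f = y"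
  by (auto simp: hom_def fibre_def Let_def)

lemma fibre_Ar_ends:
  assumes "is_func P" "f \<in> Ar (fdom P)" "far P f = Idn (fcod P) b" "b \<in> Ob (fcod P)"
  shows "fob P (Dom (fdom P) f) = b" "fob P (Cod (fdom P) f) = b"
  using Dom_far[OF assms(1,2)] Cod_far[OF assms(1,2)] assms by simp_all

lemma reindex_sel [simp]:
  "fdom (reindex P \<delta> u) = fibre P (Cod (fcod P) u)" "fcod (reindex P \<delta> u) = fibre P (Dom (fcod P) u)"
  "\<lbrakk>x \<in> Ob (fdom P); fob P x = Cod (fcod P) u\<rbrakk> \<Longrightarrow> fob (reindex P \<delta> u) x = Dom (fdom P) (\<delta> (x, u))"
  by (simp_all add: reindex_def Let_def)

text \<open>Reindexing functors are compared as records without establishing \<open>is_func\<close>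
  for them; extensionality of the two maps is what this requires.\<close>

lemma reindex_ext:
  "fob (reindex P \<delta> u) \<in> extensional (Ob (fibre P (Cod (fcod P) u)))"
  "far (reindex P \<delta> u) \<in> extensional (Ar (fibre P (Cod (fcod P) u)))"
  by (auto simp: reindex_def Let_def)

text \<open>Any vertical arrow that completes the square of lifts is the chosen one, since the lift
  at the codomain is cartesian and can be cancelled.\<close>

lemma reindex_far_eqI:
  assumes P: "is_func P" and c: "cleavage P \<delta>" and u: "u \<in> Ar (fcod P)"
    and f: "f \<in> Ar (fdom P)" "far P f = Idn (fcod P) (Cod (fcod P) u)"
    and k: "k \<in> Ar (fdom P)" "far P k = Idn (fcod P) (Dom (fcod P) u)"
      "Dom (fdom P) k = Dom (fdom P) (\<delta> (Dom (fdom P) f, u))" "Cod (fdom P) k = Dom (fdom P) (\<delta> (Cod (fdom P) f, u))"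
      "Cmp (fdom P) (\<delta> (Cod (fdom P) f, u)) k = Cmp (fdom P) f (\<delta> (Dom (fdom P) f, u))"
  shows "far (reindex P \<delta> u) f = k"
proof -
  let ?E = "fdom P"
  have b: "Cod (fcod P) u \<in> Ob (fcod P)" using P u by simp
  note ends = fibre_Ar_ends[OF P f b]
  note lift = cleavageD[OF P c _ u]
  have "(THE h. h \<in> hom (fibre P (Dom (fcod P) u)) (Dom ?E (\<delta> (Dom ?E f, u))) (Dom ?E (\<delta> (Cod ?E f, u))) \<and>
      Cmp ?E (\<delta> (Cod ?E f, u)) h = Cmp ?E f (\<delta> (Dom ?E f, u))) = k"
  proof (rule the_equality)
    show "k \<in> hom (fibre P (Dom (fcod P) u)) (Dom ?E (\<delta> (Dom ?E f, u))) (Dom ?E (\<delta> (Cod ?E f, u))) \<and>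
      Cmp ?E (\<delta> (Cod ?E f, u)) k = Cmp ?E f (\<delta> (Dom ?E f, u))"
      using k by (simp add: fibre_hom)
    fix h assume "h \<in> hom (fibre P (Dom (fcod P) u)) (Dom ?E (\<delta> (Dom ?E f, u))) (Dom ?E (\<delta> (Cod ?E f, u))) \<and>
      Cmp ?E (\<delta> (Cod ?E f, u)) h = Cmp ?E f (\<delta> (Dom ?E f, u))"
    then have h: "h \<in> Ar ?E" "far P h = Idn (fcod P) (Dom (fcod P) u)" "Dom ?E h = Dom ?E (\<delta> (Dom ?E f, u))"
      "Cod ?E h = Dom ?E (\<delta> (Cod ?E f, u))" "Cmp ?E (\<delta> (Cod ?E f, u)) h = Cmp ?E f (\<delta> (Dom ?E f, u))"
      unfolding fibre_hom by blast+
    have "Cod ?E f \<in> Ob ?E" using P f(1) by simp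
    then have "cartesian P (\<delta> (Cod ?E f, u))" by (rule lift(1)) (rule ends(2)[symmetric])
    from cartesian_cancel[OF P this h(1) k(1) _ h(4) k(4)] show "h = k"
      unfolding h(2,3,5) k(2,3,5) by blast
  qed
  then show ?thesis using f by (simp add: reindex_def Let_def)
qed

text \<open>Existence for the description: \<open>f\<close> after the lift at its domain lies over
  u, and it factors through the lift at its codomain over an identity.\<close>

lemma reindex_far:
  assumes P: "is_func P" and c: "cleavage P \<delta>" and u: "u \<in> Ar (fcod P)"
    and f: "f \<in> Ar (fdom P)" "far P f = Idn (fcod P) (Cod (fcod P) u)"
  shows "far (reindex P \<delta> u) f \<in> Ar (fdom P)" (is ?c1)
    "far P (far (reindex P \<delta> u) f) = Idn (fcod P) (Dom (fcod P) u)" (is ?c2)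
    "Dom (fdom P) (far (reindex P \<delta> u) f) = Dom (fdom P) (\<delta> (Dom (fdom P) f, u))" (is ?c3)
    "Cod (fdom P) (far (reindex P \<delta> u) f) = Dom (fdom P) (\<delta> (Cod (fdom P) f, u))" (is ?c4)
    "Cmp (fdom P) (\<delta> (Cod (fdom P) f, u)) (far (reindex P \<delta> u) f) = Cmp (fdom P) f (\<delta> (Dom (fdom P) f, u))" (is ?c5)
proof -
  let ?E = "fdom P" and ?B = "fcod P"
  have b: "Cod ?B u \<in> Ob ?B" using P u by simp
  note ends = fibre_Ar_ends[OF P f b]
  note lift = cleavageD[OF P c _ u]
  have "\<exists>!h. h \<in> hom ?E (Dom ?E (Cmp ?E f (\<delta> (Dom ?E f, u)))) (Dom ?E (\<delta> (Cod ?E f, u))) \<and>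
      Cmp ?E (\<delta> (Cod ?E f, u)) h = Cmp ?E f (\<delta> (Dom ?E f, u)) \<and> far P h = Idn ?B (Dom ?B u)"
    by (rule cartesian_lift) (use P f u ends in \<open>simp_all add: lift\<close>)
  then obtain k where k: "k \<in> Ar ?E" "far P k = Idn ?B (Dom ?B u)"
    "Dom ?E k = Dom ?E (\<delta> (Dom ?E f, u))" "Cod ?E k = Dom ?E (\<delta> (Cod ?E f, u))"
    "Cmp ?E (\<delta> (Cod ?E f, u)) k = Cmp ?E f (\<delta> (Dom ?E f, u))"
    using P f ends by (auto simp: hom_def lift)
  show ?c1 ?c2 ?c3 ?c4 ?c5
    unfolding reindex_far_eqI[OF P c u f k] by (rule k)+
qed

text \<open>The value of a reindexing functor on an arrow is determined by a square of lifts, so the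
  equations between reindexing functors are obtained from those between lifts.\<close>

lemma split_cleavageI:
  assumes P: "is_func P" and c: "cleavage P \<delta>"
    and i: "\<And>x. x \<in> Ob (fdom P) \<Longrightarrow> \<delta> (x, Idn (fcod P) (fob P x)) = Idn (fdom P) x"
    and m: "\<And>x u v. \<lbrakk>x \<in> Ob (fdom P); u \<in> Ar (fcod P); Cod (fcod P) u = fob P x; v \<in> Ar (fcod P); Cod (fcod P) v = Dom (fcod P) u\<rbrakk> \<Longrightarrow>
        \<delta> (x, Cmp (fcod P) u v) = Cmp (fdom P) (\<delta> (x, u)) (\<delta> (Dom (fdom P) (\<delta> (x, u)), v))"
  shows "split_cleavage P \<delta>"
proof -
  let ?E = "fdom P" and ?B = "fcod P"
  have id: "reindex P \<delta> (Idn ?B a) = func_id (fibre P a)" if a: "a \<in> Ob ?B" for a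
  proof -
    have "fob (reindex P \<delta> (Idn ?B a)) = fob (func_id (fibre P a))"
    proof (rule extensionalityI)
      show "fob (reindex P \<delta> (Idn ?B a)) \<in> extensional (Ob (fibre P a))"
        using reindex_ext(1)[of P \<delta> "Idn ?B a"] P a by simp
      fix x assume x: "x \<in> Ob (fibre P a)"
      then show "fob (reindex P \<delta> (Idn ?B a)) x = fob (func_id (fibre P a)) x"
        using P a i[of x] by auto
    qed (simp add: func_id_def)
    moreover have "far (reindex P \<delta> (Idn ?B a)) = far (func_id (fibre P a))"
    proof (rule extensionalityI)
      show "far (reindex P \<delta> (Idn ?B a)) \<in> extensional (Ar (fibre P a))"
        using reindex_ext(2)[of P \<delta> "Idn ?B a"] P a by simp
      fix f assume f: "f \<in> Ar (fibre P a)"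
      then have f': "f \<in> Ar ?E" "far P f = Idn ?B a" by simp_all
      \<comment> \<open>Lifts of an identity are identities, so \<open>f\<close> completes the
        square that characterizes its own reindexing.\<close>
      have d: "\<delta> (Dom ?E f, Idn ?B a) = Idn ?E (Dom ?E f)" "\<delta> (Cod ?E f, Idn ?B a) = Idn ?E (Cod ?E f)"
        using i[of "Dom ?E f"] i[of "Cod ?E f"] P f' fibre_Ar_ends[OF P f' a] by simp_all
      have "far (reindex P \<delta> (Idn ?B a)) f = f"
        by (rule reindex_far_eqI[OF P c]) (use P a f' in \<open>simp_all add: d\<close>)
      then show "far (reindex P \<delta> (Idn ?B a)) f = far (func_id (fibre P a)) f"
        using f by simp
    qed (simp add: func_id_def)
    ultimately show ?thesis using P a by simp
  qed
  have comp: "reindex P \<delta> (Cmp ?B u v) = func_comp (reindex P \<delta> v) (reindex P \<delta> u)"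
    if u: "u \<in> Ar ?B" and v: "v \<in> Ar ?B" and uv: "Cod ?B v = Dom ?B u" for u v
  proof -
    have uv': "Cmp ?B u v \<in> Ar ?B" "Dom ?B (Cmp ?B u v) = Dom ?B v" "Cod ?B (Cmp ?B u v) = Cod ?B u"
      using P u v uv by simp_all
    have obs: "fob P (Dom ?E (\<delta> (x, u))) = Dom ?B u" "\<delta> (x, u) \<in> Ar ?E" "Dom ?E (\<delta> (x, u)) \<in> Ob ?E"
      "\<delta> (Dom ?E (\<delta> (x, u)), v) \<in> Ar ?E" "Cod ?E (\<delta> (Dom ?E (\<delta> (x, u)), v)) = Dom ?E (\<delta> (x, u))"
      "Cod ?E (\<delta> (x, u)) = x"
      "\<delta> (x, Cmp ?B u v) = Cmp ?E (\<delta> (x, u)) (\<delta> (Dom ?E (\<delta> (x, u)), v))"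
      if x: "x \<in> Ob ?E" "fob P x = Cod ?B u" for x
    proof -
      note l = cleavageD[OF P c x(1) u x(2)[symmetric]]
      show 1: "fob P (Dom ?E (\<delta> (x, u))) = Dom ?B u" "\<delta> (x, u) \<in> Ar ?E" "Dom ?E (\<delta> (x, u)) \<in> Ob ?E"
        "Cod ?E (\<delta> (x, u)) = x"
        using P l by simp_all
      show "\<delta> (Dom ?E (\<delta> (x, u)), v) \<in> Ar ?E" "Cod ?E (\<delta> (Dom ?E (\<delta> (x, u)), v)) = Dom ?E (\<delta> (x, u))"
        using cleavageD[OF P c 1(3) v] uv 1(1) by simp_all
      show "\<delta> (x, Cmp ?B u v) = Cmp ?E (\<delta> (x, u)) (\<delta> (Dom ?E (\<delta> (x, u)), v))"
        using m[OF x(1) u x(2)[symmetric] v uv] .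
    qed
    have "fob (reindex P \<delta> (Cmp ?B u v)) = fob (func_comp (reindex P \<delta> v) (reindex P \<delta> u))"
    proof (rule extensionalityI)
      show "fob (reindex P \<delta> (Cmp ?B u v)) \<in> extensional (Ob (fibre P (Cod ?B u)))"
        using reindex_ext(1)[of P \<delta> "Cmp ?B u v"] uv' by simp
      show "fob (func_comp (reindex P \<delta> v) (reindex P \<delta> u)) \<in> extensional (Ob (fibre P (Cod ?B u)))"
        by (auto simp: func_comp_def)
      fix x assume "x \<in> Ob (fibre P (Cod ?B u))"
      then have x: "x \<in> Ob ?E" "fob P x = Cod ?B u" by simp_all
      show "fob (reindex P \<delta> (Cmp ?B u v)) x = fob (func_comp (reindex P \<delta> v) (reindex P \<delta> u)) x"
        using x obs[OF x] uv uv' P by simp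
    qed
    moreover have "far (reindex P \<delta> (Cmp ?B u v)) = far (func_comp (reindex P \<delta> v) (reindex P \<delta> u))"
    proof (rule extensionalityI)
      show "far (reindex P \<delta> (Cmp ?B u v)) \<in> extensional (Ar (fibre P (Cod ?B u)))"
        using reindex_ext(2)[of P \<delta> "Cmp ?B u v"] uv' by simp
      show "far (func_comp (reindex P \<delta> v) (reindex P \<delta> u)) \<in> extensional (Ar (fibre P (Cod ?B u)))"
        by (auto simp: func_comp_def)
      fix f assume "f \<in> Ar (fibre P (Cod ?B u))"
      then have f: "f \<in> Ar ?E" "far P f = Idn ?B (Cod ?B u)" by simp_all
      let ?x = "Dom ?E f" and ?y = "Cod ?E f"
      have b: "Cod ?B u \<in> Ob ?B" using P u by simp
      note ends = fibre_Ar_ends[OF P f b]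
      have xy: "?x \<in> Ob ?E" "?y \<in> Ob ?E" using P f by simp_all
      note X = obs[OF xy(1) ends(1)] and Y = obs[OF xy(2) ends(2)]
      define r where "r = far (reindex P \<delta> u) f"
      note r = reindex_far[OF P c u f, folded r_def]
      have r2: "far P r = Idn ?B (Cod ?B v)" using r(2) uv by simp
      define q where "q = far (reindex P \<delta> v) r"
      note q = reindex_far[OF P c v r(1) r2, folded q_def, unfolded r(3,4)]
      let ?dy = "\<delta> (Dom ?E (\<delta> (?y, u)), v)" and ?dx = "\<delta> (Dom ?E (\<delta> (?x, u)), v)"
      \<comment> \<open>The arrow \<open>q\<close> is obtained from \<open>f\<close> by reindexing
        along u and then along v. Pasting the two squares gives the square of composite lifts, which
        are the lifts of \<open>u v\<close>.\<close>
      have "Cmp ?E (Cmp ?E (\<delta> (?y, u)) ?dy) q = Cmp ?E (\<delta> (?y, u)) (Cmp ?E ?dy q)"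
        by (rule ls_assoc) (use P Y q in simp_all)
      also have "\<dots> = Cmp ?E (\<delta> (?y, u)) (Cmp ?E r ?dx)" by (simp add: q(5))
      also have "\<dots> = Cmp ?E (Cmp ?E (\<delta> (?y, u)) r) ?dx"
        by (rule ls_assoc[symmetric]) (use P X Y r in simp_all)
      also have "\<dots> = Cmp ?E (Cmp ?E f (\<delta> (?x, u))) ?dx" by (simp add: r(5))
      also have "\<dots> = Cmp ?E f (Cmp ?E (\<delta> (?x, u)) ?dx)"
        by (rule ls_assoc) (use P X f in simp_all)
      finally have eq: "Cmp ?E (Cmp ?E (\<delta> (?y, u)) ?dy) q = Cmp ?E f (Cmp ?E (\<delta> (?x, u)) ?dx)" .
      have "far (reindex P \<delta> (Cmp ?B u v)) f = q"
        by (rule reindex_far_eqI[OF P c uv'(1)]) (use P f q X Y eq uv' in simp_all)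
      then show "far (reindex P \<delta> (Cmp ?B u v)) f = far (func_comp (reindex P \<delta> v) (reindex P \<delta> u)) f"
        using f by (simp add: q_def r_def)
    qed
    ultimately show ?thesis using uv' by (intro func.equality) simp_all
  qed
  show ?thesis
    unfolding split_cleavage_def Let_def using c id comp i m by (auto simp: liftable_def)
qed

subsection \<open>From split cleavages to actions\<close>

text \<open>The chosen lift indexed by the comma object (b, u, x) instead of the pair (x, u), so
  that the action can be computed without taking codes apart.\<close>

definition lift :: "'u::universe splitfib \<Rightarrow> 'u \<Rightarrow> 'u" where
  "lift Z X = snd Z (ctop X, cmor X)"

lemma liftD:
  assumes P: "is_func P" and c: "cleavage P \<delta>" and X: "X \<in> Ob (comma P)"
  shows "cartesian P (lift (P, \<delta>) X)" "lift (P, \<delta>) X \<in> Ar (fdom P)" "Cod (fdom P) (lift (P, \<delta>) X) = ctop X"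
    "far P (lift (P, \<delta>) X) = cmor X" "fob P (Dom (fdom P) (lift (P, \<delta>) X)) = cbase X"
  using cleavageD[OF P c comma_ObD(1,2,4)[OF X]] comma_ObD(3)[OF X] by (simp_all add: lift_def)

lemma action_top_sel [simp]:
  "fdom (action_top (P, \<delta>)) = comma P" "fcod (action_top (P, \<delta>)) = fdom P"
  "X \<in> Ob (comma P) \<Longrightarrow> fob (action_top (P, \<delta>)) X = Dom (fdom P) (lift (P, \<delta>) X)"
  by (simp_all add: action_top_def lift_def Let_def)

text \<open>The working form of the action on arrows: cancelling the cartesian lift at the codomain
  of \<open>h\<close> leaves no choice for \<open>k\<close>. Functoriality, both algebra laws and
  both comparisons of morphisms are proved by exhibiting a suitable \<open>k\<close>.\<close>

lemma action_top_far_eqI: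
  assumes P: "is_func P" and c: "cleavage P \<delta>" and h: "h \<in> Ar (comma P)"
    and k: "k \<in> Ar (fdom P)" "Dom (fdom P) k = Dom (fdom P) (lift (P, \<delta>) (adom h))"
      "Cod (fdom P) k = Dom (fdom P) (lift (P, \<delta>) (acod h))" "far P k = abase h"
      "Cmp (fdom P) (lift (P, \<delta>) (acod h)) k = Cmp (fdom P) (atop h) (lift (P, \<delta>) (adom h))"
  shows "far (action_top (P, \<delta>)) h = k"
proof -
  let ?E = "fdom P" and ?l = "lift (P, \<delta>)"
  have "(THE k. k \<in> hom ?E (Dom ?E (?l (adom h))) (Dom ?E (?l (acod h))) \<and> far P k = abase h \<and>
               Cmp ?E (?l (acod h)) k = Cmp ?E (atop h) (?l (adom h))) = k"
  proof (rule the_equality)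
    show "k \<in> hom ?E (Dom ?E (?l (adom h))) (Dom ?E (?l (acod h))) \<and> far P k = abase h \<and>
               Cmp ?E (?l (acod h)) k = Cmp ?E (atop h) (?l (adom h))"
      using k by (simp add: hom_def)
    fix k' assume "k' \<in> hom ?E (Dom ?E (?l (adom h))) (Dom ?E (?l (acod h))) \<and> far P k' = abase h \<and>
               Cmp ?E (?l (acod h)) k' = Cmp ?E (atop h) (?l (adom h))"
    then have k': "k' \<in> Ar ?E" "Dom ?E k' = Dom ?E (?l (adom h))" "Cod ?E k' = Dom ?E (?l (acod h))"
      "far P k' = abase h" "Cmp ?E (?l (acod h)) k' = Cmp ?E (atop h) (?l (adom h))"
      unfolding hom_def by blast+
    from cartesian_cancel[OF P liftD(1)[OF P c comma_ArD(2)[OF h]] k'(1) k(1) _ k'(3) k(3)]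
    show "k' = k" unfolding k'(2,4,5) k(2,4,5) by blast
  qed
  then show ?thesis using h by (simp add: action_top_def Let_def lift_def)
qed

text \<open>Existence: for \<open>h\<close> = (s, f) from (b, u, x) to (c, v, y), the arrow f after
  the lift of u lies over P f u = v s and therefore factors through the lift of v over s.\<close>

lemma action_top_far:
  assumes P: "is_func P" and c: "cleavage P \<delta>" and h: "h \<in> Ar (comma P)"
  shows "far (action_top (P, \<delta>)) h \<in> Ar (fdom P)" (is ?c1)
    "Dom (fdom P) (far (action_top (P, \<delta>)) h) = Dom (fdom P) (lift (P, \<delta>) (adom h))" (is ?c2)
    "Cod (fdom P) (far (action_top (P, \<delta>)) h) = Dom (fdom P) (lift (P, \<delta>) (acod h))" (is ?c3)
    "far P (far (action_top (P, \<delta>)) h) = abase h" (is ?c4)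
    "Cmp (fdom P) (lift (P, \<delta>) (acod h)) (far (action_top (P, \<delta>)) h) = Cmp (fdom P) (atop h) (lift (P, \<delta>) (adom h))" (is ?c5)
proof -
  let ?E = "fdom P" and ?l = "lift (P, \<delta>)"
  note l = liftD[OF P c comma_ArD(1)[OF h]] liftD[OF P c comma_ArD(2)[OF h]]
  note [simp] = P comma_ArD[OF h] l(2-5,7-10)
  have "\<exists>!k. k \<in> hom ?E (Dom ?E (Cmp ?E (atop h) (?l (adom h)))) (Dom ?E (?l (acod h))) \<and>
      Cmp ?E (?l (acod h)) k = Cmp ?E (atop h) (?l (adom h)) \<and> far P k = abase h"
    by (rule cartesian_lift[OF l(6)]) (use comma_Ar_square[OF h] in simp_all)
  then obtain k where k: "k \<in> Ar (fdom P)" "Dom (fdom P) k = Dom (fdom P) (lift (P, \<delta>) (adom h))"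
      "Cod (fdom P) k = Dom (fdom P) (lift (P, \<delta>) (acod h))" "far P k = abase h"
      "Cmp (fdom P) (lift (P, \<delta>) (acod h)) k = Cmp (fdom P) (atop h) (lift (P, \<delta>) (adom h))"
    by (auto simp: hom_def)
  show ?c1 ?c2 ?c3 ?c4 ?c5
    unfolding action_top_far_eqI[OF P c h k] by (rule k)+
qed

text \<open>The composite of the two values satisfies the square that characterizes the value on the
  composite.\<close>

lemma is_func_action_top:
  assumes P: "is_func P" and c: "cleavage P \<delta>"
  shows "is_func (action_top (P, \<delta>))"
proof -
  let ?A = "action_top (P, \<delta>)" and ?E = "fdom P" and ?l = "lift (P, \<delta>)"
  note [simp] = P comma_ArD[of _ P] comma_ObD[of _ P] comma_Ob_cbase[OF P] liftD(2-5)[OF P c] action_top_far(1-4)[OF P c]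
  have i: "far ?A (Idn (comma P) X) = Idn ?E (fob ?A X)" if X: "X \<in> Ob (comma P)" for X
    by (rule action_top_far_eqI[OF P c]) (use X in simp_all)
  have m: "far ?A (Cmp (comma P) g f) = Cmp ?E (far ?A g) (far ?A f)"
    if f: "f \<in> Ar (comma P)" and g: "g \<in> Ar (comma P)" and m: "acod f = adom g" for f g
  proof (rule action_top_far_eqI[OF P c])
    show "Cmp (comma P) g f \<in> Ar (comma P)" by (rule comma_Cmp_Ar[OF P f g m])
    have "Cmp ?E (?l (acod g)) (Cmp ?E (far ?A g) (far ?A f)) = Cmp ?E (Cmp ?E (?l (acod g)) (far ?A g)) (far ?A f)"
      by (rule ls_assoc[symmetric]) (use f g m in simp_all)
    also have "\<dots> = Cmp ?E (Cmp ?E (atop g) (?l (acod f))) (far ?A f)"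
      by (simp add: action_top_far(5)[OF P c g] m)
    also have "\<dots> = Cmp ?E (atop g) (Cmp ?E (?l (acod f)) (far ?A f))"
      by (rule ls_assoc) (use f g m in simp_all)
    also have "\<dots> = Cmp ?E (atop g) (Cmp ?E (atop f) (?l (adom f)))"
      by (simp add: action_top_far(5)[OF P c f])
    also have "\<dots> = Cmp ?E (Cmp ?E (atop g) (atop f)) (?l (adom f))"
      by (rule ls_assoc[symmetric]) (use f g m in simp_all)
    finally show "Cmp ?E (?l (acod (Cmp (comma P) g f))) (Cmp ?E (far ?A g) (far ?A f))
        = Cmp ?E (atop (Cmp (comma P) g f)) (?l (adom (Cmp (comma P) g f)))"
      using f g m by simp
  qed (use f g m in simp_all)
  have ext: "fob ?A \<in> extensional (Ob (comma P))" "far ?A \<in> extensional (Ar (comma P))"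
    by (simp_all add: action_top_def Let_def)
  show ?thesis
    unfolding is_func_def Let_def action_top_sel
  proof (intro conjI ballI impI ext i)
    fix f g assume "f \<in> Ar (comma P)" "g \<in> Ar (comma P)" "Cod (comma P) f = Dom (comma P) g"
    then show "far ?A (Cmp (comma P) g f) = Cmp ?E (far ?A g) (far ?A f)"
      by (intro m) simp_all
  qed simp_all
qed

text \<open>The algebra laws for the total component alone, the base component being an
  identity.\<close>

definition comma_action :: "'u::universe func \<Rightarrow> 'u func \<Rightarrow> bool" where
  "comma_action P A \<longleftrightarrow> square (DomF P) P A (func_id (fcod P)) \<and>
     func_comp A (comma_J P) = func_id (fdom P) \<and>
     func_comp A (comma_M P) = func_comp A (comma_map (DomF P) P A (func_id (fcod P)))"

lemma algebras_comma:
  "a \<in> algebras CAT2 comma_monad \<longleftrightarrow> osrc a = DomF (otgt a) \<and>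
     snd (und a) = func_id (fcod (otgt a)) \<and> comma_action (otgt a) (fst (und a))"
proof (cases "und a")
  case (Pair A S)
  let ?P = "otgt a"
  \<comment> \<open>The unit has base component an identity, so in the base the unit law of an
    algebra reads S 1 = 1.\<close>
  have S: "S = func_id (fcod ?P)" if "square (DomF ?P) ?P A S" "func_comp S (func_id (fcod ?P)) = func_id (fcod ?P)"
    using that squareD[OF that(1)] by simp
  have id: "func_comp (func_id (fcod ?P)) (func_id (fcod ?P)) = func_id (fcod ?P)" if "is_func ?P"
    using that by simp
  have "a \<in> algebras CAT2 comma_monad \<longleftrightarrow> square (DomF ?P) ?P A S \<and> osrc a = DomF ?P \<and>
      func_comp A (comma_J ?P) = func_id (fdom ?P) \<and> func_comp S (func_id (fcod ?P)) = func_id (fcod ?P) \<and>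
      func_comp A (comma_M ?P) = func_comp A (comma_map (DomF ?P) ?P A S) \<and>
      func_comp S (func_id (fcod ?P)) = func_comp S S"
    by (auto simp: algebras_def comma_monad_def CAT2_cell1 Pair)
  also have "\<dots> \<longleftrightarrow> osrc a = DomF ?P \<and> S = func_id (fcod ?P) \<and> comma_action ?P A"
    using S id squareD(1,2)[of "DomF ?P" ?P A S] unfolding comma_action_def by metis
  finally show ?thesis by (simp add: Pair)
qed

text \<open>On objects the two algebra laws come from the two splitting equations for lifts; on
  arrows both sides solve the same factorization problem.\<close>

lemma comma_action_action_top:
  assumes P: "is_func P" and s: "split_cleavage P \<delta>"
  shows "comma_action P (action_top (P, \<delta>))"
proof -
  let ?A = "action_top (P, \<delta>)" and ?E = "fdom P" and ?B = "fcod P" and ?l = "lift (P, \<delta>)"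
  note c = split_cleavageD(1)[OF s]
  note A = is_func_action_top[OF P c]
  note [simp] = P A comma_ArD[of _ P] comma_ObD[of _ P] comma_Ob_cbase[OF P] liftD(2-5)[OF P c] action_top_far(1-4)[OF P c]
    comma_DomF_ObD[of _ P] comma_DomF_ArD[of _ P]
  have sq: "square (DomF P) P ?A (func_id ?B)"
    by (simp add: square_def)
  note [simp] = is_func_comma_map[OF sq]
  have lJ: "?l (comma_J_ob P x) = Idn ?E x" if "x \<in> Ob ?E" for x
    using split_cleavageD(2)[OF s that] by (simp add: lift_def)
  have J: "func_comp ?A (comma_J P) = func_id ?E"
  proof (rule func_eqI)
    fix f assume "f \<in> Ar (fdom (func_comp ?A (comma_J P)))"
    then have f: "f \<in> Ar ?E" by simp
    have "far (comma_J P) f \<in> Ar (comma P)" using f by (intro is_func_rules) simp_all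
    then have "far ?A (far (comma_J P) f) = f"
      by (rule action_top_far_eqI[OF P c]) (use f in \<open>simp_all add: lJ del: carr_in_comma\<close>)
    then show "far (func_comp ?A (comma_J P)) f = far (func_id ?E) f"
      using f by (simp del: comma_J_sel(4))
  qed (simp_all add: lJ)
  \<comment> \<open>For Z = (a, t, (b, u, x)) the action sends Z to (a, t, \<open>u^*x\<close>), so
    this is the splitting equation for the composite \<open>u t\<close>.\<close>
  have lM: "?l (comma_M_ob P Z) = Cmp ?E (?l (ctop Z)) (?l (comma_ob ?A (func_id ?B) Z))"
    if Z: "Z \<in> Ob (comma (DomF P))" for Z
    using split_cleavageD(3)[OF s, of "ctop (ctop Z)" "cmor (ctop Z)" "cmor Z"] Z
    by (simp add: lift_def)
  have M: "func_comp ?A (comma_M P) = func_comp ?A (comma_map (DomF P) P ?A (func_id ?B))"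
  proof (rule func_eqI)
    show "is_func (func_comp ?A (comma_map (DomF P) P ?A (func_id ?B)))" by simp
    fix Z assume "Z \<in> Ob (fdom (func_comp ?A (comma_M P)))"
    then have Z: "Z \<in> Ob (comma (DomF P))" by simp
    have W: "comma_ob ?A (func_id ?B) Z \<in> Ob (comma P)" by (rule comma_ob_in[OF sq Z])
    show "fob (func_comp ?A (comma_M P)) Z = fob (func_comp ?A (comma_map (DomF P) P ?A (func_id ?B))) Z"
      using Z W comma_M_ob_in[OF P Z] by (simp add: lM)
  next
    fix k assume "k \<in> Ar (fdom (func_comp ?A (comma_M P)))"
    then have k: "k \<in> Ar (comma (DomF P))" by simp
    let ?Z = "adom k" and ?Z' = "acod k"
    let ?W = "comma_ob ?A (func_id ?B) ?Z" and ?W' = "comma_ob ?A (func_id ?B) ?Z'"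
    have W: "?W \<in> Ob (comma P)" "?W' \<in> Ob (comma P)"
      by (rule comma_ob_in[OF sq]; use k in simp)+
    note m = comma_map_in[OF sq k]
    have bk: "abase k \<in> Ar ?B" using k by simp
    \<comment> \<open>The value prescribed by the other side of the law: \<open>k\<close>
      transported by the action and then acted upon. It is the candidate for the action on
      \<open>comma_M_arr P k\<close>.\<close>
    define r where "r = far ?A (carr ?W ?W' (far (func_id ?B) (abase k)) (far ?A (atop k)))"
    have r: "r \<in> Ar ?E" "Dom ?E r = Dom ?E (?l ?W)" "Cod ?E r = Dom ?E (?l ?W')" "far P r = abase k"
      "Cmp ?E (?l ?W') r = Cmp ?E (far ?A (atop k)) (?l ?W)"
      unfolding r_def using action_top_far[OF P c m] bk by simp_all
    have lZ: "?l (ctop ?Z) \<in> Ar ?E" "?l (ctop ?Z') \<in> Ar ?E" "?l ?W \<in> Ar ?E" "?l ?W' \<in> Ar ?E"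
       "Cod ?E (?l ?W) = Dom ?E (?l (ctop ?Z))" "Cod ?E (?l ?W') = Dom ?E (?l (ctop ?Z'))"
       "Cod ?E (?l (ctop ?Z)) = ctop (ctop ?Z)"
      using k W by simp_all
    have fk: "far ?A (atop k) \<in> Ar ?E" "Dom ?E (far ?A (atop k)) = Dom ?E (?l (ctop ?Z))"
       "Cod ?E (far ?A (atop k)) = Dom ?E (?l (ctop ?Z'))"
      "Cmp ?E (?l (ctop ?Z')) (far ?A (atop k)) = Cmp ?E (atop (atop k)) (?l (ctop ?Z))"
      using k action_top_far(5)[OF P c, of "atop k"] by simp_all
    have tk: "atop (atop k) \<in> Ar ?E" "Dom ?E (atop (atop k)) = ctop (ctop ?Z)"
      using k by simp_all
    \<comment> \<open>The square defining \<open>r\<close> is stacked on the square defining the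
      action on the top component of \<open>k\<close>; by \<open>lM\<close> the outer legs are lifts
      of composites.\<close>
    have "Cmp ?E (Cmp ?E (?l (ctop ?Z')) (?l ?W')) r = Cmp ?E (?l (ctop ?Z')) (Cmp ?E (?l ?W') r)"
      by (rule ls_assoc) (use lZ r in simp_all)
    also have "\<dots> = Cmp ?E (Cmp ?E (?l (ctop ?Z')) (far ?A (atop k))) (?l ?W)"
      unfolding r(5) by (rule ls_assoc[symmetric]) (use lZ fk in simp_all)
    also have "\<dots> = Cmp ?E (atop (atop k)) (Cmp ?E (?l (ctop ?Z)) (?l ?W))"
      unfolding fk(4) by (rule ls_assoc) (use lZ tk in simp_all)
    finally have eq: "Cmp ?E (Cmp ?E (?l (ctop ?Z')) (?l ?W')) r = Cmp ?E (atop (atop k)) (Cmp ?E (?l (ctop ?Z)) (?l ?W))" .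
    have lMZ: "?l (comma_M_ob P ?Z) = Cmp ?E (?l (ctop ?Z)) (?l ?W)" "?l (comma_M_ob P ?Z') = Cmp ?E (?l (ctop ?Z')) (?l ?W')"
      using k by (simp_all add: lM)
    have "far ?A (carr (comma_M_ob P ?Z) (comma_M_ob P ?Z') (abase k) (atop (atop k))) = r"
      by (rule action_top_far_eqI[OF P c comma_M_in[OF P k]])
        (use r lZ eq in \<open>simp_all add: lMZ\<close>)
    then show "far (func_comp ?A (comma_M P)) k = far (func_comp ?A (comma_map (DomF P) P ?A (func_id ?B))) k"
      using k by (simp add: r_def)
  qed simp_all
  show ?thesis
    using sq J M by (simp add: comma_action_def)
qed

subsection \<open>From actions to split cleavages\<close>

definition canonical :: "'u::universe func \<Rightarrow> 'u \<Rightarrow> 'u \<Rightarrow> 'u" where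
  "canonical P x u = carr (cobj (Dom (fcod P) u) u x) (comma_J_ob P x) u (Idn (fdom P) x)"

text \<open>Restriction to \<open>liftable P\<close> makes the lifts extensional, as
  \<open>cleavage\<close> demands; only then can passing to the action and back return the same
  function.\<close>

definition cleave :: "'u::universe func \<Rightarrow> 'u func \<Rightarrow> 'u \<times> 'u \<Rightarrow> 'u" where
  "cleave P A = (\<lambda>(x, u)\<in>liftable P. far A (canonical P x u))"

lemma cleave_sel:
  "\<lbrakk>x \<in> Ob (fdom P); u \<in> Ar (fcod P); Cod (fcod P) u = fob P x\<rbrakk> \<Longrightarrow> cleave P A (x, u) = far A (canonical P x u)"
  by (simp add: cleave_def liftable_def)

lemma canonical_sel [simp]:
  "adom (canonical P x u) = cobj (Dom (fcod P) u) u x" "acod (canonical P x u) = comma_J_ob P x" "abase (canonical P x u) = u"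
  "atop (canonical P x u) = Idn (fdom P) x"
  by (simp_all add: canonical_def)

lemma canonical_in:
  "\<lbrakk>is_func P; x \<in> Ob (fdom P); u \<in> Ar (fcod P); Cod (fcod P) u = fob P x\<rbrakk> \<Longrightarrow> canonical P x u \<in> Ar (comma P)"
  by (simp add: canonical_def)

text \<open>The functor equations evaluated on codes: the action lies over the domain projection,
  then the unit law on objects and arrows, the multiplication law on arrows, and the effect of the
  2-functor on comma objects.\<close>

lemma comma_actionD:
  assumes a: "comma_action P A"
  shows "is_func P" "is_func A" "fdom A = comma P" "fcod A = fdom P"
    "\<And>X. X \<in> Ob (comma P) \<Longrightarrow> fob P (fob A X) = cbase X"
    "\<And>h. h \<in> Ar (comma P) \<Longrightarrow> far P (far A h) = abase h"
    "\<And>x. x \<in> Ob (fdom P) \<Longrightarrow> fob A (comma_J_ob P x) = x"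
    "\<And>f. f \<in> Ar (fdom P) \<Longrightarrow>
      far A (carr (comma_J_ob P (Dom (fdom P) f)) (comma_J_ob P (Cod (fdom P) f)) (far P f) f) = f"
    "\<And>k. k \<in> Ar (comma (DomF P)) \<Longrightarrow>
      far A (comma_M_arr P k)
      = far A (carr (comma_ob A (func_id (fcod P)) (adom k)) (comma_ob A (func_id (fcod P)) (acod k)) (abase k) (far A (atop k)))"
    "\<And>Z. Z \<in> Ob (comma (DomF P)) \<Longrightarrow> comma_ob A (func_id (fcod P)) Z = cobj (cbase Z) (cmor Z) (fob A (ctop Z))"
proof -
  have sq: "square (DomF P) P A (func_id (fcod P))"
    and J: "func_comp A (comma_J P) = func_id (fdom P)"
    and M: "func_comp A (comma_M P) = func_comp A (comma_map (DomF P) P A (func_id (fcod P)))"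
    using a by (simp_all add: comma_action_def)
  show P: "is_func P" and A: "is_func A" and d: "fdom A = comma P" "fcod A = fdom P"
    using squareD[OF sq] by simp_all
  show "fob P (fob A X) = cbase X" if "X \<in> Ob (comma P)" for X
    using squareD(9)[OF sq, of X] that comma_Ob_cbase[OF P that] by simp
  show "far P (far A h) = abase h" if "h \<in> Ar (comma P)" for h
    using squareD(10)[OF sq, of h] that comma_ArD(3)[OF that] by simp
  show "fob A (comma_J_ob P x) = x" if "x \<in> Ob (fdom P)" for x
    using arg_cong[OF J, of "\<lambda>F. fob F x"] that by simp
  show "far A (carr (comma_J_ob P (Dom (fdom P) f)) (comma_J_ob P (Cod (fdom P) f)) (far P f) f) = f"
    if "f \<in> Ar (fdom P)" for f
    using arg_cong[OF J, of "\<lambda>F. far F f"] that by simp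
  show "far A (comma_M_arr P k)
      = far A (carr (comma_ob A (func_id (fcod P)) (adom k)) (comma_ob A (func_id (fcod P)) (acod k)) (abase k) (far A (atop k)))"
    if "k \<in> Ar (comma (DomF P))" for k
    using arg_cong[OF M, of "\<lambda>F. far F k"] that comma_DomF_ArD(3)[OF that] by simp
  show "comma_ob A (func_id (fcod P)) Z = cobj (cbase Z) (cmor Z) (fob A (ctop Z))"
    if "Z \<in> Ob (comma (DomF P))" for Z
    using that comma_Ob_cbase[OF is_func_DomF[OF P] that] comma_DomF_ObD[OF that]
    by (simp add: comma_ob_def)
qed

lemma comma_action_Cmp:
  assumes a: "comma_action P A" and "h \<in> Ar (comma P)" "k \<in> Ar (comma P)" "acod h = adom k"
  shows "Cmp (fdom P) (far A k) (far A h) = far A (carr (adom h) (acod k) (Cmp (fcod P) (abase k) (abase h)) (Cmp (fdom P) (atop k) (atop h)))"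
  using far_Cmp[OF comma_actionD(2)[OF a], of h k] assms comma_actionD(1,3,4)[OF a] by simp

lemma comma_action_far:
  assumes a: "comma_action P A" and h: "h \<in> Ar (comma P)"
  shows "far A h \<in> Ar (fdom P)" "Dom (fdom P) (far A h) = fob A (adom h)" "Cod (fdom P) (far A h) = fob A (acod h)"
  using far_Ar[OF comma_actionD(2)[OF a], of h] Dom_far[OF comma_actionD(2)[OF a], of h]
    Cod_far[OF comma_actionD(2)[OF a], of h] h comma_actionD(3,4)[OF a] by simp_all

text \<open>Both sides of the multiplication law are compared on the arrow \<open>(1, (u, 1))\<close> from \<open>(b, 1, (b, u, x))\<close>
  to \<open>(b, u, J x)\<close>.\<close>

lemma comma_action_lift:
  assumes a: "comma_action P A" and x: "x \<in> Ob (fdom P)" and u: "u \<in> Ar (fcod P)" "Cod (fcod P) u = fob P x"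
  defines "X \<equiv> cobj (Dom (fcod P) u) u x"
  shows "carr (comma_J_ob P (fob A X)) X (Idn (fcod P) (Dom (fcod P) u)) (far A (canonical P x u)) \<in> Ar (comma P)"
    and "far A (carr (comma_J_ob P (fob A X)) X (Idn (fcod P) (Dom (fcod P) u)) (far A (canonical P x u))) = Idn (fdom P) (fob A X)"
proof -
  let ?B = "fcod P" and ?E = "fdom P"
  let ?b = "Dom ?B u"
  note P = comma_actionD(1)[OF a] and A = comma_actionD(2)[OF a]
  have X: "X \<in> Ob (comma P)" using x u by (simp add: X_def)
  note c = canonical_in[OF P x u]
  have J: "fob A (comma_J_ob P x) = x" by (rule comma_actionD(7)[OF a x])
  note [simp] = P A x u comma_actionD(3,4)[OF a] X c
  have cX: "cbase X = ?b" "cmor X = u" "ctop X = x" by (simp_all add: X_def)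
  have AX: "fob A X \<in> Ob ?E" "fob P (fob A X) = ?b" using comma_actionD(5)[OF a X] cX by simp_all
  have e: "far A (canonical P x u) \<in> Ar ?E" "Dom ?E (far A (canonical P x u)) = fob A X" "Cod ?E (far A (canonical P x u)) = x"
    "far P (far A (canonical P x u)) = u"
    using comma_action_far[OF a c] comma_actionD(6)[OF a c] J by (simp_all add: X_def)
  show 1: "carr (comma_J_ob P (fob A X)) X (Idn ?B ?b) (far A (canonical P x u)) \<in> Ar (comma P)"
    using AX e cX by simp
  define \<kappa> where "\<kappa> = carr (cobj ?b (Idn ?B ?b) X) (cobj ?b u (comma_J_ob P x)) (Idn ?B ?b) (canonical P x u)"
  have \<kappa>: "\<kappa> \<in> Ar (comma (DomF P))"
    using cX by (simp add: \<kappa>_def) (simp add: X_def)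
  \<comment> \<open>Both ends of \<kappa> multiply to X, because u 1 = u = 1 u; hence the
    multiplication sends \<kappa> to an identity.\<close>
  have "comma_M_ob P (cobj ?b (Idn ?B ?b) X) = X" "comma_M_ob P (cobj ?b u (comma_J_ob P x)) = X"
    by (simp_all add: comma_M_ob_def X_def)
  then have "far A (carr X X (Idn ?B ?b) (Idn ?E x))
    = far A (carr (comma_ob A (func_id ?B) (adom \<kappa>)) (comma_ob A (func_id ?B) (acod \<kappa>)) (Idn ?B ?b) (far A (canonical P x u)))"
    using comma_actionD(9)[OF a \<kappa>] by (simp add: \<kappa>_def)
  \<comment> \<open>The other side of the law sends the source to (b, 1, A X), which is J (A X)
    since A X lies over b, and the target to (b, u, A (J x)) = X.\<close>
  moreover have "comma_ob A (func_id ?B) (adom \<kappa>) = comma_J_ob P (fob A X)"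
    using comma_actionD(10)[OF a comma_DomF_ArD(1)[OF \<kappa>]] AX by (simp add: \<kappa>_def comma_J_ob_def)
  moreover have "comma_ob A (func_id ?B) (acod \<kappa>) = X"
    using comma_actionD(10)[OF a comma_DomF_ArD(2)[OF \<kappa>]] J by (simp add: \<kappa>_def X_def)
  moreover have "far A (carr X X (Idn ?B ?b) (Idn ?E x)) = Idn ?E (fob A X)"
    using far_Idn[OF A, of X] cX by simp
  ultimately show "far A (carr (comma_J_ob P (fob A X)) X (Idn ?B ?b) (far A (canonical P x u))) = Idn ?E (fob A X)"
    by simp
qed

lemma canonical_far:
  assumes a: "comma_action P A" and x: "x \<in> Ob (fdom P)" and u: "u \<in> Ar (fcod P)" "Cod (fcod P) u = fob P x"
  shows "far A (canonical P x u) \<in> Ar (fdom P)" "Dom (fdom P) (far A (canonical P x u)) = fob A (cobj (Dom (fcod P) u) u x)"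
    "Cod (fdom P) (far A (canonical P x u)) = x" "far P (far A (canonical P x u)) = u"
  using comma_action_far[OF a canonical_in[OF comma_actionD(1)[OF a] x u]] comma_actionD(7)[OF a x]
    comma_actionD(6)[OF a canonical_in[OF comma_actionD(1)[OF a] x u]] by simp_all

lemma cartesian_canonical:
  assumes a: "comma_action P A" and x: "x \<in> Ob (fdom P)" and u: "u \<in> Ar (fcod P)" "Cod (fcod P) u = fob P x"
  shows "cartesian P (far A (canonical P x u))"
  unfolding cartesian_def Let_def
proof (intro conjI ballI impI)
  let ?B = "fcod P" and ?E = "fdom P" and ?e = "far A (canonical P x u)"
  let ?X = "cobj (Dom ?B u) u x"
  note P = comma_actionD(1)[OF a] and A = comma_actionD(2)[OF a]
  note c = canonical_in[OF P x u] and e = canonical_far[OF a x u] and l = comma_action_lift[OF a x u]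
  have X: "?X \<in> Ob (comma P)" using x u by simp
  have AX: "fob A ?X \<in> Ob ?E" "fob P (fob A ?X) = Dom ?B u"
    using comma_actionD(5)[OF a X] fob_Ob[OF A, of ?X] X comma_actionD(3,4)[OF a] by simp_all
  show "?e \<in> Ar ?E" by (rule e(1))
  fix g v assume g: "g \<in> Ar ?E" and v: "v \<in> Ar ?B" and "Cod ?E g = Cod ?E ?e \<and> Dom ?B v = fob P (Dom ?E g) \<and>
    Cod ?B v = fob P (Dom ?E ?e) \<and> far P g = Cmp ?B (far P ?e) v"
  then have gv: "Cod ?E g = x" "Dom ?B v = fob P (Dom ?E g)" "Cod ?B v = Dom ?B u" "far P g = Cmp ?B u v"
    using e AX by simp_all
  let ?y = "Dom ?E g"
  \<comment> \<open>The factorization problem read as an arrow (v, g) from J y to (b, u, x); its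
    square is exactly P g = u v.\<close>
  define w where "w = carr (comma_J_ob P ?y) ?X v g"
  have w: "w \<in> Ar (comma P)"
    using P x u g v gv by (simp add: w_def)
  have wc: "adom w = comma_J_ob P ?y" "acod w = ?X" "abase w = v" "atop w = g" by (simp_all add: w_def)
  show "\<exists>!h. h \<in> hom ?E (Dom ?E g) (Dom ?E ?e) \<and> Cmp ?E ?e h = g \<and> far P h = v"
  proof (rule ex1I)
    have y: "?y \<in> Ob ?E" using P g by simp
    have "Cmp ?E ?e (far A w) = far A (carr (comma_J_ob P ?y) (comma_J_ob P x) (Cmp ?B u v) (Cmp ?E (Idn ?E x) g))"
      using comma_action_Cmp[OF a w c] wc by simp
    also have "\<dots> = g"
      using comma_actionD(8)[OF a g] P g gv by simp
    finally show "far A w \<in> hom ?E (Dom ?E g) (Dom ?E ?e) \<and> Cmp ?E ?e (far A w) = g \<and> far P (far A w) = v"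
      using comma_action_far[OF a w] comma_actionD(6)[OF a w] comma_actionD(7)[OF a y] wc e
      by (simp add: hom_def)
    fix h assume "h \<in> hom ?E (Dom ?E g) (Dom ?E ?e) \<and> Cmp ?E ?e h = g \<and> far P h = v"
    then have h: "h \<in> Ar ?E" "Dom ?E h = ?y" "Cod ?E h = fob A ?X" "Cmp ?E ?e h = g" "far P h = v"
      using e by (auto simp: hom_def)
    \<comment> \<open>A competitor \<open>h\<close> is the value of the action on J h, so composing
      with it can be carried out in the comma category.\<close>
    let ?Jh = "carr (comma_J_ob P ?y) (comma_J_ob P (fob A ?X)) v h"
    have Jh: "?Jh \<in> Ar (comma P)"
      using P h AX y v gv by simp
    have "h = Cmp ?E (Idn ?E (fob A ?X)) h"
      using P h by simp
    also have "\<dots> = Cmp ?E (far A (carr (comma_J_ob P (fob A ?X)) ?X (Idn ?B (Dom ?B u)) ?e)) (far A ?Jh)"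
      using comma_actionD(8)[OF a h(1)] h l(2) by simp
    also have "\<dots> = far A (carr (comma_J_ob P ?y) ?X (Cmp ?B (Idn ?B (Dom ?B u)) v) (Cmp ?E ?e h))"
      using comma_action_Cmp[OF a Jh l(1)] by simp
    also have "\<dots> = far A w"
      using P v gv h by (simp add: w_def)
    finally show "h = far A w" .
  qed
qed

lemma split_cleavage_cleave:
  assumes a: "comma_action P A"
  shows "split_cleavage P (cleave P A)"
proof (rule split_cleavageI)
  let ?B = "fcod P" and ?E = "fdom P"
  show P: "is_func P" by (rule comma_actionD(1)[OF a])
  note A = comma_actionD(2)[OF a]
  show "cleavage P (cleave P A)"
    using canonical_far[OF a] cartesian_canonical[OF a]
    by (auto simp: cleavage_def liftable_def cleave_sel cleave_def)
  show "cleave P A (x, Idn ?B (fob P x)) = Idn ?E x" if x: "x \<in> Ob ?E" for x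
  proof -
    \<comment> \<open>For an identity u the object (b, u, x) is J x itself.\<close>
    have "canonical P x (Idn ?B (fob P x)) = Idn (comma P) (comma_J_ob P x)"
      using P x by (simp add: canonical_def comma_J_ob_def)
    then show ?thesis
      using P A x comma_actionD(3,4,7)[OF a] by (simp add: cleave_sel del: comma_sel(3))
  qed
  fix x u v assume x: "x \<in> Ob ?E" and u: "u \<in> Ar ?B" "Cod ?B u = fob P x" and v: "v \<in> Ar ?B" "Cod ?B v = Dom ?B u"
  let ?X = "cobj (Dom ?B u) u x" and ?e = "far A (canonical P x u)"
  note e = canonical_far[OF a x u]
  have X: "?X \<in> Ob (comma P)" using x u by simp
  have AX: "fob A ?X \<in> Ob ?E" "fob P (fob A ?X) = Dom ?B u"
    using comma_actionD(5)[OF a X] fob_Ob[OF A, of ?X] X comma_actionD(3,4)[OF a] by simp_all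
  have uv: "Cmp ?B u v \<in> Ar ?B" "Dom ?B (Cmp ?B u v) = Dom ?B v" "Cod ?B (Cmp ?B u v) = fob P x"
    using P u v by simp_all
  have vA: "Cod ?B v = fob P (fob A ?X)" using v AX by simp
  \<comment> \<open>The arrow (u v, (u, 1)) from (c, v, (b, u, x)) to J (J x). The multiplication
    sends it to the canonical arrow of \<open>u v\<close>, while applying the action inside yields
    (u v, e) from (c, v, \<open>u^*x\<close>) to J x, with e the lift of u.\<close>
  define \<kappa> where "\<kappa> = carr (cobj (Dom ?B v) v ?X) (comma_J_ob (DomF P) (comma_J_ob P x)) (Cmp ?B u v) (canonical P x u)"
  have \<kappa>: "\<kappa> \<in> Ar (comma (DomF P))"
    using P x u v uv canonical_in[OF P x u] by (simp add: \<kappa>_def)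
  have M: "comma_M_ob P (cobj (Dom ?B v) v ?X) = cobj (Dom ?B v) (Cmp ?B u v) x"
     "comma_M_ob P (comma_J_ob (DomF P) (comma_J_ob P x)) = comma_J_ob P x"
    using P x by (simp_all add: comma_M_ob_def) (simp add: comma_J_ob_def)
  have F: "comma_ob A (func_id ?B) (cobj (Dom ?B v) v ?X) = cobj (Dom ?B v) v (fob A ?X)"
    using comma_actionD(10)[OF a comma_DomF_ArD(1)[OF \<kappa>]] by (simp add: \<kappa>_def)
  have F': "comma_ob A (func_id ?B) (comma_J_ob (DomF P) (comma_J_ob P x)) = comma_J_ob P x"
    using comma_actionD(10)[OF a comma_DomF_ArD(2)[OF \<kappa>]] comma_actionD(7)[OF a x] P x
    by (simp add: \<kappa>_def) (simp add: comma_J_ob_def)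
  \<comment> \<open>The arrow (u v, e) factors as the canonical arrow of v followed by J e, and the
    action returns e on J e.\<close>
  let ?Je = "carr (comma_J_ob P (fob A ?X)) (comma_J_ob P x) u ?e"
  have Je: "?Je \<in> Ar (comma P)" using P x u AX e by simp
  have "far A (canonical P x (Cmp ?B u v)) = far A (carr (cobj (Dom ?B v) v (fob A ?X)) (comma_J_ob P x) (Cmp ?B u v) ?e)"
    using comma_actionD(9)[OF a \<kappa>] uv M F F' by (simp add: \<kappa>_def canonical_def)
  also have "\<dots> = Cmp ?E (far A ?Je) (far A (canonical P (fob A ?X) v))"
    using comma_action_Cmp[OF a canonical_in[OF P AX(1) v(1) vA] Je] P e by simp
  also have "far A ?Je = ?e"
    using comma_actionD(8)[OF a e(1)] e by simp
  finally show "cleave P A (x, Cmp ?B u v) = Cmp ?E (cleave P A (x, u)) (cleave P A (Dom ?E (cleave P A (x, u)), v))"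
    using x u v uv AX vA e by (simp add: cleave_sel)
qed

text \<open>The given action satisfies the equation that characterizes the reconstructed one: it is
  functorial, and \<open>h\<close> followed by a canonical arrow equals a canonical arrow followed
  by J of the top component.\<close>

lemma action_top_cleave:
  assumes a: "comma_action P A"
  shows "action_top (P, cleave P A) = A"
proof (rule func_eqI)
  let ?B = "fcod P" and ?E = "fdom P" and ?l = "lift (P, cleave P A)"
  note P = comma_actionD(1)[OF a] and c = split_cleavageD(1)[OF split_cleavage_cleave[OF a]]
  show "is_func (action_top (P, cleave P A))" by (rule is_func_action_top[OF P c])
  show "is_func A" by (rule comma_actionD(2)[OF a])
  show "fdom (action_top (P, cleave P A)) = fdom A" "fcod (action_top (P, cleave P A)) = fcod A"
    using comma_actionD(3,4)[OF a] by simp_all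
  have l: "?l X = far A (canonical P (ctop X) (cmor X))" if "X \<in> Ob (comma P)" for X
    using comma_ObD[OF that] by (simp add: lift_def cleave_sel)
  have cX: "canonical P (ctop X) (cmor X) \<in> Ar (comma P)" "adom (canonical P (ctop X) (cmor X)) = X" if "X \<in> Ob (comma P)" for X
    using canonical_in[OF P comma_ObD(1,2,4)[OF that]] comma_ObD(3)[OF that] cobj_collapse[OF that] by simp_all
  have ob: "Dom ?E (?l X) = fob A X" if "X \<in> Ob (comma P)" for X
    using comma_action_far(2)[OF a cX(1)[OF that]] cX(2)[OF that] l[OF that] by simp
  then show "fob (action_top (P, cleave P A)) X = fob A X" if "X \<in> Ob (fdom (action_top (P, cleave P A)))" for X
    using that by simp
  fix h assume "h \<in> Ar (fdom (action_top (P, cleave P A)))"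
  then have h: "h \<in> Ar (comma P)" by simp
  note h' = comma_ArD[OF h]
  let ?x = "ctop (adom h)" and ?y = "ctop (acod h)"
  let ?Jf = "carr (comma_J_ob P ?x) (comma_J_ob P ?y) (far P (atop h)) (atop h)"
  have Jf: "?Jf \<in> Ar (comma P)" using P h' comma_ObD[of _ P] by simp
  have "Cmp ?E (?l (acod h)) (far A h)
      = far A (carr (adom h) (comma_J_ob P ?y) (Cmp ?B (cmor (acod h)) (abase h)) (Cmp ?E (Idn ?E ?y) (atop h)))"
    using comma_action_Cmp[OF a h cX(1)[OF h'(2)]] cX(2)[OF h'(2)] l[OF h'(2)] by simp
  \<comment> \<open>The commuting square of \<open>h\<close> equates the two base components; the
    top components agree by the identity laws.\<close>
  also have "\<dots> = far A (carr (adom h) (comma_J_ob P ?y) (Cmp ?B (far P (atop h)) (cmor (adom h))) (Cmp ?E (atop h) (Idn ?E ?x)))"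
    using P h' comma_Ar_square[OF h] by simp
  also have "\<dots> = Cmp ?E (far A ?Jf) (far A (canonical P ?x (cmor (adom h))))"
    using comma_action_Cmp[OF a cX(1)[OF h'(1)] Jf] cX(2)[OF h'(1)] by simp
  also have "\<dots> = Cmp ?E (atop h) (?l (adom h))"
    using comma_actionD(8)[OF a h'(4)] h'(7,8) l[OF h'(1)] by simp
  finally have "Cmp ?E (?l (acod h)) (far A h) = Cmp ?E (atop h) (?l (adom h))" .
  then show "far (action_top (P, cleave P A)) h = far A h"
    using comma_action_far[OF a h] comma_actionD(6)[OF a h] ob h'
    by (intro action_top_far_eqI[OF P c h]) simp_all
qed

text \<open>The target of a canonical arrow is J x, whose chosen lift is an identity by splitting.
  The equation for the action therefore reads 1 k = 1 \<delta>, so k is the lift itself.\<close>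

lemma cleave_action_top:
  assumes P: "is_func P" and s: "split_cleavage P \<delta>"
  shows "cleave P (action_top (P, \<delta>)) = \<delta>"
proof (rule extensionalityI)
  let ?B = "fcod P" and ?E = "fdom P" and ?l = "lift (P, \<delta>)"
  note c = split_cleavageD(1)[OF s]
  show "cleave P (action_top (P, \<delta>)) \<in> extensional (liftable P)" by (simp add: cleave_def)
  show "\<delta> \<in> extensional (liftable P)" using c by (simp add: cleavage_def)
  fix z assume "z \<in> liftable P"
  then obtain x u where z: "z = (x, u)" and xu: "x \<in> Ob ?E" "u \<in> Ar ?B" "Cod ?B u = fob P x"
    by (auto simp: liftable_def)
  note d = cleavageD[OF P c xu]
  have l: "?l (cobj (Dom ?B u) u x) = \<delta> (x, u)" "?l (comma_J_ob P x) = Idn ?E x"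
    using split_cleavageD(2)[OF s xu(1)] by (simp_all add: lift_def)
  have "far (action_top (P, \<delta>)) (canonical P x u) = \<delta> (x, u)"
    by (rule action_top_far_eqI[OF P c canonical_in[OF P xu]]) (use P xu d in \<open>simp_all add: l\<close>)
  then show "cleave P (action_top (P, \<delta>)) z = \<delta> z"
    using xu by (simp add: z cleave_sel)
qed

subsection \<open>The comparison 2-functor\<close>

text \<open>If \<open>T\<close> preserves lifts, it carries the square characterizing one action to
  the square characterizing the other. Conversely, evaluating the algebra equation at canonical
  arrows gives back the preservation of lifts.\<close>

lemma split_morphism_iff_action:
  assumes P: "is_func P" "split_cleavage P \<delta>" and Q: "is_func Q" "split_cleavage Q \<gamma>" and s: "square P Q T S"
  shows "(\<forall>(x, u)\<in>liftable P. far T (\<delta> (x, u)) = \<gamma> (fob T x, far S u)) \<longleftrightarrow>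
    func_comp T (action_top (P, \<delta>)) = func_comp (action_top (Q, \<gamma>)) (comma_map P Q T S)"
    (is "?l \<longleftrightarrow> func_comp T ?A = func_comp ?A' ?F")
proof
  let ?B = "fcod P" and ?E = "fdom P"
  note c = split_cleavageD(1)[OF P(2)] and c' = split_cleavageD(1)[OF Q(2)]
  note [simp] = squareD[OF s] is_func_action_top[OF P(1) c] is_func_action_top[OF Q(1) c'] is_func_comma_map[OF s]
  note A = comma_action_action_top[OF P] and A' = comma_action_action_top[OF Q]
  show "func_comp T ?A = func_comp ?A' ?F" if ?l
  proof (rule func_eqI)
    have l: "far T (lift (P, \<delta>) X) = lift (Q, \<gamma>) (comma_ob T S X)" if "X \<in> Ob (comma P)" for X
      using \<open>?l\<close> comma_ObD[OF that] by (auto simp: lift_def liftable_def)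
    have lD: "lift (P, \<delta>) X \<in> Ar ?E" "Cod ?E (lift (P, \<delta>) X) = ctop X"
      "Dom (fdom Q) (lift (Q, \<gamma>) (comma_ob T S X)) = fob T (Dom ?E (lift (P, \<delta>) X))"
      if "X \<in> Ob (comma P)" for X
      using liftD[OF P(1) c that] by (simp_all flip: l[OF that])
    show "fob (func_comp T ?A) X = fob (func_comp ?A' ?F) X" if "X \<in> Ob (fdom (func_comp T ?A))" for X
      using that comma_ob_in[OF s, of X] lD(3)[of X] by simp
    fix h assume "h \<in> Ar (fdom (func_comp T ?A))"
    then have h: "h \<in> Ar (comma P)" by simp
    note h' = comma_ArD[OF h]
    note k = action_top_far[OF P(1) c h]
    have "Cmp (fdom Q) (lift (Q, \<gamma>) (comma_ob T S (acod h))) (far T (far ?A h))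
        = far T (Cmp ?E (lift (P, \<delta>) (acod h)) (far ?A h))"
      using k(1-4) h' lD by (simp add: l)
    also have "\<dots> = Cmp (fdom Q) (far T (atop h)) (lift (Q, \<gamma>) (comma_ob T S (adom h)))"
      unfolding k(5) using h' lD by (simp add: l)
    finally have "far ?A' (comma_arr T S h) = far T (far ?A h)"
      by (intro action_top_far_eqI[OF Q(1) c' comma_map_in[OF s h]]) (use k h' lD(3) in simp_all)
    then show "far (func_comp T ?A) h = far (func_comp ?A' ?F) h"
      using h by simp
  qed simp_all
  show ?l if eq: "func_comp T ?A = func_comp ?A' ?F"
  proof clarify
    fix x u assume "(x, u) \<in> liftable P"
    then have xu: "x \<in> Ob ?E" "u \<in> Ar ?B" "Cod ?B u = fob P x" by (auto simp: liftable_def)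
    note i = canonical_in[OF P(1) xu]
    have xu': "fob T x \<in> Ob (fdom Q)" "far S u \<in> Ar (fcod Q)" "Cod (fcod Q) (far S u) = fob Q (fob T x)"
      using xu by simp_all
    \<comment> \<open>With this, the functor on comma categories sends canonical arrows to canonical
      arrows.\<close>
    have "comma_ob T S (comma_J_ob P x) = comma_J_ob Q (fob T x)"
      using xu by (simp add: comma_ob_def) (simp add: comma_J_ob_def)
    then have "far ?F (canonical P x u) = canonical Q (fob T x) (far S u)"
      using i xu by (simp add: canonical_def comma_ob_def)
    then have "far T (far ?A (canonical P x u)) = far ?A' (canonical Q (fob T x) (far S u))"
      using arg_cong[OF eq, of "\<lambda>F. far F (canonical P x u)"] i by simp
    then show "far T (\<delta> (x, u)) = \<gamma> (fob T x, far S u)"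
      using cleave_sel[OF xu, of ?A] cleave_sel[OF xu', of ?A'] cleave_action_top[OF P] cleave_action_top[OF Q]
      by simp
  qed
qed

text \<open>This is why split fibrations need no condition on 2-cells. The component of \<beta> at
  the domain of a lift lies over the component of \<alpha> at b, and naturality at that lift makes
  it the value of the action on the pair of components.\<close>

lemma action_top_natural:
  assumes P: "is_func P" "split_cleavage P \<delta>" and Q: "is_func Q" "split_cleavage Q \<gamma>" and n: "square_nt P Q \<beta> \<alpha>"
    and s: "func_comp (ndom \<beta>) (action_top (P, \<delta>)) = func_comp (action_top (Q, \<gamma>)) (comma_map P Q (ndom \<beta>) (ndom \<alpha>))"
    and t: "func_comp (ncod \<beta>) (action_top (P, \<delta>)) = func_comp (action_top (Q, \<gamma>)) (comma_map P Q (ncod \<beta>) (ncod \<alpha>))"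
  shows "nt_hcomp \<beta> (nt_id (action_top (P, \<delta>))) = nt_hcomp (nt_id (action_top (Q, \<gamma>))) (comma_nt P Q \<beta> \<alpha>)"
proof -
  let ?E = "fdom P" and ?A = "action_top (P, \<delta>)" and ?A' = "action_top (Q, \<gamma>)"
  note c = split_cleavageD(1)[OF P(2)] and c' = split_cleavageD(1)[OF Q(2)]
  note s' = square_ntD(3)[OF n] and t' = square_ntD(4)[OF n]
  note [simp] = squareD[OF s'] squareD[OF t'] square_ntD(1,2,5)[OF n] square_ntD(1)[OF square_nt_comma_nt[OF n]]
    is_func_action_top[OF P(1) c] is_func_action_top[OF Q(1) c']
  have "far ?A' (ncmp (comma_nt P Q \<beta> \<alpha>) X) = ncmp \<beta> (fob ?A X)" if X: "X \<in> Ob (comma P)" for X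
  proof -
    note l = liftD[OF P(1) c X]
    have A: "fob ?A X \<in> Ob ?E" "fob ?A X = Dom ?E (lift (P, \<delta>) X)" "fob P (Dom ?E (lift (P, \<delta>) X)) = cbase X"
      using X l by simp_all
    \<comment> \<open>The boundary 1-cells are given as algebra morphisms, but naturality at a lift
      needs them as functors preserving lifts.\<close>
    have lT: "far T (lift (P, \<delta>) X) = lift (Q, \<gamma>) (comma_ob T S X)"
      if T: "square P Q T S" "func_comp T ?A = func_comp ?A' (comma_map P Q T S)" for T S
    proof -
      have "(ctop X, cmor X) \<in> liftable P" using comma_ObD[OF X] by (simp add: liftable_def)
      then show ?thesis
        using split_morphism_iff_action[OF P Q T(1)] T(2) by (auto simp: lift_def)
    qed
    note ls = lT[OF s' s] and lt = lT[OF t' t]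
    have d: "Dom (fdom Q) (lift (Q, \<gamma>) (comma_ob (ndom \<beta>) (ndom \<alpha>) X)) = fob (ndom \<beta>) (fob ?A X)"
      "Dom (fdom Q) (lift (Q, \<gamma>) (comma_ob (ncod \<beta>) (ncod \<alpha>) X)) = fob (ncod \<beta>) (fob ?A X)"
      using l by (simp_all add: A flip: ls lt)
    \<comment> \<open>Naturality of \<beta> at the lift of X, with its images under the two boundary
      functors recognized as chosen lifts.\<close>
    have "Cmp (fdom Q) (lift (Q, \<gamma>) (comma_ob (ncod \<beta>) (ncod \<alpha>) X)) (ncmp \<beta> (fob ?A X))
        = Cmp (fdom Q) (ncmp \<beta> (ctop X)) (lift (Q, \<gamma>) (comma_ob (ndom \<beta>) (ndom \<alpha>) X))"
      using nt_natural[OF square_ntD(1)[OF n], of "lift (P, \<delta>) X"] l by (simp add: ls lt A)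
    then have "far ?A' (comma_cmp \<beta> \<alpha> X)
        = ncmp \<beta> (fob ?A X)"
      by (intro action_top_far_eqI[OF Q(1) c' comma_nt_in[OF n X]])
        (use A d in \<open>simp_all del: action_top_sel(3)\<close>)
    then show ?thesis using X by simp
  qed
  then have "nt_hcomp (nt_id ?A') (comma_nt P Q \<beta> \<alpha>) = nt_hcomp \<beta> (nt_id ?A)"
    by (subst whisker_eq_iff) (simp_all add: s t)
  then show ?thesis by simp
qed

section \<open>The 2-category of split fibrations and the isomorphism\<close>

abbreviation split_fibs :: "'u::universe splitfib set" where
  "split_fibs \<equiv> {(P, \<delta>). is_func P \<and> split_cleavage P \<delta>}"

lemma SFib_eq: "SFib = structured CAT2 split_fibs fst
     (\<lambda>X Y h. \<forall>(x, u)\<in>liftable (fst X). far (fst (und h)) (snd X (x, u)) = snd Y (fob (fst (und h)) x, far (snd (und h)) u))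
     (\<lambda>_ _ _. True)"
  by (simp add: SFib_def case_prod_unfold)

text \<open>Preservation of lifts is stable under composition because a square maps liftable pairs
  to liftable pairs, so the condition on the second square can be applied to the image.\<close>

lemma two_category_SFib: "two_category SFib"
  unfolding SFib_eq
proof (rule two_category_structured[OF two_category_CAT2])
  fix Z :: "'a splitfib" assume "Z \<in> split_fibs"
  then obtain P \<delta> where Z: "Z = (P, \<delta>)" and P: "is_func P" "split_cleavage P \<delta>" by auto
  note d = cleavageD(2)[OF P(1) split_cleavageD(1)[OF P(2)]]
  show "fst Z \<in> cell0 CAT2" using P by (simp add: Z CAT2_cell0)
  show "\<forall>(x, u)\<in>liftable (fst Z). far (fst (und (id1 CAT2 (fst Z)))) (snd Z (x, u))
      = snd Z (fob (fst (und (id1 CAT2 (fst Z)))) x, far (snd (und (id1 CAT2 (fst Z)))) u)"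
    using P d by (auto simp: Z liftable_def)
next
  fix X Y Z :: "'a splitfib" and f g :: "'a sq"
  assume X: "X \<in> split_fibs"
    and c: "f \<in> cell1 CAT2" "g \<in> cell1 CAT2" "dom1 CAT2 f = fst X" "cod1 CAT2 f = fst Y" "dom1 CAT2 g = fst Y" "cod1 CAT2 g = fst Z"
    and f: "\<forall>(x, u)\<in>liftable (fst X). far (fst (und f)) (snd X (x, u)) = snd Y (fob (fst (und f)) x, far (snd (und f)) u)"
    and g: "\<forall>(x, u)\<in>liftable (fst Y). far (fst (und g)) (snd Y (x, u)) = snd Z (fob (fst (und g)) x, far (snd (und g)) u)"
  obtain P \<delta> where X': "X = (P, \<delta>)" and P: "is_func P" "split_cleavage P \<delta>" using X by auto
  have s: "square P (fst Y) (fst (und f)) (snd (und f))" using c(1,3,4) by (simp add: CAT2_cell1 X')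
  note [simp] = squareD[OF s]
  show "\<forall>(x, u)\<in>liftable (fst X). far (fst (und (comp1 CAT2 g f))) (snd X (x, u))
      = snd Z (fob (fst (und (comp1 CAT2 g f))) x, far (snd (und (comp1 CAT2 g f))) u)"
  proof clarify
    fix x u assume "(x, u) \<in> liftable (fst X)"
    then have xu: "x \<in> Ob (fdom P)" "u \<in> Ar (fcod P)" "Cod (fcod P) u = fob P x" by (auto simp: X' liftable_def)
    have "far (fst (und f)) (\<delta> (x, u)) = snd Y (fob (fst (und f)) x, far (snd (und f)) u)"
      using f xu by (auto simp: X' liftable_def)
    moreover have "(fob (fst (und f)) x, far (snd (und f)) u) \<in> liftable (fst Y)"
      using xu by (simp add: liftable_def)
    ultimately show "far (fst (und (comp1 CAT2 g f))) (snd X (x, u))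
      = snd Z (fob (fst (und (comp1 CAT2 g f))) x, far (snd (und (comp1 CAT2 g f))) u)"
      using g xu cleavageD(2)[OF P(1) split_cleavageD(1)[OF P(2)] xu] by (auto simp: X')
  qed
qed simp_all

lemma action_sel [simp]:
  "osrc (action Z) = DomF (fst Z)" "otgt (action Z) = fst Z" "und (action Z) = (action_top Z, func_id (fcod (fst Z)))"
  by (simp_all add: action_def)

text \<open>The inverse retains the codomain of the action and reads a cleavage from its total
  component. The domain and the base component carry no further information, by
  \<open>algebras_comma\<close>.\<close>

lemma bij_betw_action:
  "bij_betw action split_fibs (algebras CAT2 comma_monad)"
proof (rule bij_betw_byWitness[where f' = "\<lambda>a. (otgt a, cleave (otgt a) (fst (und a)))"])
  show "\<forall>Z\<in>split_fibs. (otgt (action Z), cleave (otgt (action Z)) (fst (und (action Z)))) = Z"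
    by (auto simp: cleave_action_top)
  show "\<forall>a\<in>algebras CAT2 comma_monad. action (otgt a, cleave (otgt a) (fst (und a))) = a"
    by (auto simp: algebras_comma tagged_eq_iff action_top_cleave intro: prod_eqI)
  show "action ` split_fibs \<subseteq> algebras CAT2 comma_monad"
    by (auto simp: algebras_comma comma_action_action_top)
  show "(\<lambda>a. (otgt a, cleave (otgt a) (fst (und a)))) ` algebras CAT2 comma_monad \<subseteq> split_fibs"
    by (auto simp: algebras_comma split_cleavage_cleave comma_actionD(1))
qed

lemma two_iso_over_Gamma_f:
  "two_iso_over CAT2 SFib U_SFib (Alg CAT2 comma_monad) (forget (cod1 CAT2)) Gamma_f"
proof -
  have T: "two_functor CAT2 CAT2 (mfun comma_monad)"
    by (simp add: comma_monad_def two_functor_comma_fun)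
  show ?thesis
    unfolding SFib_eq U_SFib_def Alg_def Gamma_f_def
  proof (rule two_iso_over_structured[OF two_category_CAT2 _ two_category_SFib[unfolded SFib_eq] two_category_Alg[OF T, unfolded Alg_def] bij_betw_action])
    fix X Y :: "'a splitfib" and f :: "'a sq"
    assume X: "X \<in> split_fibs" and Y: "Y \<in> split_fibs"
      and f: "f \<in> cell1 CAT2" "dom1 CAT2 f = fst X" "cod1 CAT2 f = fst Y"
    obtain P \<delta> Q \<gamma> where XY: "X = (P, \<delta>)" "Y = (Q, \<gamma>)"
      and P: "is_func P" "split_cleavage P \<delta>" and Q: "is_func Q" "split_cleavage Q \<gamma>"
      using X Y by auto
    have s: "square P Q (fst (und f)) (snd (und f))" using f by (simp add: CAT2_cell1 XY)
    show "comp1 CAT2 f (action X) = comp1 CAT2 (action Y) (map1 (mfun comma_monad) f) \<longleftrightarrow>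
      (\<forall>(x, u)\<in>liftable (fst X). far (fst (und f)) (snd X (x, u)) = snd Y (fob (fst (und f)) x, far (snd (und f)) u))"
      using split_morphism_iff_action[OF P Q s] squareD[OF s] f by (simp add: XY comma_monad_def)
  next
    fix X Y :: "'a splitfib" and \<theta> :: "'a sq2"
    assume X: "X \<in> split_fibs" and Y: "Y \<in> split_fibs"
      and \<theta>: "\<theta> \<in> cell2 CAT2" "dom1 CAT2 (dom2 CAT2 \<theta>) = fst X" "cod1 CAT2 (dom2 CAT2 \<theta>) = fst Y"
      and s: "\<forall>(x, u)\<in>liftable (fst X). far (fst (und (dom2 CAT2 \<theta>))) (snd X (x, u))
          = snd Y (fob (fst (und (dom2 CAT2 \<theta>))) x, far (snd (und (dom2 CAT2 \<theta>))) u)"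
      and t: "\<forall>(x, u)\<in>liftable (fst X). far (fst (und (cod2 CAT2 \<theta>))) (snd X (x, u))
          = snd Y (fob (fst (und (cod2 CAT2 \<theta>))) x, far (snd (und (cod2 CAT2 \<theta>))) u)"
    obtain P \<delta> Q \<gamma> where XY: "X = (P, \<delta>)" "Y = (Q, \<gamma>)"
      and P: "is_func P" "split_cleavage P \<delta>" and Q: "is_func Q" "split_cleavage Q \<gamma>"
      using X Y by auto
    have n: "square_nt P Q (fst (und \<theta>)) (snd (und \<theta>))" using \<theta> by (simp add: CAT2_cell2 XY)
    note sq = square_ntD(3)[OF n] and tq = square_ntD(4)[OF n]
    have top: "nt_hcomp (fst (und \<theta>)) (nt_id (action_top (P, \<delta>)))
        = nt_hcomp (nt_id (action_top (Q, \<gamma>))) (comma_nt P Q (fst (und \<theta>)) (snd (und \<theta>)))"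
      by (rule action_top_natural[OF P Q n])
        (use s t in \<open>simp_all add: XY flip: split_morphism_iff_action[OF P Q sq] split_morphism_iff_action[OF P Q tq]\<close>)
    have base: "nt_hcomp (snd (und \<theta>)) (nt_id (func_id (fcod P))) = nt_hcomp (nt_id (func_id (fcod Q))) (snd (und \<theta>))"
      by (rule sym, subst whisker_eq_iff) (use squareD[OF sq] squareD[OF tq] square_ntD[OF n] in simp_all)
    \<comment> \<open>The condition of \<open>SFib\<close> on 2-cells is \<open>True\<close>, so the
      algebra equation must hold outright: \<open>top\<close> gives its total part,
      \<open>base\<close> its part in the bases.\<close>
    show "hcomp CAT2 \<theta> (id2 CAT2 (action X)) = hcomp CAT2 (id2 CAT2 (action Y)) (map2 (mfun comma_monad) \<theta>) \<longleftrightarrow> True"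
      using top base \<theta> by (simp add: XY comma_monad_def)
  qed (auto simp: CAT2_cell0)
qed

theorem corollary7p2:
  shows "two_monad (CAT2 :: ('u::universe func, 'u sq, 'u sq2) twocat) comma_monad \<and>
         two_iso_over (CAT2 :: ('u func, 'u sq, 'u sq2) twocat)
           SFib U_SFib (Alg CAT2 comma_monad) (forget (cod1 CAT2)) Gamma_f \<and>
         strictly_two_monadic (SFib :: ('u splitfib, _, _) twocat) CAT2 U_SFib"
  using two_monad_comma two_iso_over_Gamma_f strictly_two_monadicI[OF two_monad_comma two_iso_over_Gamma_f]
  by blast

end
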